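(* Let $\alpha\in(\alpha_c,\bar\alpha)$ and assume the following. (A1) For all $\theta\in\Theta$ and $q\in\{1,\dots,Q\}$, under $P_{\theta^*}$ the random variable $\ell_q(X,\theta)$ is continuous (its distribution has no atoms); in addition, the function $t\mapsto \mathbb{P}_{\theta^*}(T(X,\theta)<t)$ is (strictly) increasing on $(\alpha_c,\bar\alpha)$. (A2) For $P_{\theta^*}$-almost all $x\in\mathbb{R}^d$, the map $u\in\mathcal{U}\mapsto f_u(x)$ is continuous. (A3) There exist positive constants $r=r(\theta^* )$, $C_1=C_1(\theta^* )$, $C_2=C_2(\theta^*,\alpha)$, $C_3=C_3(\theta^*,\alpha)$ such that: (i) for $\mathbb{P}_{\theta^*}$-almost all $x$, $u\in\mathcal{U}\mapsto f_u(x)$ is continuously differentiable, and $\sum_{1\le q\le Q}\mathbb{E}_{\theta^*}\sup_{\theta\in\Theta,\|\theta-\theta^*\|\le r}\|\nabla_\theta\ell_q(X,\theta)\|\le C_1$; (ii) for all $t,t'\in[0,1]$, $|\mathbb{P}_{\theta^*}(T(X,\theta^* )<t)-\mathbb{P}_{\theta^*}(T(X,\theta^* )<t')|\le C_2|t-t'|$; (iii) for all $\beta\in[(\alpha_c+\alpha)/2,(\alpha+\bar\alpha)/2]$, $|t^*(\beta)-t^*(\alpha)|\le C_3|\beta-\alpha|$. (A4) The VC dimensions $\mathscr{V}$ and $\mathscr{V}_-$ are finite. Consider an estimator $\hat\theta$ of $\theta^*$ which takes its values in a countable subset $\mathcal{D}$ of $\Theta$ and which is consistent in the sense that, for all $\epsilon>0$,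 $\eta(\epsilon,\theta^* )=\mathbb{P}_{\theta^*}\big(\min_{\sigma\in[Q]}\|\hat\theta^\sigma-\theta^*\|_2\ge\epsilon\big)$ tends to $0$ as $n\to\infty$. Let $s^*=\mathbb{P}_{\theta^*}\big(T(X,\theta^* )<t^*((\alpha+\alpha_c)/2)\big)$. Then, with constants $A>0$ and $B>0$ only depending on $Q,C_1,C_2,C_3,\mathscr{V},\mathscr{V}_-$ and $s^*$, we have for any sequence $\epsilon_n>0$ tending to zero, for $n$ larger than a constant only depending on $\alpha$ and $\theta^*$, $$\mathrm{FMR}_{\theta^*}(\widehat{\mathcal{C}}^{\rm PI}_\alpha)\le\alpha+A\sqrt{\epsilon_n}+B\sqrt{\log n/n}+5/n^2+\eta(\epsilon_n,\theta^* ),$$ $$n^{-1}\mathbb{E}_{\theta^*}(|\widehat{S}^{\rm PI}_\alpha|)-n^{-1}\mathbb{E}_{\theta^*}(|S|)\ge-A\sqrt{\epsilon_n}-B\sqrt{\log n/n}-5/n^2-\eta(\epsilon_n,\theta^* ),$$ for any procedure $\mathcal{C}=(\widehat{\mathbf{Z}},S)$ that controls the mFMR at level $\alpha$, i.e. $\mathrm{mFMR}_{\theta^*}(\mathcal{C})\le\alpha$.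
   Context: Model. The number of classes $Q$ is fixed. $\{F_u,u\in\mathcal{U}\}$ is a family of distributions on $\mathbb{R}^d$ with Lebesgue densities $f_u$. A parameter is $\theta=(\pi,\phi)$ with $\pi=(\pi_1,\dots,\pi_Q)$ a probability vector with all $\pi_q>0$, and $\phi=(\phi_1,\dots,\phi_Q)\in\mathcal{U}^Q$ with distinct $\phi_q$'s; the parameter set $\Theta$ is an open subset of $\mathbb{R}^K$ for some $K\ge1$. $P_\theta$ is the law of $(Z,X)$ with $\mathbb{P}(Z=q)=\pi_q$ and $X\mid Z=q\sim F_{\phi_q}$. The true parameter $\theta^*\in\Theta$ is fixed; $(Z_i,X_i)$, $1\le i\le n$, are i.i.d. with law $P_{\theta^*}$; $\mathbf{X}=(X_1,\dots,X_n)$ is observed and $\mathbf{Z}=(Z_1,\dots,Z_n)$ is latent. $\mathbb{P}_{\theta^*},\mathbb{E}_{\theta^*}$ denote the corresponding probability and expectation. Posterior quantities: $\ell_q(X,\theta)=\mathbb{P}_\theta(Z=q\mid X)=\pi_qf_{\phi_q}(X)/\sum_{\ell=1}^Q\pi_\ell f_{\phi_\ell}(X)$ and $T(X,\theta)=1-\max_{1\le q\le Q}\ell_q(X,\theta)$. Procedures: a procedure is a pair $\mathcal{C}=(\widehat{\mathbf{Z}},S)$ of measurable functions of $\mathbf{X}$, with $\widehat{\mathbf{Z}}\in\{1,\dots,Q\}^n$ and $S\subset\{1,\dots,n\}$. $[Q]$ is the set of permutations of $\{1,\dots,Q\}$, $\sigma(\widehat{\mathbf{Z}})=(\sigma(\hat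 Z_i))_i$, and $\varepsilon_S(\widehat{\mathbf{Z}},\mathbf{Z})=\sum_{i\in S}\mathbf{1}\{Z_i\neq\hat Z_i\}$. Then $\mathrm{FMR}_{\theta^*}(\mathcal{C})=\mathbb{E}_{\theta^*}\big(\min_{\sigma\in[Q]}\mathbb{E}_{\theta^*}\big(\varepsilon_S(\sigma(\widehat{\mathbf{Z}}),\mathbf{Z})/\max(|S|,1)\mid\mathbf{X}\big)\big)$ and $\mathrm{mFMR}_{\theta^*}(\mathcal{C})=\mathbb{E}_{\theta^*}\big(\min_{\sigma\in[Q]}\mathbb{E}_{\theta^*}(\varepsilon_S(\sigma(\widehat{\mathbf{Z}}),\mathbf{Z})\mid\mathbf{X})\big)/\mathbb{E}_{\theta^*}(|S|)$, with $0/0=0$. Plug-in procedure $\widehat{\mathcal{C}}^{\rm PI}_\alpha=(\widehat{\mathbf{Z}}^{\rm PI},\widehat{S}^{\rm PI}_\alpha)$ at level $\alpha$ based on an estimator $\hat\theta=\hat\theta(\mathbf{X})\in\Theta$: $\hat Z_i^{\rm PI}\in\arg\max_q\ell_q(X_i,\hat\theta)$; $\hat T_i=T(X_i,\hat\theta)$ with order statistics $\hat T_{(1)}\le\dots\le\hat T_{(n)}$; $\hat k$ is the maximum of the $k\in\{0,\dots,n\}$ with $\max(k,1)^{-1}\sum_{j=1}^k\hat T_{(j)}\le\alpha$; $\widehat S_\alpha^{\rm PI}$ is the set of indices of the $\hat k$ smallest $\hat T_i$'s. Permuted parameter: for $\sigma\in[Q]$, $\theta^\sigma$ is $\theta$ with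 classes relabelled by $\sigma$, i.e. $\theta^\sigma=((\pi_{\sigma(q)})_q,(\phi_{\sigma(q)})_q)$. Critical levels and threshold: $\mathrm{mFMR}^*_t=\mathbb{E}_{\theta^*}(T(X,\theta^* )\mid T(X,\theta^* )<t)$ (equal to $0$ if the conditioning event has probability $0$), $t^*(\alpha)=\sup\{t\in[0,1]:\mathrm{mFMR}^*_t\le\alpha\}$, $\alpha_c=\inf\{\mathrm{mFMR}^*_t: t\in(0,1],\mathrm{mFMR}^*_t>0\}$, $\bar\alpha=\mathrm{mFMR}^*_1$. VC dimensions: the VC dimension of a set $\mathscr{F}$ of real functions on $\mathbb{R}^d$ is that of the set family $\{\{x:f(x)\ge u\},f\in\mathscr{F},u\in\mathbb{R}\}$. $\mathscr{V}$ is the VC dimension of $\{\ell_q(\cdot,\theta),\theta\in\Theta,1\le q\le Q\}$, and $\mathscr{V}_-$ is that of $\{\mathbf{1}\{\ell_q(\cdot,\theta)-\ell_{q'}(\cdot,\theta)\ge0\},\theta\in\Theta,1\le q,q'\le Q\}$.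
   Formalization: The bounds are stated for n ≥ N with ε_n ≤ ε_0, where N and ε_0 depend on the model, θ*, α and the constants of (A3) but not on the sequence; with no smallness condition on ε_n, a threshold for n independent of the sequence is impossible. *)

theory Defs
  imports "HOL-Probability.Probability" "HOL-Combinatorics.Permutations"
begin

section \<open>Analysis in coordinate spaces of variable dimension\<close>

text \<open>
  The constants of the theorem do not depend on the dimensions of the observation space and of the
  parameter space, so these dimensions are natural numbers and not types.  Points of the
  \<open>m\<close>-dimensional space are functions on the coordinates \<open>k < m\<close>: for topology the carrier is
  \<^term>\<open>Euclidean_space m\<close> (coordinates beyond \<open>m\<close> are zero), for measure theory it is
  the product measure below (coordinates beyond \<open>m\<close> are \<open>undefined\<close>).
\<close>

type_synonym rvec = "nat \<Rightarrow> real"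

definition leb :: "nat \<Rightarrow> rvec measure" where
  "leb m = Pi\<^sub>M {..<m} (\<lambda>_. lborel)"

definition edist :: "nat \<Rightarrow> rvec \<Rightarrow> rvec \<Rightarrow> real" where
  "edist m x y = L2_set (\<lambda>k. x k - y k) {..<m}"

definition has_gradient :: "nat \<Rightarrow> (rvec \<Rightarrow> real) \<Rightarrow> rvec \<Rightarrow> rvec \<Rightarrow> rvec set \<Rightarrow> bool" where
  "has_gradient m F g x S \<longleftrightarrow>
     (\<forall>e>0. \<exists>\<delta>>0. \<forall>y\<in>S. edist m y x < \<delta> \<longrightarrow>
        \<bar>F y - F x - (\<Sum>k<m. g k * (y k - x k))\<bar> \<le> e * edist m y x)"

text \<open>At interior points of \<open>S\<close> the coordinates \<open>k < m\<close> of the gradient are unique.\<close>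

definition gradient :: "nat \<Rightarrow> (rvec \<Rightarrow> real) \<Rightarrow> rvec set \<Rightarrow> rvec \<Rightarrow> rvec" where
  "gradient m F S x = (SOME g. has_gradient m F g x S)"

definition C1_on :: "nat \<Rightarrow> rvec set \<Rightarrow> (rvec \<Rightarrow> real) \<Rightarrow> bool" where
  "C1_on m S F \<longleftrightarrow>
     (\<exists>G. (\<forall>x\<in>S. has_gradient m F (G x) x S) \<and>
          (\<forall>k<m. continuous_map (subtopology (Euclidean_space m) S) euclideanreal (\<lambda>x. G x k)))"

section \<open>Vapnik-Chervonenkis dimension\<close>

definition shatters :: "'a set set \<Rightarrow> 'a set \<Rightarrow> bool" where
  "shatters \<C> A \<longleftrightarrow> (\<forall>B\<subseteq>A. \<exists>C\<in>\<C>. A \<inter> C = B)"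

definition vc_dim :: "'a set set \<Rightarrow> enat" where
  "vc_dim \<C> = Sup {enat (card A) |A. finite A \<and> shatters \<C> A}"

definition fun_vc_dim :: "'a set \<Rightarrow> ('a \<Rightarrow> real) set \<Rightarrow> enat" where
  "fun_vc_dim X \<F> = vc_dim {{x \<in> X. g x \<ge> u} |g u. g \<in> \<F>}"

section \<open>Mixture models\<close>

text \<open>
  A parameter is a pair \<open>(\<pi>, \<phi>)\<close> of families indexed by the classes \<open>{1..Q}\<close>.  Since \<open>\<pi>\<close> is
  constrained to a hyperplane, viewing a set of parameters as an open subset of a coordinate
  space requires a choice of coordinates, for instance \<open>(\<pi>\<^sub>1, \<dots>, \<pi>\<^sub>Q\<^sub>-\<^sub>1, \<phi>\<^sub>1, \<dots>, \<phi>\<^sub>Q)\<close>, or fewer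
  coordinates for a constrained model.  The field \<open>coord\<close> holds this choice; norms and gradients
  of parameters are taken in these coordinates.
\<close>

type_synonym param = "(nat \<Rightarrow> real) \<times> (nat \<Rightarrow> rvec)"

record mixture =
  nclass :: nat                         \<comment> \<open>\<open>Q\<close>\<close>
  xdim :: nat                           \<comment> \<open>dimension \<open>d\<close> of the observations\<close>
  udim :: nat                           \<comment> \<open>dimension of the space containing \<open>\<U>\<close>\<close>
  comps :: "rvec set"                   \<comment> \<open>\<open>\<U>\<close>\<close>
  dens :: "rvec \<Rightarrow> rvec \<Rightarrow> real"        \<comment> \<open>\<open>f\<^sub>u x\<close>\<close>
  pdim :: nat                           \<comment> \<open>\<open>K\<close>\<close>
  params :: "param set"                 \<comment> \<open>\<open>\<Theta>\<close>\<close>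
  coord :: "param \<Rightarrow> rvec"

abbreviation classes :: "mixture \<Rightarrow> nat set" where
  "classes M \<equiv> {1..nclass M}"

abbreviation perms :: "mixture \<Rightarrow> (nat \<Rightarrow> nat) set" where
  "perms M \<equiv> {\<sigma>. \<sigma> permutes classes M}"

definition relabel :: "(nat \<Rightarrow> nat) \<Rightarrow> param \<Rightarrow> param" where
  "relabel \<sigma> \<theta> = (fst \<theta> \<circ> \<sigma>, snd \<theta> \<circ> \<sigma>)"

text \<open>
  Relabelled parameters need not belong to the parameter set, but their coordinates are defined
  and determine them.
\<close>

definition mixture_model :: "mixture \<Rightarrow> bool" where
  "mixture_model M \<longleftrightarrow>
     comps M \<subseteq> topspace (Euclidean_space (udim M)) \<and>
     (\<forall>u\<in>comps M. dens M u \<in> borel_measurable (leb (xdim M)) \<and>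
        (\<forall>x\<in>space (leb (xdim M)). 0 \<le> dens M u x) \<and>
        (\<integral>\<^sup>+x. ennreal (dens M u x) \<partial>leb (xdim M)) = 1) \<and>
     (\<forall>(\<pi>, \<phi>)\<in>params M.
        \<pi> \<in> classes M \<rightarrow>\<^sub>E {0<..} \<and> (\<Sum>q\<in>classes M. \<pi> q) = 1 \<and>
        \<phi> \<in> classes M \<rightarrow>\<^sub>E comps M \<and> inj_on \<phi> (classes M)) \<and>
     1 \<le> pdim M \<and>
     (let H = (\<Union>\<sigma>\<in>perms M. relabel \<sigma> ` params M) in
        coord M ` H \<subseteq> topspace (Euclidean_space (pdim M)) \<and> inj_on (coord M) H) \<and>
     openin (Euclidean_space (pdim M)) (coord M ` params M)"

definition pdist :: "mixture \<Rightarrow> param \<Rightarrow> param \<Rightarrow> real" where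
  "pdist M \<theta> \<theta>' = edist (pdim M) (coord M \<theta>) (coord M \<theta>')"

text \<open>The law of \<open>(Z, X)\<close>.\<close>

definition joint :: "mixture \<Rightarrow> param \<Rightarrow> (nat \<times> rvec) measure" where
  "joint M \<theta> = density (count_space (classes M) \<Otimes>\<^sub>M leb (xdim M))
                  (\<lambda>(q, x). ennreal (fst \<theta> q * dens M (snd \<theta> q) x))"

definition obs_law :: "mixture \<Rightarrow> param \<Rightarrow> rvec measure" where
  "obs_law M \<theta> = distr (joint M \<theta>) (leb (xdim M)) snd"

definition post :: "mixture \<Rightarrow> param \<Rightarrow> nat \<Rightarrow> rvec \<Rightarrow> real" where
  "post M \<theta> q x = fst \<theta> q * dens M (snd \<theta> q) x / (\<Sum>l\<in>classes M. fst \<theta> l * dens M (snd \<theta> l) x)"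

definition Tstat :: "mixture \<Rightarrow> param \<Rightarrow> rvec \<Rightarrow> real" where
  "Tstat M \<theta> x = 1 - Max ((\<lambda>q. post M \<theta> q x) ` classes M)"

definition post_coord :: "mixture \<Rightarrow> nat \<Rightarrow> rvec \<Rightarrow> rvec \<Rightarrow> real" where
  "post_coord M q x y = post M (inv_into (params M) (coord M) y) q x"

definition grad_post_norm :: "mixture \<Rightarrow> param \<Rightarrow> nat \<Rightarrow> rvec \<Rightarrow> real" where
  "grad_post_norm M \<theta> q x =
     L2_set (gradient (pdim M) (post_coord M q x) (coord M ` params M) (coord M \<theta>)) {..<pdim M}"

section \<open>Samples, procedures and error rates\<close>

definition sample :: "mixture \<Rightarrow> param \<Rightarrow> nat \<Rightarrow> (nat \<Rightarrow> nat \<times> rvec) measure" where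
  "sample M \<theta> n = Pi\<^sub>M {1..n} (\<lambda>_. joint M \<theta>)"

definition obs_space :: "mixture \<Rightarrow> nat \<Rightarrow> (nat \<Rightarrow> rvec) measure" where
  "obs_space M n = Pi\<^sub>M {1..n} (\<lambda>_. leb (xdim M))"

definition obs :: "nat \<Rightarrow> (nat \<Rightarrow> nat \<times> rvec) \<Rightarrow> nat \<Rightarrow> rvec" where
  "obs n \<omega> = (\<lambda>i\<in>{1..n}. snd (\<omega> i))"

definition lab :: "(nat \<Rightarrow> nat \<times> rvec) \<Rightarrow> nat \<Rightarrow> nat" where
  "lab \<omega> i = fst (\<omega> i)"

text \<open>The conditional expectation given the observations.\<close>

definition cond_exp_obs ::
  "mixture \<Rightarrow> param \<Rightarrow> nat \<Rightarrow> ((nat \<Rightarrow> nat \<times> rvec) \<Rightarrow> real) \<Rightarrow> (nat \<Rightarrow> nat \<times> rvec) \<Rightarrow> real" where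
  "cond_exp_obs M \<theta> n =
     real_cond_exp (sample M \<theta> n)
       (vimage_algebra (space (sample M \<theta> n)) (obs n) (obs_space M n))"

type_synonym procedure = "((nat \<Rightarrow> rvec) \<Rightarrow> nat \<Rightarrow> nat) \<times> ((nat \<Rightarrow> rvec) \<Rightarrow> nat set)"

definition is_procedure :: "mixture \<Rightarrow> nat \<Rightarrow> procedure \<Rightarrow> bool" where
  "is_procedure M n C \<longleftrightarrow>
     (\<forall>i\<in>{1..n}. (\<lambda>x. fst C x i) \<in> obs_space M n \<rightarrow>\<^sub>M count_space (classes M)) \<and>
     snd C \<in> obs_space M n \<rightarrow>\<^sub>M count_space (Pow {1..n})"

definition misclass :: "nat set \<Rightarrow> (nat \<Rightarrow> nat) \<Rightarrow> (nat \<Rightarrow> nat) \<Rightarrow> real" where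
  "misclass S zhat z = (\<Sum>i\<in>S. of_bool (z i \<noteq> zhat i))"

definition FMR :: "mixture \<Rightarrow> param \<Rightarrow> nat \<Rightarrow> procedure \<Rightarrow> real" where
  "FMR M \<theta> n C =
     (\<integral>\<omega>. (MIN \<sigma>\<in>perms M.
          cond_exp_obs M \<theta> n
            (\<lambda>\<omega>. misclass (snd C (obs n \<omega>)) (\<sigma> \<circ> fst C (obs n \<omega>)) (lab \<omega>)
                  / real (max (card (snd C (obs n \<omega>))) 1)) \<omega>)
        \<partial>sample M \<theta> n)"

definition expected_size :: "mixture \<Rightarrow> param \<Rightarrow> nat \<Rightarrow> procedure \<Rightarrow> real" where
  "expected_size M \<theta> n C = (\<integral>\<omega>. real (card (snd C (obs n \<omega>))) \<partial>sample M \<theta> n)"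

definition mFMR :: "mixture \<Rightarrow> param \<Rightarrow> nat \<Rightarrow> procedure \<Rightarrow> real" where
  "mFMR M \<theta> n C =
     (\<integral>\<omega>. (MIN \<sigma>\<in>perms M.
          cond_exp_obs M \<theta> n
            (\<lambda>\<omega>. misclass (snd C (obs n \<omega>)) (\<sigma> \<circ> fst C (obs n \<omega>)) (lab \<omega>)) \<omega>)
        \<partial>sample M \<theta> n) / expected_size M \<theta> n C"

text \<open>
  The plug-in procedure.  The maximizing class and the order of equal values of the statistics
  may be ambiguous, hence a predicate: any measurable choice is allowed.
\<close>

definition order_stat :: "nat \<Rightarrow> (nat \<Rightarrow> real) \<Rightarrow> nat \<Rightarrow> real" where
  "order_stat n t j = sort (map t [1..<Suc n]) ! (j - 1)"

definition khat :: "nat \<Rightarrow> real \<Rightarrow> (nat \<Rightarrow> real) \<Rightarrow> nat" where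
  "khat n \<alpha> t = Max {k \<in> {0..n}. (\<Sum>j=1..k. order_stat n t j) / real (max k 1) \<le> \<alpha>}"

definition is_plugin :: "mixture \<Rightarrow> nat \<Rightarrow> real \<Rightarrow> ((nat \<Rightarrow> rvec) \<Rightarrow> param) \<Rightarrow> procedure \<Rightarrow> bool" where
  "is_plugin M n \<alpha> est C \<longleftrightarrow>
     is_procedure M n C \<and>
     (\<forall>x\<in>space (obs_space M n).
        let zhat = fst C x; S = snd C x; t = (\<lambda>i. Tstat M (est x) (x i)) in
          (\<forall>i\<in>{1..n}. is_arg_max (\<lambda>q. post M (est x) q (x i)) (\<lambda>q. q \<in> classes M) (zhat i)) \<and>
          S \<subseteq> {1..n} \<and> card S = khat n \<alpha> t \<and> (\<forall>i\<in>S. \<forall>j\<in>{1..n} - S. t i \<le> t j))"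

section \<open>Critical levels and thresholds\<close>

definition mFMR_thr :: "mixture \<Rightarrow> param \<Rightarrow> real \<Rightarrow> real" where
  "mFMR_thr M \<theta> t =
     (\<integral>x. Tstat M \<theta> x * of_bool (Tstat M \<theta> x < t) \<partial>obs_law M \<theta>)
       / \<P>(x in obs_law M \<theta>. Tstat M \<theta> x < t)"

definition t_star :: "mixture \<Rightarrow> param \<Rightarrow> real \<Rightarrow> real" where
  "t_star M \<theta> \<alpha> = Sup {t \<in> {0..1}. mFMR_thr M \<theta> t \<le> \<alpha>}"

definition alpha_c :: "mixture \<Rightarrow> param \<Rightarrow> real" where
  "alpha_c M \<theta> = Inf {mFMR_thr M \<theta> t |t. t \<in> {0<..1} \<and> mFMR_thr M \<theta> t > 0}"

definition alpha_bar :: "mixture \<Rightarrow> param \<Rightarrow> real" where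
  "alpha_bar M \<theta> = mFMR_thr M \<theta> 1"

definition s_star :: "mixture \<Rightarrow> param \<Rightarrow> real \<Rightarrow> real" where
  "s_star M \<theta> \<alpha> = \<P>(x in obs_law M \<theta>. Tstat M \<theta> x < t_star M \<theta> ((\<alpha> + alpha_c M \<theta>) / 2))"

section \<open>Assumptions and estimators\<close>

definition A1 :: "mixture \<Rightarrow> param \<Rightarrow> bool" where
  "A1 M \<theta>\<^sub>0 \<longleftrightarrow>
     (\<forall>\<theta>\<in>params M.
        (\<forall>q\<in>classes M. \<forall>c. \<P>(x in obs_law M \<theta>\<^sub>0. post M \<theta> q x = c) = 0) \<and>
        strict_mono_on {alpha_c M \<theta>\<^sub>0<..<alpha_bar M \<theta>\<^sub>0}
          (\<lambda>t. \<P>(x in obs_law M \<theta>\<^sub>0. Tstat M \<theta> x < t)))"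

definition A2 :: "mixture \<Rightarrow> param \<Rightarrow> bool" where
  "A2 M \<theta>\<^sub>0 \<longleftrightarrow>
     (AE x in obs_law M \<theta>\<^sub>0.
        continuous_map (subtopology (Euclidean_space (udim M)) (comps M)) euclideanreal
          (\<lambda>u. dens M u x))"

text \<open>
  The second conjunct of the first part makes the gradients of the third one exist; it is
  automatic, in smooth coordinates, where the mixture density does not vanish.
\<close>

definition A3 :: "mixture \<Rightarrow> param \<Rightarrow> real \<Rightarrow> real \<Rightarrow> real \<Rightarrow> real \<Rightarrow> real \<Rightarrow> bool" where
  "A3 M \<theta>\<^sub>0 \<alpha> r C\<^sub>1 C\<^sub>2 C\<^sub>3 \<longleftrightarrow>
     0 < r \<and> 0 < C\<^sub>1 \<and> 0 < C\<^sub>2 \<and> 0 < C\<^sub>3 \<and>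
     (AE x in obs_law M \<theta>\<^sub>0. C1_on (udim M) (comps M) (\<lambda>u. dens M u x)) \<and>
     (AE x in obs_law M \<theta>\<^sub>0. \<forall>q\<in>classes M. \<forall>\<theta>\<in>params M. pdist M \<theta> \<theta>\<^sub>0 \<le> r \<longrightarrow>
        (\<exists>g. has_gradient (pdim M) (post_coord M q x) g (coord M \<theta>) (coord M ` params M))) \<and>
     (\<Sum>q\<in>classes M.
        \<integral>\<^sup>+x. (SUP \<theta>\<in>{\<theta>\<in>params M. pdist M \<theta> \<theta>\<^sub>0 \<le> r}. ennreal (grad_post_norm M \<theta> q x))
          \<partial>obs_law M \<theta>\<^sub>0) \<le> ennreal C\<^sub>1 \<and>
     (\<forall>t\<in>{0..1}. \<forall>t'\<in>{0..1}.
        \<bar>\<P>(x in obs_law M \<theta>\<^sub>0. Tstat M \<theta>\<^sub>0 x < t) - \<P>(x in obs_law M \<theta>\<^sub>0. Tstat M \<theta>\<^sub>0 x < t')\<bar>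
          \<le> C\<^sub>2 * \<bar>t - t'\<bar>) \<and>
     (\<forall>\<beta>\<in>{(alpha_c M \<theta>\<^sub>0 + \<alpha>) / 2 .. (\<alpha> + alpha_bar M \<theta>\<^sub>0) / 2}.
        \<bar>t_star M \<theta>\<^sub>0 \<beta> - t_star M \<theta>\<^sub>0 \<alpha>\<bar> \<le> C\<^sub>3 * \<bar>\<beta> - \<alpha>\<bar>)"

definition vc_post :: "mixture \<Rightarrow> enat" where
  "vc_post M = fun_vc_dim (space (leb (xdim M)))
     {post M \<theta> q |\<theta> q. \<theta> \<in> params M \<and> q \<in> classes M}"

definition vc_diff :: "mixture \<Rightarrow> enat" where
  "vc_diff M = fun_vc_dim (space (leb (xdim M)))
     {(\<lambda>x. of_bool (post M \<theta> q x - post M \<theta> q' x \<ge> 0)) |\<theta> q q'.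
        \<theta> \<in> params M \<and> q \<in> classes M \<and> q' \<in> classes M}"

definition eta :: "mixture \<Rightarrow> param \<Rightarrow> nat \<Rightarrow> ((nat \<Rightarrow> rvec) \<Rightarrow> param) \<Rightarrow> real \<Rightarrow> real" where
  "eta M \<theta>\<^sub>0 n est \<epsilon> =
     \<P>(\<omega> in sample M \<theta>\<^sub>0 n. (MIN \<sigma>\<in>perms M. pdist M (relabel \<sigma> (est (obs n \<omega>))) \<theta>\<^sub>0) \<ge> \<epsilon>)"

text \<open>A sequence of estimators, one for each sample size.\<close>

definition consistent_estimator ::
  "mixture \<Rightarrow> param \<Rightarrow> param set \<Rightarrow> (nat \<Rightarrow> (nat \<Rightarrow> rvec) \<Rightarrow> param) \<Rightarrow> bool" where
  "consistent_estimator M \<theta>\<^sub>0 D est \<longleftrightarrow>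
     countable D \<and> D \<subseteq> params M \<and>
     (\<forall>n. est n \<in> obs_space M n \<rightarrow>\<^sub>M count_space D) \<and>
     (\<forall>\<epsilon>>0. (\<lambda>n. eta M \<theta>\<^sub>0 n (est n) \<epsilon>) \<longlonglongrightarrow> 0)"

end

theory Submission
  imports Defs
begin

text \<open>
  If the estimator is within \<open>\<epsilon>\<close> of the true parameter after relabelling, the mean value theorem
  bounds the change of each posterior probability at \<open>x\<close> by \<open>\<epsilon>\<close> times the supremum of its gradients
  at \<open>x\<close>.  This comparison is pointwise in \<open>x\<close> and uniform in the estimator, and by Markov's
  inequality the sample average of the bound is at most \<open>\<surd>\<epsilon>\<close> up to probability \<open>C\<^sub>1 \<surd>\<epsilon>\<close>; so
  concentration is needed only for averages of two fixed functions of \<open>T(X, \<theta>\<^sup>*)\<close>, and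
  Hoeffding's inequality provides it.

  Take the threshold \<open>t = t\<^sup>*(\<alpha> - \<delta>)\<close> with \<open>\<delta>\<close> of order \<open>(\<surd>\<epsilon> + \<surd>(log n / n)) / s\<^sup>*\<close>.  The expectation of
  \<open>(T - \<alpha>) 1{T < t}\<close> is at most \<open>-\<delta> s\<^sup>*\<close>, which absorbs all error terms: the indices with \<open>T\<^sub>i < t\<close> have
  average estimated statistic at most \<open>\<alpha>\<close>, and the plug-in procedure selects at least as many indices.
  By (A3) this loses at most \<open>C\<^sub>2 C\<^sub>3 \<delta>\<close> against thresholding at \<open>t\<^sup>*(\<alpha>)\<close>, which by a Neyman-Pearson
  argument is optimal among the procedures controlling the mFMR.
\<close>

(* Otherwise the simplifier turns {1..Q} into {Suc 0..Q}, which facts about the classes and the sample indices do not match. *)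
declare One_nat_def [simp del]

section \<open>Order statistics\<close>

text \<open>Inserting a data-dependent estimator destroys the independence of the summands.
  \<open>osc\<close> restores it: the supremum over all values that the estimator may take near the
  truth is a fixed function of the observation, measurable because these values are countable. The
  relabelling that brings the estimator near the truth is among the permutations over which the
  error rates minimise. Conditioning on the observations turns misclassification counts into sums of
  \<open>1 - post\<close> at the true parameter. These exceed the estimated statistics by at most
  the oscillations, and the plug-in rule keeps the average of the estimated statistics at most
  \<alpha>. The oscillations sum to n sqrt(\<epsilon>) at most but are divided by the size of the
  selection; therefore at least n s/2 indices must be selected, s being s*, and s enters the
  constants. With c = sqrt(ln n / n) each of the two Hoeffding bounds costs exp(-2 n c^2) = 1/n^2.
  Thresholds are studied through the sign of an expectation that is affine in the level, instead of
  the conditional expectation, a quotient that may be 0/0.\<close>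

lemma sum_least_subset:
  fixes t :: "'a \<Rightarrow> real"
  assumes "finite U" "A \<subseteq> U" "B \<subseteq> U" "card A = card B"
    and least: "\<And>i j. i \<in> A \<Longrightarrow> j \<in> U - A \<Longrightarrow> t i \<le> t j"
  shows "sum t A \<le> sum t B"
proof -
  have fin: "finite A" "finite B" using assms finite_subset by blast+
  have "card (A - B) = card (B - A)"
    using fin assms(4) card_Diff_subset_Int[of A B] card_Diff_subset_Int[of B A]
    by (simp add: Int_commute)
  \<comment> \<open>Equal cardinalities leave equally many indices in \<open>A - B\<close> and
    \<open>B - A\<close>; pairing them compares each index of \<open>A - B\<close> with one outside
    \<open>A\<close>.\<close>
  then obtain f where f: "bij_betw f (A - B) (B - A)"
    using fin finite_same_card_bij[of "A - B" "B - A"] by auto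
  have "sum t (A - B) \<le> (\<Sum>i\<in>A - B. t (f i))"
    using f assms(3) by (intro sum_mono least) (auto simp: bij_betw_def)
  also have "\<dots> = sum t (B - A)" by (rule sum.reindex_bij_betw[OF f])
  finally have "sum t (A - B) + sum t (A \<inter> B) \<le> sum t (B - A) + sum t (A \<inter> B)" by simp
  then show ?thesis
    using fin sum.Int_Diff[of A t B] sum.Int_Diff[of B t A] by (simp add: Int_commute add.commute)
qed

text \<open>Turning the sorting permutation of the list into a bijection of the indices makes sums
  of order statistics sums of \<open>t\<close> over index sets.\<close>

lemma order_stat_enumeration:
  obtains b where "bij_betw b {1..n} {1..n}"
    and "\<And>j. j \<in> {1..n} \<Longrightarrow> order_stat n t j = t (b j)"
    and "\<And>i j. 1 \<le> i \<Longrightarrow> i \<le> j \<Longrightarrow> j \<le> n \<Longrightarrow> t (b i) \<le> t (b j)"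
proof -
  define xs where "xs = map t [1..<Suc n]"
  have len: "length xs = n" by (simp add: xs_def)
  obtain p where p: "p permutes {..<n}" "permute_list p xs = sort xs"
    using mset_eq_permutation[of "sort xs" xs] len by auto
  \<comment> \<open>List positions start at 0, sample indices at 1.\<close>
  define b where "b j = Suc (p (j - 1))" for j
  have os: "order_stat n t j = t (b j)" if "j \<in> {1..n}" for j
  proof -
    have j: "j - 1 < n" using that by auto
    then have "p (j - 1) < n" using permutes_in_image[OF p(1), of "j - 1"] by simp
    then have "xs ! p (j - 1) = t (b j)" by (simp add: xs_def b_def nth_map plus_1_eq_Suc del: upt_Suc)
    moreover have "permute_list p xs ! (j - 1) = xs ! p (j - 1)"
      using p(1) j len by (intro permute_list_nth) auto
    ultimately show ?thesis using p(2) by (simp add: order_stat_def xs_def del: upt_Suc)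
  qed
  have 1: "bij_betw (\<lambda>j. j - 1) {1..n} {..<n}"
    by (rule bij_betw_byWitness[where f'=Suc]) auto
  have 2: "bij_betw Suc {..<n} {1..n}"
    by (rule bij_betw_byWitness[where f'="\<lambda>j. j - 1"]) auto
  have "bij_betw (Suc \<circ> p \<circ> (\<lambda>j. j - 1)) {1..n} {1..n}"
    by (intro bij_betw_trans[OF 1 bij_betw_trans[OF permutes_imp_bij[OF p(1)] 2]])
  then have bij: "bij_betw b {1..n} {1..n}" by (simp add: b_def[abs_def] comp_def)
  have "t (b i) \<le> t (b j)" if "1 \<le> i" "i \<le> j" "j \<le> n" for i j
  proof -
    have "sort xs ! (i - 1) \<le> sort xs ! (j - 1)"
      using that len by (intro sorted_nth_mono) auto
    then show ?thesis using that os[of i] os[of j] by (simp add: order_stat_def xs_def)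
  qed
  then show ?thesis using that[OF bij os] by blast
qed

text \<open>Both bounds compare \<open>A\<close> with the set \<open>R\<close> of the first
  \<open>k\<close> indices in sorted order: \<open>R\<close> is a least set of its size, and in the
  second bound \<open>A\<close> is one as well. The second bound serves selections that resolve ties
  otherwise than the sorting does.\<close>

lemma sum_order_stat_bounds:
  assumes "A \<subseteq> {1..n}" and k: "card A = k"
  shows sum_order_stat_le: "(\<Sum>j=1..k. order_stat n t j) \<le> sum t A"
    and sum_le_sum_order_stat: "(\<And>i j. i \<in> A \<Longrightarrow> j \<in> {1..n} - A \<Longrightarrow> t i \<le> t j) \<Longrightarrow>
      sum t A \<le> (\<Sum>j=1..k. order_stat n t j)"
proof -
  obtain b where b: "bij_betw b {1..n} {1..n}"
    "\<And>j. j \<in> {1..n} \<Longrightarrow> order_stat n t j = t (b j)"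
    "\<And>i j. 1 \<le> i \<Longrightarrow> i \<le> j \<Longrightarrow> j \<le> n \<Longrightarrow> t (b i) \<le> t (b j)"
    using order_stat_enumeration[of n t] by blast
  have kn: "k \<le> n" using card_mono[OF _ assms(1)] k by simp
  define R where "R = b ` {1..k}"
  have inj: "inj_on b {1..k}"
    using b(1) kn by (auto simp: bij_betw_def intro: inj_on_subset)
  have R: "R \<subseteq> {1..n}" "card R = k"
    using b(1) kn card_image[OF inj] by (auto simp: R_def bij_betw_def)
  have sum: "(\<Sum>j=1..k. order_stat n t j) = sum t R"
    using kn b(2) unfolding R_def sum.reindex[OF inj] by (intro sum.cong) auto
  have least: "t i \<le> t j" if ij: "i \<in> R" "j \<in> {1..n} - R" for i j
  proof -
    obtain i' where "i = b i'" "1 \<le> i'" "i' \<le> k" using ij(1) by (auto simp: R_def)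
    moreover obtain j' where j': "j = b j'" "j' \<in> {1..n}"
      using ij(2) b(1) unfolding bij_betw_def by blast
    moreover have "k < j'" using ij(2) j' by (force simp: R_def)
    ultimately show ?thesis using b(3)[of i' j'] by simp
  qed
  show "(\<Sum>j=1..k. order_stat n t j) \<le> sum t A"
    unfolding sum using R assms least by (intro sum_least_subset[of "{1..n}"]) auto
  assume "\<And>i j. i \<in> A \<Longrightarrow> j \<in> {1..n} - A \<Longrightarrow> t i \<le> t j"
  then show "sum t A \<le> (\<Sum>j=1..k. order_stat n t j)"
    unfolding sum using R assms by (intro sum_least_subset[of "{1..n}"]) auto
qed

text \<open>The maximum is attained, because k = 0 with its empty sum qualifies at every nonnegative
  level.\<close>

lemma sum_khat:
  assumes "0 \<le> \<alpha>"
  shows "(\<Sum>j=1..khat n \<alpha> t. order_stat n t j) / real (max (khat n \<alpha> t) 1) \<le> \<alpha>"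
proof -
  let ?K = "{k \<in> {0..n}. (\<Sum>j=1..k. order_stat n t j) / real (max k 1) \<le> \<alpha>}"
  have "0 \<in> ?K" using assms by simp
  then have "khat n \<alpha> t \<in> ?K" unfolding khat_def by (intro Max_in) auto
  then show ?thesis by auto
qed

text \<open>The \<open>card A\<close> smallest values sum to no more than the values on
  \<open>A\<close>, so \<open>card A\<close> competes in the maximum. This is how a set found by
  thresholding the true statistic forces the plug-in selection to be large.\<close>

lemma khat_ge:
  assumes "0 \<le> \<alpha>" "A \<subseteq> {1..n}" "sum t A \<le> \<alpha> * real (card A)"
  shows "card A \<le> khat n \<alpha> t"
proof -
  have n: "card A \<le> n" using card_mono[OF _ assms(2)] by simp
  have "(\<Sum>j=1..card A. order_stat n t j) \<le> \<alpha> * real (card A)"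
    using sum_order_stat_le[OF assms(2) refl, of t] assms(3) by linarith
  also have "\<dots> \<le> \<alpha> * real (max (card A) 1)" using assms(1) by (intro mult_left_mono) auto
  finally have "(\<Sum>j=1..card A. order_stat n t j) / real (max (card A) 1) \<le> \<alpha>"
    by (subst pos_divide_le_eq) auto
  then show ?thesis unfolding khat_def using n by (intro Max_ge) auto
qed

section \<open>Gradients\<close>

text \<open>A basic open set of the product topology constrains each coordinate separately;
  coordinates below \<open>m\<close> are controlled by the distance, and those beyond
  \<open>m\<close> vanish for both points. This links the topology of the parameter set with the
  metric in which gradients are defined.\<close>

lemma openin_Euclidean_space_edist:
  assumes "openin (Euclidean_space m) U" "x \<in> U"
  obtains \<rho> where "0 < \<rho>"
    "\<And>y. y \<in> topspace (Euclidean_space m) \<Longrightarrow> edist m y x < \<rho> \<Longrightarrow> y \<in> U"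
proof -
  obtain T where T: "openin (powertop_real UNIV) T" "U = T \<inter> {x. \<forall>i\<ge>m. x i = 0}"
    using assms(1) unfolding Euclidean_space_def openin_subtopology by blast
  obtain X where X: "x \<in> Pi\<^sub>E UNIV X" "\<And>i. open (X i)" "Pi\<^sub>E UNIV X \<subseteq> T"
    using product_topology_open_contains_basis[OF T(1), of x] assms(2) T(2) by (simp; blast)
  have "\<exists>e>0. \<forall>z. dist z (x i) < e \<longrightarrow> z \<in> X i" for i
    using X(1,2) by (auto simp: open_dist PiE_iff)
  then obtain e where e: "\<And>i. e i > 0" "\<And>i z. dist z (x i) < e i \<Longrightarrow> z \<in> X i" by metis
  \<comment> \<open>The inserted 1 keeps the minimum defined for m = 0.\<close>
  define \<rho> where "\<rho> = Min (insert 1 (e ` {..<m}))"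
  have \<rho>: "\<rho> \<le> e i" if "i < m" for i unfolding \<rho>_def using that by (intro Min_le) auto
  show ?thesis
  proof
    show "0 < \<rho>" unfolding \<rho>_def using e(1) by (subst Min_gr_iff) auto
    fix y assume y: "y \<in> topspace (Euclidean_space m)" "edist m y x < \<rho>"
    have "y i \<in> X i" for i
    proof (cases "i < m")
      case True
      have "\<bar>y i - x i\<bar> \<le> edist m y x"
        unfolding edist_def using member_le_L2_set[of "{..<m}" i "\<lambda>k. \<bar>y k - x k\<bar>"] True
        by (simp add: L2_set_def)
      then show ?thesis using e(2)[of "y i" i] \<rho>[OF True] y(2)
        by (simp add: dist_real_def)
    next
      case False
      then have "y i = x i" using y(1) assms(2) T(2) by (simp add: topspace_Euclidean_space)
      then show ?thesis using X(1) by (auto simp: PiE_iff)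
    qed
    then show "y \<in> U"
      using X(3) y(1) T(2) by (auto simp: topspace_Euclidean_space PiE_iff)
  qed
qed

text \<open>On the segment the function has one real variable; its derivative is the inner product
  of the gradient with the increment, which Cauchy-Schwarz bounds.\<close>

lemma has_gradient_mean_value:
  assumes seg: "\<And>s. s \<in> {0..1} \<Longrightarrow> (\<lambda>k. x k + s * (y k - x k)) \<in> S"
    and grad: "\<And>s. s \<in> {0..1} \<Longrightarrow> has_gradient m F (G s) (\<lambda>k. x k + s * (y k - x k)) S"
    and bound: "\<And>s. s \<in> {0..1} \<Longrightarrow> L2_set (G s) {..<m} \<le> B"
  shows "\<bar>F y - F x\<bar> \<le> B * edist m y x"
proof -
  define l where "l s = (\<lambda>k. x k + s * (y k - x k))" for s
  define D where "D = edist m y x"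
  define d where "d s = (\<Sum>k<m. G s k * (y k - x k))" for s
  have D0: "0 \<le> D" by (simp add: D_def edist_def)
  have dist_l: "edist m (l s') (l s) = \<bar>s' - s\<bar> * D" for s s'
  proof -
    have "edist m (l s') (l s) = L2_set (\<lambda>k. (s' - s) * (y k - x k)) {..<m}"
      by (simp add: edist_def l_def algebra_simps)
    then show ?thesis
      by (simp add: D_def edist_def L2_set_def power_mult_distrib real_sqrt_mult
          flip: sum_distrib_left)
  qed
  have deriv: "((\<lambda>s. F (l s)) has_field_derivative d s) (at s within {0..1})" if s: "s \<in> {0..1}" for s
    unfolding has_field_derivative_def has_derivative_within_alt
  proof safe
    show "bounded_linear ((*) (d s))" by (rule bounded_linear_mult_right)
    fix e :: real assume e: "0 < e"
    \<comment> \<open>\<open>D\<close> may be zero, hence \<open>D + 1\<close>; the factor D / (D +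
      1) left at the end is at most 1.\<close>
    have "0 < e / (D + 1)" using e D0 by simp
    with grad[OF s] obtain \<delta> where \<delta>: "0 < \<delta>" "\<And>z. z \<in> S \<Longrightarrow> edist m z (l s) < \<delta> \<Longrightarrow>
        \<bar>F z - F (l s) - (\<Sum>k<m. G s k * (z k - l s k))\<bar> \<le> e / (D + 1) * edist m z (l s)"
      unfolding has_gradient_def l_def[symmetric] by metis
    show "\<exists>d'>0. \<forall>s'\<in>{0..1}. norm (s' - s) < d' \<longrightarrow>
        norm (F (l s') - F (l s) - d s * (s' - s)) \<le> e * norm (s' - s)"
    proof (intro exI[of _ "\<delta> / (D + 1)"] conjI ballI impI)
      show "0 < \<delta> / (D + 1)" using \<delta>(1) D0 by simp
      fix s' :: real assume s': "s' \<in> {0..1}" "norm (s' - s) < \<delta> / (D + 1)"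
      have "\<bar>s' - s\<bar> * D \<le> \<bar>s' - s\<bar> * (D + 1)" by (intro mult_left_mono) auto
      also have "\<dots> < \<delta>" using s'(2) D0 by (simp add: pos_less_divide_eq)
      finally have "edist m (l s') (l s) < \<delta>" by (simp add: dist_l)
      moreover have "l s' \<in> S" using seg[OF s'(1)] by (simp add: l_def)
      ultimately have "\<bar>F (l s') - F (l s) - (\<Sum>k<m. G s k * (l s' k - l s k))\<bar>
          \<le> e / (D + 1) * (\<bar>s' - s\<bar> * D)"
        using \<delta>(2) dist_l by metis
      also have "(\<Sum>k<m. G s k * (l s' k - l s k)) = d s * (s' - s)"
        unfolding d_def sum_distrib_right by (intro sum.cong) (auto simp: l_def algebra_simps)
      also have "e / (D + 1) * (\<bar>s' - s\<bar> * D) = e * \<bar>s' - s\<bar> * (D / (D + 1))" by simp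
      also have "\<dots> \<le> e * \<bar>s' - s\<bar> * 1"
        using e D0 by (intro mult_left_mono) auto
      finally show "norm (F (l s') - F (l s) - d s * (s' - s)) \<le> e * norm (s' - s)" by simp
    qed
  qed
  have "\<bar>d s\<bar> \<le> B * D" if s: "s \<in> {0..1}" for s
  proof -
    have "\<bar>d s\<bar> \<le> (\<Sum>k<m. \<bar>G s k\<bar> * \<bar>y k - x k\<bar>)"
      unfolding d_def using sum_abs[of "\<lambda>k. G s k * (y k - x k)" "{..<m}"] by (simp add: abs_mult)
    also have "\<dots> \<le> L2_set (G s) {..<m} * D" unfolding D_def edist_def by (rule L2_set_mult_ineq)
    also have "\<dots> \<le> B * D" using bound[OF s] D0 by (intro mult_right_mono)
    finally show ?thesis .
  qed
  then have "norm (F (l 1) - F (l 0)) \<le> B * D * norm (1 - 0 :: real)"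
    by (intro field_differentiable_bound[OF convex_closed_interval deriv]) (auto simp: box_real)
  moreover have "l 1 = y" "l 0 = x" by (auto simp: l_def)
  ultimately show ?thesis by (simp add: D_def)
qed

section \<open>The mixture model\<close>

locale mixture_at =
  fixes M :: mixture and \<theta>\<^sub>0 :: param
  assumes model: "mixture_model M" and true_param: "\<theta>\<^sub>0 \<in> params M"
begin

abbreviation L :: "rvec measure" where "L \<equiv> leb (xdim M)"

abbreviation P :: "rvec measure" where "P \<equiv> obs_law M \<theta>\<^sub>0"

definition mix :: "rvec \<Rightarrow> real" where
  "mix x = (\<Sum>l\<in>classes M. fst \<theta>\<^sub>0 l * dens M (snd \<theta>\<^sub>0 l) x)"

lemma paramD:
  assumes "\<theta> \<in> params M"
  shows "(\<Sum>q\<in>classes M. fst \<theta> q) = 1"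
    and "q \<in> classes M \<Longrightarrow> 0 < fst \<theta> q"
    and "q \<in> classes M \<Longrightarrow> dens M (snd \<theta> q) \<in> borel_measurable L"
    and "q \<in> classes M \<Longrightarrow> x \<in> space L \<Longrightarrow> 0 \<le> dens M (snd \<theta> q) x"
    and "q \<in> classes M \<Longrightarrow> (\<integral>\<^sup>+x. ennreal (dens M (snd \<theta> q) x) \<partial>L) = 1"
proof -
  have *: "fst \<theta> \<in> classes M \<rightarrow>\<^sub>E {0<..}" "(\<Sum>q\<in>classes M. fst \<theta> q) = 1"
    "snd \<theta> \<in> classes M \<rightarrow>\<^sub>E comps M"
    using model assms by (auto simp: mixture_model_def case_prod_beta)
  have **: "dens M u \<in> borel_measurable L" "x \<in> space L \<Longrightarrow> 0 \<le> dens M u x"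
    "(\<integral>\<^sup>+x. ennreal (dens M u x) \<partial>L) = 1" if "u \<in> comps M" for u x
    using model that by (auto simp: mixture_model_def)
  show "(\<Sum>q\<in>classes M. fst \<theta> q) = 1" by (fact *)
  assume q: "q \<in> classes M"
  show "0 < fst \<theta> q" using *(1) q by (auto simp: PiE_iff)
  have "snd \<theta> q \<in> comps M" using *(3) q by (auto simp: PiE_iff)
  then show "dens M (snd \<theta> q) \<in> borel_measurable L" "x \<in> space L \<Longrightarrow> 0 \<le> dens M (snd \<theta> q) x"
    "(\<integral>\<^sup>+x. ennreal (dens M (snd \<theta> q) x) \<partial>L) = 1"
    using ** by auto
qed

lemma classes_nonempty: "classes M \<noteq> {}"
  using paramD(1)[OF true_param] by force

lemma post_measurable [measurable]:
  assumes "\<theta> \<in> params M" "q \<in> classes M"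
  shows "post M \<theta> q \<in> borel_measurable L"
  unfolding post_def[abs_def] using paramD(3)[OF assms(1)] assms(2) by measurable

lemma post_bounds:
  assumes "\<theta> \<in> params M" "q \<in> classes M" "x \<in> space L"
  shows "0 \<le> post M \<theta> q x" "post M \<theta> q x \<le> 1"
proof -
  have nn: "0 \<le> fst \<theta> l * dens M (snd \<theta> l) x" if "l \<in> classes M" for l
    using paramD(2,4)[OF assms(1) that] assms(3) by simp
  then show "0 \<le> post M \<theta> q x"
    unfolding post_def using assms(2) by (intro divide_nonneg_nonneg sum_nonneg) auto
  have "fst \<theta> q * dens M (snd \<theta> q) x \<le> (\<Sum>l\<in>classes M. fst \<theta> l * dens M (snd \<theta> l) x)"
    using nn assms(2) by (intro member_le_sum) auto
  moreover have "0 \<le> (\<Sum>l\<in>classes M. fst \<theta> l * dens M (snd \<theta> l) x)"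
    using nn by (intro sum_nonneg) auto
  \<comment> \<open>If the denominator vanishes, division by zero yields 0.\<close>
  ultimately show "post M \<theta> q x \<le> 1"
    unfolding post_def by (auto simp: divide_le_eq_1)
qed

lemma Tstat_measurable [measurable]:
  assumes "\<theta> \<in> params M"
  shows "Tstat M \<theta> \<in> borel_measurable L"
  unfolding Tstat_def[abs_def] using post_measurable[OF assms] by measurable

lemma Tstat_le: "q \<in> classes M \<Longrightarrow> Tstat M \<theta> x \<le> 1 - post M \<theta> q x"
  unfolding Tstat_def by simp

lemma Tstat_attained: obtains q where "q \<in> classes M" "Tstat M \<theta> x = 1 - post M \<theta> q x"
proof -
  have "Max ((\<lambda>q. post M \<theta> q x) ` classes M) \<in> (\<lambda>q. post M \<theta> q x) ` classes M"
    using classes_nonempty by (intro Max_in) auto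
  then obtain q where "q \<in> classes M" "Max ((\<lambda>q. post M \<theta> q x) ` classes M) = post M \<theta> q x"
    by blast
  then show ?thesis using that unfolding Tstat_def by simp
qed

lemma Tstat_bounds:
  assumes "\<theta> \<in> params M" "x \<in> space L"
  shows "0 \<le> Tstat M \<theta> x" "Tstat M \<theta> x \<le> 1"
  by (metis Tstat_attained assms post_bounds diff_ge_0_iff_ge diff_le_eq le_add_same_cancel1)+

lemma mix_nonneg: "x \<in> space L \<Longrightarrow> 0 \<le> mix x"
  unfolding mix_def using paramD(2,4)[OF true_param] by (intro sum_nonneg mult_nonneg_nonneg) (auto intro: less_imp_le)

lemma mix_measurable [measurable]: "mix \<in> borel_measurable L"
  unfolding mix_def[abs_def] using paramD(3)[OF true_param] by measurable

text \<open>Where the mixture density vanishes, the posterior has the default value 0, but every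
  summand of \<open>mix\<close> vanishes there too; so the identity holds everywhere and not only
  almost everywhere.\<close>

lemma mix_post:
  assumes "q \<in> classes M" "x \<in> space L"
  shows "mix x * post M \<theta>\<^sub>0 q x = fst \<theta>\<^sub>0 q * dens M (snd \<theta>\<^sub>0 q) x"
proof (cases "mix x = 0")
  case True
  then have "fst \<theta>\<^sub>0 q * dens M (snd \<theta>\<^sub>0 q) x = 0"
    using paramD(2,4)[OF true_param] assms
    unfolding mix_def by (subst (asm) sum_nonneg_eq_0_iff) (auto simp: less_imp_le)
  then show ?thesis using True by simp
qed (simp add: post_def mix_def[symmetric])

lemma sigma_finite_L: "sigma_finite_measure L"
proof -
  interpret product_sigma_finite "\<lambda>_::nat. lborel :: real measure" by standard
  show ?thesis unfolding leb_def by (rule sigma_finite) simp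
qed

lemma sets_joint [measurable_cong]:
  "sets (joint M \<theta>) = sets (count_space (classes M) \<Otimes>\<^sub>M L)"
  by (simp add: joint_def)

lemma joint_density_measurable [measurable]:
  "(\<lambda>(q, x). ennreal (fst \<theta>\<^sub>0 q * dens M (snd \<theta>\<^sub>0 q) x)) \<in>
     borel_measurable (count_space (classes M) \<Otimes>\<^sub>M L)"
proof (rule measurable_pair_measure_countable1)
  fix q assume "q \<in> classes M"
  then have [measurable]: "dens M (snd \<theta>\<^sub>0 q) \<in> borel_measurable L"
    using paramD(3)[OF true_param] by simp
  show "(\<lambda>x. case (q, x) of (q, x) \<Rightarrow> ennreal (fst \<theta>\<^sub>0 q * dens M (snd \<theta>\<^sub>0 q) x)) \<in> borel_measurable L"
    unfolding prod.case by measurable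
qed simp

lemma nn_integral_joint:
  assumes g [measurable]: "g \<in> borel_measurable (count_space (classes M) \<Otimes>\<^sub>M L)"
  shows "(\<integral>\<^sup>+z. g z \<partial>joint M \<theta>\<^sub>0) =
    (\<Sum>q\<in>classes M. \<integral>\<^sup>+x. ennreal (fst \<theta>\<^sub>0 q * dens M (snd \<theta>\<^sub>0 q) x) * g (q, x) \<partial>L)"
proof -
  interpret sigma_finite_measure L by (rule sigma_finite_L)
  have "(\<integral>\<^sup>+z. g z \<partial>joint M \<theta>\<^sub>0) = (\<integral>\<^sup>+z. (case z of (q, x) \<Rightarrow>
      ennreal (fst \<theta>\<^sub>0 q * dens M (snd \<theta>\<^sub>0 q) x)) * g z \<partial>(count_space (classes M) \<Otimes>\<^sub>M L))"
    unfolding joint_def by (rule nn_integral_density) measurable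
  also have "\<dots> = (\<integral>\<^sup>+q. \<integral>\<^sup>+x. ennreal (fst \<theta>\<^sub>0 q * dens M (snd \<theta>\<^sub>0 q) x) * g (q, x) \<partial>L
      \<partial>count_space (classes M))"
    by (subst nn_integral_fst[symmetric]) auto
  finally show ?thesis by (simp add: nn_integral_count_space_finite)
qed

lemma prob_space_joint: "prob_space (joint M \<theta>\<^sub>0)"
proof (rule prob_spaceI)
  have "emeasure (joint M \<theta>\<^sub>0) (space (joint M \<theta>\<^sub>0)) = (\<integral>\<^sup>+z. 1 \<partial>joint M \<theta>\<^sub>0)" by simp
  also have "\<dots> = (\<Sum>q\<in>classes M. \<integral>\<^sup>+x. ennreal (fst \<theta>\<^sub>0 q) * ennreal (dens M (snd \<theta>\<^sub>0 q) x) \<partial>L)"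
    using paramD(2,4)[OF true_param]
    by (subst nn_integral_joint) (auto intro!: sum.cong nn_integral_cong simp: ennreal_mult less_imp_le)
  also have "\<dots> = (\<Sum>q\<in>classes M. ennreal (fst \<theta>\<^sub>0 q))"
    using paramD(3,5)[OF true_param] by (intro sum.cong) (auto simp: nn_integral_cmult)
  also have "\<dots> = ennreal (\<Sum>q\<in>classes M. fst \<theta>\<^sub>0 q)"
    using paramD(2)[OF true_param] by (intro sum_ennreal) (auto intro: less_imp_le)
  also have "\<dots> = 1" using paramD(1)[OF true_param] by simp
  finally show "emeasure (joint M \<theta>\<^sub>0) (space (joint M \<theta>\<^sub>0)) = 1" .
qed

lemma sets_P [measurable_cong, simp]: "sets P = sets L"
  by (simp add: obs_law_def)

lemma space_P [simp]: "space P = space L"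
  by (simp add: obs_law_def)

lemma snd_joint_measurable [measurable]: "snd \<in> joint M \<theta>\<^sub>0 \<rightarrow>\<^sub>M L"
  by measurable

lemma prob_space_P: "prob_space P"
  unfolding obs_law_def by (rule prob_space.prob_space_distr[OF prob_space_joint]) measurable

text \<open>The label is summed out under the integral: \<open>mix\<close> is the Lebesgue density
  of \<open>P\<close>.\<close>

lemma nn_integral_P:
  assumes [measurable]: "g \<in> borel_measurable L"
  shows "(\<integral>\<^sup>+x. g x \<partial>P) = (\<integral>\<^sup>+x. ennreal (mix x) * g x \<partial>L)"
proof -
  have [measurable]: "dens M (snd \<theta>\<^sub>0 q) \<in> borel_measurable L" if "q \<in> classes M" for q
    using paramD(3)[OF true_param that] .
  have "(\<integral>\<^sup>+x. g x \<partial>P) = (\<integral>\<^sup>+z. g (snd z) \<partial>joint M \<theta>\<^sub>0)"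
    unfolding obs_law_def by (rule nn_integral_distr) measurable
  also have "\<dots> = (\<Sum>q\<in>classes M. \<integral>\<^sup>+x. ennreal (fst \<theta>\<^sub>0 q * dens M (snd \<theta>\<^sub>0 q) x) * g x \<partial>L)"
    by (subst nn_integral_joint) auto
  also have "\<dots> = (\<integral>\<^sup>+x. (\<Sum>q\<in>classes M. ennreal (fst \<theta>\<^sub>0 q * dens M (snd \<theta>\<^sub>0 q) x) * g x) \<partial>L)"
    by (intro nn_integral_sum[symmetric]) measurable
  also have "\<dots> = (\<integral>\<^sup>+x. ennreal (mix x) * g x \<partial>L)"
  proof (rule nn_integral_cong)
    fix x assume "x \<in> space L"
    then have "(\<Sum>q\<in>classes M. ennreal (fst \<theta>\<^sub>0 q * dens M (snd \<theta>\<^sub>0 q) x)) = ennreal (mix x)"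
      unfolding mix_def using paramD(2,4)[OF true_param] by (intro sum_ennreal) (auto simp: less_imp_le)
    then show "(\<Sum>q\<in>classes M. ennreal (fst \<theta>\<^sub>0 q * dens M (snd \<theta>\<^sub>0 q) x) * g x) = ennreal (mix x) * g x"
      by (simp add: sum_distrib_right[symmetric])
  qed
  finally show ?thesis .
qed

text \<open>A density vanishes only on a null set of its own law. Off this set the posteriors sum to
  one.\<close>

lemma AE_mix_pos: "AE x in P. 0 < mix x"
proof -
  have "(\<integral>\<^sup>+x. indicator {x \<in> space L. mix x = 0} x \<partial>P) =
      (\<integral>\<^sup>+x. ennreal (mix x) * indicator {x \<in> space L. mix x = 0} x \<partial>L)"
    by (rule nn_integral_P) measurable
  also have "\<dots> = (\<integral>\<^sup>+x. 0 \<partial>L)"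
    by (rule nn_integral_cong) (auto simp: indicator_def)
  finally have "emeasure P {x \<in> space L. mix x = 0} = 0"
    by simp
  then have "AE x in P. mix x \<noteq> 0"
    by (intro AE_I[of _ _ "{x \<in> space L. mix x = 0}"]) auto
  then show ?thesis
    using AE_space by eventually_elim (use mix_nonneg in \<open>auto simp: less_le\<close>)
qed

text \<open>Bayes' formula for one observation: fixing the label leaves the summand \<open>q\<close>
  of the density, which is \<open>mix\<close> times the posterior.\<close>

lemma nn_integral_joint_label:
  assumes [measurable]: "g \<in> borel_measurable L" and q: "q \<in> classes M"
  shows "(\<integral>\<^sup>+z. g (snd z) * indicator {q} (fst z) \<partial>joint M \<theta>\<^sub>0) =
    (\<integral>\<^sup>+z. g (snd z) * ennreal (post M \<theta>\<^sub>0 q (snd z)) \<partial>joint M \<theta>\<^sub>0)"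
proof -
  note [measurable] = post_measurable[OF true_param q]
  have "(\<integral>\<^sup>+z. g (snd z) * indicator {q} (fst z) \<partial>joint M \<theta>\<^sub>0) =
    (\<Sum>l\<in>classes M. \<integral>\<^sup>+x. ennreal (fst \<theta>\<^sub>0 l * dens M (snd \<theta>\<^sub>0 l) x) * (g x * indicator {q} l) \<partial>L)"
  proof (subst nn_integral_joint)
    show "(\<lambda>z. g (snd z) * indicator {q} (fst z)) \<in> borel_measurable (count_space (classes M) \<Otimes>\<^sub>M L)"
      by (rule measurable_pair_measure_countable1) auto
  qed simp
  also have "\<dots> = (\<Sum>l\<in>classes M. if l = q then
      \<integral>\<^sup>+x. ennreal (fst \<theta>\<^sub>0 q * dens M (snd \<theta>\<^sub>0 q) x) * g x \<partial>L else 0)"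
    by (intro sum.cong) (auto simp: indicator_def)
  also have "\<dots> = (\<integral>\<^sup>+x. ennreal (fst \<theta>\<^sub>0 q * dens M (snd \<theta>\<^sub>0 q) x) * g x \<partial>L)"
    using q by simp
  also have "\<dots> = (\<integral>\<^sup>+x. ennreal (mix x) * (g x * ennreal (post M \<theta>\<^sub>0 q x)) \<partial>L)"
    using q by (intro nn_integral_cong)
      (auto simp: mix_post[symmetric] ennreal_mult mix_nonneg post_bounds[OF true_param] ac_simps)
  also have "\<dots> = (\<integral>\<^sup>+x. g x * ennreal (post M \<theta>\<^sub>0 q x) \<partial>P)"
    by (subst nn_integral_P) auto
  also have "\<dots> = (\<integral>\<^sup>+z. g (snd z) * ennreal (post M \<theta>\<^sub>0 q (snd z)) \<partial>joint M \<theta>\<^sub>0)"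
    unfolding obs_law_def by (subst nn_integral_distr) auto
  finally show ?thesis .
qed

section \<open>The sample and conditional expectations\<close>

abbreviation S :: "nat \<Rightarrow> (nat \<Rightarrow> nat \<times> rvec) measure" where "S \<equiv> sample M \<theta>\<^sub>0"

lemma prob_space_sample: "prob_space (S n)"
  unfolding sample_def by (intro prob_space_PiM prob_space_joint)

lemma coord_measurable [measurable]: "i \<in> {1..n} \<Longrightarrow> (\<lambda>\<omega>. \<omega> i) \<in> S n \<rightarrow>\<^sub>M joint M \<theta>\<^sub>0"
  unfolding sample_def by (rule measurable_component_singleton)

lemma coord_snd_measurable [measurable]: "i \<in> {1..n} \<Longrightarrow> (\<lambda>\<omega>. snd (\<omega> i)) \<in> S n \<rightarrow>\<^sub>M L"
  using measurable_compose[OF coord_measurable snd_joint_measurable] by simp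

lemma lab_measurable [measurable]:
  "i \<in> {1..n} \<Longrightarrow> (\<lambda>\<omega>. lab \<omega> i) \<in> S n \<rightarrow>\<^sub>M count_space (classes M)"
proof -
  assume "i \<in> {1..n}"
  have "fst \<in> joint M \<theta>\<^sub>0 \<rightarrow>\<^sub>M count_space (classes M)" by measurable
  from measurable_compose[OF coord_measurable[OF \<open>i \<in> {1..n}\<close>] this] show ?thesis
    unfolding lab_def .
qed

lemma space_sampleD:
  assumes "\<omega> \<in> space (S n)" "i \<in> {1..n}"
  shows "lab \<omega> i \<in> classes M" "snd (\<omega> i) \<in> space L"
  using measurable_space[OF lab_measurable[OF assms(2)] assms(1)]
    measurable_space[OF coord_snd_measurable[OF assms(2)] assms(1)] by simp_all

lemma obs_measurable [measurable]: "obs n \<in> S n \<rightarrow>\<^sub>M obs_space M n"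
  unfolding obs_def[abs_def] obs_space_def by (rule measurable_restrict) measurable

lemma obs_apply: "i \<in> {1..n} \<Longrightarrow> obs n \<omega> i = snd (\<omega> i)"
  by (simp add: obs_def)

lemma distr_coord: "i \<in> {1..n} \<Longrightarrow> distr (S n) (joint M \<theta>\<^sub>0) (\<lambda>\<omega>. \<omega> i) = joint M \<theta>\<^sub>0"
  unfolding sample_def by (intro distr_PiM_component prob_space_joint)

lemma distr_obs_coord:
  assumes i: "i \<in> {1..n}"
  shows "distr (S n) L (\<lambda>\<omega>. snd (\<omega> i)) = P"
proof -
  have "P = distr (distr (S n) (joint M \<theta>\<^sub>0) (\<lambda>\<omega>. \<omega> i)) L snd"
    unfolding obs_law_def distr_coord[OF i] ..
  also have "\<dots> = distr (S n) L (snd \<circ> (\<lambda>\<omega>. \<omega> i))"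
    using i by (intro distr_distr) auto
  finally show ?thesis by (simp add: comp_def)
qed

lemma integral_obs_coord:
  fixes g :: "rvec \<Rightarrow> real"
  assumes "i \<in> {1..n}" "g \<in> borel_measurable L"
  shows "(\<integral>\<omega>. g (snd (\<omega> i)) \<partial>S n) = (\<integral>x. g x \<partial>P)"
  using assms by (subst distr_obs_coord[OF assms(1), symmetric], subst integral_distr) auto

lemma nn_integral_obs_coord:
  assumes "i \<in> {1..n}" "g \<in> borel_measurable L"
  shows "(\<integral>\<^sup>+\<omega>. g (snd (\<omega> i)) \<partial>S n) = (\<integral>\<^sup>+x. g x \<partial>P)"
  using assms by (subst distr_obs_coord[OF assms(1), symmetric], subst nn_integral_distr) auto

lemma AE_obs_coord:
  assumes "i \<in> {1..n}" "AE x in P. R x"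
  shows "AE \<omega> in S n. R (snd (\<omega> i))"
proof (rule AE_distrD[where P=R])
  show "AE x in distr (S n) L (\<lambda>\<omega>. snd (\<omega> i)). R x"
    unfolding distr_obs_coord[OF assms(1)] by (rule assms(2))
qed (rule coord_snd_measurable[OF assms(1)])

text \<open>Weighting the sample law by the indicator of the label of item \<open>i\<close>, or by
  its posterior, gives two measures with the same image under \<open>obs n\<close>: on a box each
  image is a product over the items by independence, only factor \<open>i\<close> differs, and there
  Bayes' formula applies. Integrating \<open>u\<close> against the common image gives the
  claim.\<close>

lemma integral_label:
  fixes u :: "(nat \<Rightarrow> rvec) \<Rightarrow> real"
  assumes u [measurable]: "u \<in> borel_measurable (obs_space M n)" and i: "i \<in> {1..n}"
    and q: "q \<in> classes M"
  shows "(\<integral>\<omega>. u (obs n \<omega>) * of_bool (lab \<omega> i = q) \<partial>S n) =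
    (\<integral>\<omega>. u (obs n \<omega>) * post M \<theta>\<^sub>0 q (snd (\<omega> i)) \<partial>S n)"
proof -
  \<comment> \<open>One family for both weights, so that measurability and the formula on boxes are
    proved once.\<close>
  define v :: "bool \<Rightarrow> nat \<times> rvec \<Rightarrow> real"
    where "v b z = (if b then of_bool (fst z = q) else post M \<theta>\<^sub>0 q (snd z))" for b z
  define D where "D b = distr (density (S n) (\<lambda>\<omega>. ennreal (v b (\<omega> i)))) (obs_space M n) (obs n)" for b
  note [measurable] = post_measurable[OF true_param q]
  have v [measurable]: "v b \<in> borel_measurable (joint M \<theta>\<^sub>0)" for b
  proof (cases b)
    case True
    have "(\<lambda>z. of_bool (fst z = q) :: real) \<in> borel_measurable (count_space (classes M) \<Otimes>\<^sub>M L)"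
      by (rule measurable_pair_measure_countable1) auto
    then have "(\<lambda>z. of_bool (fst z = q) :: real) \<in> borel_measurable (joint M \<theta>\<^sub>0)"
      by (simp cong: measurable_cong_sets add: sets_joint)
    then show ?thesis using True by (simp add: v_def[abs_def])
  qed (simp add: v_def[abs_def])
  have vi [measurable]: "(\<lambda>\<omega>. v b (\<omega> i)) \<in> borel_measurable (S n)" for b
    using measurable_compose[OF coord_measurable[OF i] v] by simp
  have vi0: "AE \<omega> in S n. 0 \<le> v b (\<omega> i)" for b
    using AE_space by eventually_elim
      (use space_sampleD[OF _ i] post_bounds[OF true_param q] in \<open>auto simp: v_def\<close>)
  have Dbox: "emeasure (D b) (Pi\<^sub>E {1..n} A) =
      (\<Prod>j\<in>{1..n}. \<integral>\<^sup>+z. indicator (A j) (snd z) * (if j = i then ennreal (v b z) else 1) \<partial>joint M \<theta>\<^sub>0)"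
    if A: "\<forall>j\<in>{1..n}. A j \<in> sets L" for A b
  proof -
    interpret product_sigma_finite "\<lambda>_::nat. joint M \<theta>\<^sub>0"
      unfolding product_sigma_finite_def
      using prob_space_imp_sigma_finite[OF prob_space_joint] by simp
    have box [measurable]: "Pi\<^sub>E {1..n} A \<in> sets (obs_space M n)"
      unfolding obs_space_def using A by (intro sets_PiM_I_finite) auto
    have "emeasure (D b) (Pi\<^sub>E {1..n} A) =
        (\<integral>\<^sup>+\<omega>. ennreal (v b (\<omega> i)) * indicator (obs n -` Pi\<^sub>E {1..n} A \<inter> space (S n)) \<omega> \<partial>S n)"
      unfolding D_def by (subst emeasure_distr) (auto intro!: emeasure_density)
    \<comment> \<open>The weight of item \<open>i\<close> is placed in its own factor, with 1 in the
      others, so that the integral splits.\<close>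
    also have "\<dots> = (\<integral>\<^sup>+\<omega>. (\<Prod>j\<in>{1..n}. indicator (A j) (snd (\<omega> j)) *
        (if j = i then ennreal (v b (\<omega> j)) else 1)) \<partial>S n)"
    proof (rule nn_integral_cong)
      fix \<omega> assume \<omega>: "\<omega> \<in> space (S n)"
      have "indicator (obs n -` Pi\<^sub>E {1..n} A \<inter> space (S n)) \<omega> =
          (\<Prod>j\<in>{1..n}. indicator (A j) (snd (\<omega> j)) :: ennreal)"
      proof (cases "\<forall>j\<in>{1..n}. snd (\<omega> j) \<in> A j")
        case False
        then obtain j where "j \<in> {1..n}" "snd (\<omega> j) \<notin> A j" by blast
        then have "(\<Prod>j\<in>{1..n}. indicator (A j) (snd (\<omega> j)) :: ennreal) = 0"
          by (intro prod_zero) (auto intro!: bexI[of _ j])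
        then show ?thesis using False by (auto simp: obs_def PiE_iff indicator_def)
      qed (use \<omega> in \<open>auto simp: obs_def PiE_iff\<close>)
      moreover have "(\<Prod>j\<in>{1..n}. if j = i then ennreal (v b (\<omega> j)) else 1) = ennreal (v b (\<omega> i))"
        using i by (subst prod.delta) auto
      ultimately show "ennreal (v b (\<omega> i)) * indicator (obs n -` Pi\<^sub>E {1..n} A \<inter> space (S n)) \<omega> =
          (\<Prod>j\<in>{1..n}. indicator (A j) (snd (\<omega> j)) * (if j = i then ennreal (v b (\<omega> j)) else 1))"
        by (simp add: prod.distrib mult.commute)
    qed
    also have "\<dots> = (\<Prod>j\<in>{1..n}. \<integral>\<^sup>+z. indicator (A j) (snd z) *
        (if j = i then ennreal (v b z) else 1) \<partial>joint M \<theta>\<^sub>0)"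
      unfolding sample_def
    proof (rule product_nn_integral_prod)
      fix j assume "j \<in> {1..n}"
      with A have Aj [measurable]: "A j \<in> sets L" by blast
      show "(\<lambda>z. indicator (A j) (snd z) * (if j = i then ennreal (v b z) else 1))
          \<in> borel_measurable (joint M \<theta>\<^sub>0)" by measurable
    qed simp
    finally show ?thesis .
  qed
  \<comment> \<open>The measures agree on all boxes, and the whole space is itself a box of finite
    measure, so a constant sequence exhausts it.\<close>
  have DD: "D True = D False"
  proof (rule measure_eqI_PiM_finite[where I="{1..n}" and M="\<lambda>_. L" and A="\<lambda>_. space (obs_space M n)"])
    show "emeasure (D True) (Pi\<^sub>E {1..n} A) = emeasure (D False) (Pi\<^sub>E {1..n} A)"
      if A: "\<And>j. j \<in> {1..n} \<Longrightarrow> A j \<in> sets L" for A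
    proof (subst (1 2) Dbox, safe intro!: A prod.cong)
      fix j assume "j \<in> {1..n}"
      then have Aj [measurable]: "A j \<in> sets L" by (rule A)
      have eq: "ennreal (of_bool (a = q)) = indicator {q} a" for a
        by (simp add: indicator_def)
      show "(\<integral>\<^sup>+z. indicator (A j) (snd z) * (if j = i then ennreal (v True z) else 1) \<partial>joint M \<theta>\<^sub>0) =
          (\<integral>\<^sup>+z. indicator (A j) (snd z) * (if j = i then ennreal (v False z) else 1) \<partial>joint M \<theta>\<^sub>0)"
        using nn_integral_joint_label[of "indicator (A j)", OF borel_measurable_indicator[OF Aj] q] by (cases "j = i") (simp_all add: v_def eq)
    qed
    show "range (\<lambda>_. space (obs_space M n)) \<subseteq> prod_algebra {1..n} (\<lambda>_. L)"
      by (auto simp: obs_space_def space_PiM intro!: prod_algebraI_finite)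
    have v1: "ennreal (v True z) * indicator B \<omega> \<le> 1" for z B and \<omega> :: "nat \<Rightarrow> nat \<times> rvec"
      by (cases "fst z = q"; cases "\<omega> \<in> B"; simp add: v_def)
    have "emeasure (D True) (space (obs_space M n)) =
        (\<integral>\<^sup>+\<omega>. ennreal (v True (\<omega> i)) * indicator (obs n -` space (obs_space M n) \<inter> space (S n)) \<omega> \<partial>S n)"
      unfolding D_def by (subst emeasure_distr) (auto intro!: emeasure_density)
    also have "\<dots> \<le> (\<integral>\<^sup>+\<omega>. 1 \<partial>S n)" by (intro nn_integral_mono v1)
    also have "\<dots> = 1" using prob_space.emeasure_space_1[OF prob_space_sample] by simp
    finally show "emeasure (D True) (space (obs_space M n)) \<noteq> \<infinity>" by (auto simp: top_unique)
  qed (simp_all add: D_def obs_space_def)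
  have I: "(\<integral>x. u x \<partial>D b) = (\<integral>\<omega>. u (obs n \<omega>) * v b (\<omega> i) \<partial>S n)" for b
    unfolding D_def using vi0
    by (subst integral_distr, simp, simp, subst integral_density) (auto simp: mult.commute)
  show ?thesis using I[of True] I[of False] by (simp add: DD v_def lab_def)
qed

section \<open>Independence of the items and concentration of sample sums\<close>

lemma indep_coords:
  assumes "1 \<le> n"
  shows "prob_space.indep_vars (S n) (\<lambda>_. joint M \<theta>\<^sub>0) (\<lambda>i \<omega>. \<omega> i) {1..n}"
proof -
  interpret prob_space "S n" by (rule prob_space_sample)
  \<comment> \<open>On the product space the restriction to the index set is the identity, so the
    joint law of the coordinates is the product law itself.\<close>
  have "distr (S n) (S n) (\<lambda>\<omega>. \<lambda>i\<in>{1..n}. \<omega> i) = distr (S n) (S n) (\<lambda>\<omega>. \<omega>)"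
    by (intro distr_cong) (auto simp: sample_def space_PiM)
  also have "\<dots> = (\<Pi>\<^sub>M i\<in>{1..n}. distr (S n) (joint M \<theta>\<^sub>0) (\<lambda>\<omega>. \<omega> i))"
    unfolding distr_id2[OF refl] by (subst sample_def) (auto intro!: PiM_cong simp: distr_coord)
  finally show ?thesis
    using assms by (subst indep_vars_iff_distr_eq_PiM') (auto simp: sample_def)
qed

lemma Hoeffding_sample:
  fixes g :: "rvec \<Rightarrow> real"
  assumes g [measurable]: "g \<in> borel_measurable L"
    and bounds: "\<And>x. x \<in> space L \<Longrightarrow> g x \<in> {a..a + 1}"
    and n: "1 \<le> n" and c: "0 \<le> c"
  shows "measure (S n) {\<omega> \<in> space (S n). real n * (\<integral>x. g x \<partial>P) + real n * c \<le> (\<Sum>i=1..n. g (snd (\<omega> i)))}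
           \<le> exp (- 2 * real n * c\<^sup>2)"
    and "measure (S n) {\<omega> \<in> space (S n). (\<Sum>i=1..n. g (snd (\<omega> i))) \<le> real n * (\<integral>x. g x \<partial>P) - real n * c}
           \<le> exp (- 2 * real n * c\<^sup>2)"
proof -
  interpret prob_space "S n" by (rule prob_space_sample)
  have 1: "(\<Sum>i=1..n. expectation (\<lambda>\<omega>. g (snd (\<omega> i)))) = real n * (\<integral>x. g x \<partial>P)"
    by (subst sum.cong[OF refl integral_obs_coord]) auto
  interpret H: Hoeffding_ineq "S n" "{1..n}" "\<lambda>i \<omega>. g (snd (\<omega> i))" "\<lambda>_. a" "\<lambda>_. a + 1"
    "real n * (\<integral>x. g x \<partial>P)"
  proof (unfold_locales, goal_cases)
    case 2
    show ?case by (rule indep_vars_compose2[OF indep_coords[OF n]]) measurable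
  next
    case (3 i)
    then show ?case using bounds space_sampleD(2) by (intro AE_I2) blast
  qed (simp_all add: 1)
  \<comment> \<open>All ranges have length 1, so their squares sum to n.\<close>
  have 2: "-2 * (real n * c)\<^sup>2 / (\<Sum>i\<in>{1..n}. (a + 1 - a)\<^sup>2) = - 2 * real n * c\<^sup>2"
    using n by (simp add: power2_eq_square)
  show "prob {\<omega> \<in> space (S n). real n * (\<integral>x. g x \<partial>P) + real n * c \<le> (\<Sum>i=1..n. g (snd (\<omega> i)))}
           \<le> exp (- 2 * real n * c\<^sup>2)"
    using H.Hoeffding_ineq_ge[of "real n * c"] n c unfolding 2 by simp
  show "prob {\<omega> \<in> space (S n). (\<Sum>i=1..n. g (snd (\<omega> i))) \<le> real n * (\<integral>x. g x \<partial>P) - real n * c}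
           \<le> exp (- 2 * real n * c\<^sup>2)"
    using H.Hoeffding_ineq_le[of "real n * c"] n c unfolding 2 by simp
qed

section \<open>Conditional error of a procedure given the observations\<close>

lemma procedure_measurable:
  assumes "is_procedure M n C"
  shows "i \<in> {1..n} \<Longrightarrow> (\<lambda>x. fst C x i) \<in> obs_space M n \<rightarrow>\<^sub>M count_space UNIV"
    and "(\<lambda>x. of_bool (i \<in> snd C x) :: real) \<in> borel_measurable (obs_space M n)"
    and "(\<lambda>x. real (card (snd C x))) \<in> borel_measurable (obs_space M n)"
    and "x \<in> space (obs_space M n) \<Longrightarrow> snd C x \<subseteq> {1..n}"
    and "i \<in> {1..n} \<Longrightarrow> x \<in> space (obs_space M n) \<Longrightarrow> fst C x i \<in> classes M"
proof -
  have S: "snd C \<in> obs_space M n \<rightarrow>\<^sub>M count_space (Pow {1..n})"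
    and Z: "\<And>i. i \<in> {1..n} \<Longrightarrow> (\<lambda>x. fst C x i) \<in> obs_space M n \<rightarrow>\<^sub>M count_space (classes M)"
    using assms by (auto simp: is_procedure_def)
  show "(\<lambda>x. fst C x i) \<in> obs_space M n \<rightarrow>\<^sub>M count_space UNIV" if "i \<in> {1..n}"
    by (rule measurable_compose[OF Z[OF that], where g="\<lambda>y. y", simplified]) simp
  show "(\<lambda>x. of_bool (i \<in> snd C x) :: real) \<in> borel_measurable (obs_space M n)"
    by (rule measurable_compose[OF S, where g="\<lambda>A. of_bool (i \<in> A)"]) simp
  show "(\<lambda>x. real (card (snd C x))) \<in> borel_measurable (obs_space M n)"
    by (rule measurable_compose[OF S, where g="\<lambda>A. real (card A)"]) simp
  show "snd C x \<subseteq> {1..n}" if "x \<in> space (obs_space M n)"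
    using measurable_space[OF S that] by simp
  show "fst C x i \<in> classes M" if "i \<in> {1..n}" "x \<in> space (obs_space M n)"
    using measurable_space[OF Z[OF that(1)] that(2)] by simp
qed

lemma obs_in_space: "\<omega> \<in> space (S n) \<Longrightarrow> obs n \<omega> \<in> space (obs_space M n)"
  using measurable_space[OF obs_measurable] .

lemma AE_post_sum: "AE x in P. (\<Sum>q\<in>classes M. post M \<theta>\<^sub>0 q x) = 1"
  using AE_mix_pos
  by eventually_elim (simp add: post_def mix_def[symmetric] sum_divide_distrib[symmetric])

text \<open>The conditional expectation is characterised by its integrals over events generated by
  the observations. The indicator of such an event is absorbed into the weights, and
  \<open>integral_label\<close> then replaces each label indicator by its posterior.\<close>

lemma cond_exp_label_sum:
  assumes w [measurable]: "\<And>i q. i \<in> {1..n} \<Longrightarrow> q \<in> classes M \<Longrightarrow> w i q \<in> borel_measurable (obs_space M n)"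
    and wb: "\<And>i q x. \<bar>w i q x\<bar> \<le> 1"
    and f: "\<And>\<omega>. \<omega> \<in> space (S n) \<Longrightarrow>
      f \<omega> = (\<Sum>i=1..n. \<Sum>q\<in>classes M. w i q (obs n \<omega>) * of_bool (lab \<omega> i = q))"
  shows "AE \<omega> in S n. cond_exp_obs M \<theta>\<^sub>0 n f \<omega> =
      (\<Sum>i=1..n. \<Sum>q\<in>classes M. w i q (obs n \<omega>) * post M \<theta>\<^sub>0 q (snd (\<omega> i)))"
proof -
  interpret prob_space "S n" by (rule prob_space_sample)
  define F where "F = vimage_algebra (space (S n)) (obs n) (obs_space M n)"
  have obs_sp: "obs n \<in> space (S n) \<rightarrow> space (obs_space M n)"
    using obs_in_space by auto
  have subalg: "subalgebra (S n) F"
    unfolding subalgebra_def F_def sets_vimage_algebra2[OF obs_sp]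
    using measurable_sets[OF obs_measurable] by (auto simp: space_vimage_algebra)
  interpret F: finite_measure_subalgebra "S n" F
    by unfold_locales (rule subalg)
  have obs_F [measurable]: "obs n \<in> F \<rightarrow>\<^sub>M obs_space M n"
    unfolding F_def by (rule measurable_vimage_algebra1[OF obs_sp])
  have lab [measurable]: "(\<lambda>\<omega>. of_bool (lab \<omega> i = q) :: real) \<in> borel_measurable (S n)" if "i \<in> {1..n}" for i q
    by (rule measurable_compose[OF lab_measurable[OF that], where g="\<lambda>l. of_bool (l = q)"]) simp
  have post_obs: "(\<lambda>x. post M \<theta>\<^sub>0 q (x i)) \<in> borel_measurable (obs_space M n)"
    if "i \<in> {1..n}" "q \<in> classes M" for i q
    unfolding obs_space_def using post_measurable[OF true_param that(2)] that(1)
    by (intro measurable_compose[OF measurable_component_singleton[of i "{1..n}" "\<lambda>_. L"]])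
  have post_F: "(\<lambda>\<omega>. post M \<theta>\<^sub>0 q (snd (\<omega> i))) \<in> borel_measurable F"
    if "i \<in> {1..n}" "q \<in> classes M" for i q
    using measurable_compose[OF obs_F post_obs[OF that]] that(1) by (simp add: obs_apply)
  have post_S [measurable]: "(\<lambda>\<omega>. post M \<theta>\<^sub>0 q (snd (\<omega> i))) \<in> borel_measurable (S n)"
    if "i \<in> {1..n}" "q \<in> classes M" for i q
    using measurable_from_subalg[OF subalg post_F[OF that]] .
  have int1: "integrable (S n) (\<lambda>\<omega>. u (obs n \<omega>) * of_bool (lab \<omega> i = q))"
    and int2: "integrable (S n) (\<lambda>\<omega>. u (obs n \<omega>) * post M \<theta>\<^sub>0 q (snd (\<omega> i)))"
    if u [measurable]: "u \<in> borel_measurable (obs_space M n)" and ub: "\<And>x. \<bar>u x\<bar> \<le> 1"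
      and i: "i \<in> {1..n}" and q: "q \<in> classes M" for u :: "(nat \<Rightarrow> rvec) \<Rightarrow> real" and i q
  proof -
    have [measurable]: "(\<lambda>\<omega>. u (obs n \<omega>)) \<in> borel_measurable (S n)"
      by (rule measurable_compose[OF obs_measurable u])
    show "integrable (S n) (\<lambda>\<omega>. u (obs n \<omega>) * of_bool (lab \<omega> i = q))"
      using lab[OF i] ub by (intro integrable_const_bound[where B=1]) (auto simp: abs_mult)
    have "\<bar>u (obs n \<omega>) * post M \<theta>\<^sub>0 q (snd (\<omega> i))\<bar> \<le> 1 * 1" if "\<omega> \<in> space (S n)" for \<omega>
      unfolding abs_mult using ub post_bounds[OF true_param q space_sampleD(2)[OF that i]]
      by (intro mult_mono) auto
    then show "integrable (S n) (\<lambda>\<omega>. u (obs n \<omega>) * post M \<theta>\<^sub>0 q (snd (\<omega> i)))"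
      using post_S[OF i q] by (intro integrable_const_bound[where B=1]) (auto intro: AE_I2)
  qed
  show ?thesis
    unfolding cond_exp_obs_def F_def[symmetric]
  proof (rule F.real_cond_exp_charact)
    have "integrable (S n) (\<lambda>\<omega>. \<Sum>i=1..n. \<Sum>q\<in>classes M. w i q (obs n \<omega>) * of_bool (lab \<omega> i = q))"
      by (intro Bochner_Integration.integrable_sum int1 w wb)
    then show "integrable (S n) f"
      by (rule Bochner_Integration.integrable_cong[THEN iffD1, rotated 2]) (simp_all add: f)
    show "integrable (S n) (\<lambda>\<omega>. \<Sum>i=1..n. \<Sum>q\<in>classes M. w i q (obs n \<omega>) * post M \<theta>\<^sub>0 q (snd (\<omega> i)))"
      by (intro Bochner_Integration.integrable_sum int2 w wb)
    show "(\<lambda>\<omega>. \<Sum>i=1..n. \<Sum>q\<in>classes M. w i q (obs n \<omega>) * post M \<theta>\<^sub>0 q (snd (\<omega> i))) \<in> borel_measurable F"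
      by (intro borel_measurable_sum borel_measurable_times post_F measurable_compose[OF obs_F w])
    fix A assume "A \<in> sets F"
    then obtain B where B [measurable]: "B \<in> sets (obs_space M n)" and A: "A = obs n -` B \<inter> space (S n)"
      unfolding F_def sets_vimage_algebra2[OF obs_sp] by blast
    define u where "u i q x = indicator B x * w i q x" for i q x
    have u: "u i q \<in> borel_measurable (obs_space M n)" if "i \<in> {1..n}" "q \<in> classes M" for i q
      unfolding u_def[abs_def] using w[OF that] by measurable
    have ub: "\<bar>u i q x\<bar> \<le> 1" for i q x using wb by (simp add: u_def indicator_def)
    have "(\<integral>\<omega>\<in>A. f \<omega> \<partial>S n) =
        (\<integral>\<omega>. (\<Sum>i=1..n. \<Sum>q\<in>classes M. u i q (obs n \<omega>) * of_bool (lab \<omega> i = q)) \<partial>S n)"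
      unfolding set_lebesgue_integral_def
      by (intro Bochner_Integration.integral_cong)
        (simp_all add: f A u_def indicator_def sum_distrib_left)
    also have "\<dots> = (\<Sum>i=1..n. \<Sum>q\<in>classes M. \<integral>\<omega>. u i q (obs n \<omega>) * of_bool (lab \<omega> i = q) \<partial>S n)"
      by (rule trans[OF Bochner_Integration.integral_sum],
          (intro Bochner_Integration.integrable_sum int1 u ub; assumption),
          intro sum.cong refl Bochner_Integration.integral_sum int1 u ub)
    also have "\<dots> = (\<Sum>i=1..n. \<Sum>q\<in>classes M. \<integral>\<omega>. u i q (obs n \<omega>) * post M \<theta>\<^sub>0 q (snd (\<omega> i)) \<partial>S n)"
      by (intro sum.cong refl integral_label u)
    also have "\<dots> = (\<integral>\<omega>. (\<Sum>i=1..n. \<Sum>q\<in>classes M. u i q (obs n \<omega>) * post M \<theta>\<^sub>0 q (snd (\<omega> i))) \<partial>S n)"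
      by (rule sym, rule trans[OF Bochner_Integration.integral_sum],
          (intro Bochner_Integration.integrable_sum int2 u ub; assumption),
          intro sum.cong refl Bochner_Integration.integral_sum int2 u ub)
    also have "\<dots> = (\<integral>\<omega>\<in>A. (\<Sum>i=1..n. \<Sum>q\<in>classes M. w i q (obs n \<omega>) * post M \<theta>\<^sub>0 q (snd (\<omega> i))) \<partial>S n)"
      unfolding set_lebesgue_integral_def
      by (intro Bochner_Integration.integral_cong)
        (simp_all add: A u_def indicator_def sum_distrib_left)
    finally show "(\<integral>\<omega>\<in>A. f \<omega> \<partial>S n) =
      (\<integral>\<omega>\<in>A. (\<Sum>i=1..n. \<Sum>q\<in>classes M. w i q (obs n \<omega>) * post M \<theta>\<^sub>0 q (snd (\<omega> i))) \<partial>S n)" .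
  qed
qed

text \<open>An error on a selected item is a sum of label indicators over the classes other than the
  assigned one, with weights depending on the observations only. Posteriors replace the indicators,
  and as they sum to one, those of the other classes give 1 minus that of the assigned class. The
  divisor \<open>D\<close> is 1 for the mFMR and max(|S|, 1) for the FMR.\<close>

lemma cond_exp_misclass:
  assumes C: "is_procedure M n C" and \<sigma>: "\<sigma> permutes classes M"
    and D [measurable]: "D \<in> borel_measurable (obs_space M n)" and D1: "\<And>x. 1 \<le> D x"
  shows "AE \<omega> in S n. cond_exp_obs M \<theta>\<^sub>0 n
        (\<lambda>\<omega>. misclass (snd C (obs n \<omega>)) (\<sigma> \<circ> fst C (obs n \<omega>)) (lab \<omega>) / D (obs n \<omega>)) \<omega> =
      (\<Sum>i\<in>snd C (obs n \<omega>). 1 - post M \<theta>\<^sub>0 (\<sigma> (fst C (obs n \<omega>) i)) (snd (\<omega> i))) / D (obs n \<omega>)"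
proof -
  define w where "w i q x = of_bool (i \<in> snd C x) * of_bool (q \<noteq> \<sigma> (fst C x i)) / D x" for i q x
  have *: "(\<Sum>i=1..n. of_bool (i \<in> snd C (obs n \<omega>)) * h i / D (obs n \<omega>)) =
      (\<Sum>i\<in>snd C (obs n \<omega>). h i) / D (obs n \<omega>)" if "\<omega> \<in> space (S n)" for h \<omega>
  proof -
    have "(\<Sum>i=1..n. of_bool (i \<in> snd C (obs n \<omega>)) * h i / D (obs n \<omega>)) =
      (\<Sum>i=1..n. if i \<in> snd C (obs n \<omega>) then h i else 0) / D (obs n \<omega>)"
      unfolding sum_divide_distrib by (intro sum.cong) auto
    also have "(\<Sum>i=1..n. if i \<in> snd C (obs n \<omega>) then h i else 0) = (\<Sum>i\<in>{1..n} \<inter> snd C (obs n \<omega>). h i)"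
      by (simp add: sum.inter_restrict)
    also have "{1..n} \<inter> snd C (obs n \<omega>) = snd C (obs n \<omega>)"
      using procedure_measurable(4)[OF C obs_in_space[OF that]] by blast
    finally show ?thesis .
  qed
  have "AE \<omega> in S n. cond_exp_obs M \<theta>\<^sub>0 n
        (\<lambda>\<omega>. misclass (snd C (obs n \<omega>)) (\<sigma> \<circ> fst C (obs n \<omega>)) (lab \<omega>) / D (obs n \<omega>)) \<omega> =
      (\<Sum>i=1..n. \<Sum>q\<in>classes M. w i q (obs n \<omega>) * post M \<theta>\<^sub>0 q (snd (\<omega> i)))"
  proof (rule cond_exp_label_sum)
    fix i q assume i: "i \<in> {1..n}" and q: "q \<in> classes M"
    have [measurable]: "(\<lambda>x. of_bool (q \<noteq> \<sigma> (fst C x i)) :: real) \<in> borel_measurable (obs_space M n)"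
      by (rule measurable_compose[OF procedure_measurable(1)[OF C i], where g="\<lambda>l. of_bool (q \<noteq> \<sigma> l)"]) simp
    note [measurable] = procedure_measurable(2)[OF C]
    show "w i q \<in> borel_measurable (obs_space M n)"
      unfolding w_def[abs_def] by measurable
  next
    show "\<bar>w i q x\<bar> \<le> 1" for i q x
      using D1[of x] by (simp add: w_def)
  next
    fix \<omega> assume \<omega>: "\<omega> \<in> space (S n)"
    have "(\<Sum>q\<in>classes M. w i q (obs n \<omega>) * of_bool (lab \<omega> i = q)) =
      of_bool (i \<in> snd C (obs n \<omega>)) * of_bool (lab \<omega> i \<noteq> \<sigma> (fst C (obs n \<omega>) i)) / D (obs n \<omega>)"
      if "i \<in> {1..n}" for i
    proof -
      have "(\<Sum>q\<in>classes M. w i q (obs n \<omega>) * of_bool (lab \<omega> i = q)) =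
          (\<Sum>q\<in>classes M. if lab \<omega> i = q then w i q (obs n \<omega>) else 0)"
        by (intro sum.cong) auto
      then show ?thesis
        using space_sampleD(1)[OF \<omega> that] by (simp add: w_def)
    qed
    then have "(\<Sum>i=1..n. \<Sum>q\<in>classes M. w i q (obs n \<omega>) * of_bool (lab \<omega> i = q)) =
      (\<Sum>i=1..n. of_bool (i \<in> snd C (obs n \<omega>)) * of_bool (lab \<omega> i \<noteq> \<sigma> (fst C (obs n \<omega>) i)) / D (obs n \<omega>))"
      by (intro sum.cong) auto
    then show "misclass (snd C (obs n \<omega>)) (\<sigma> \<circ> fst C (obs n \<omega>)) (lab \<omega>) / D (obs n \<omega>) =
        (\<Sum>i=1..n. \<Sum>q\<in>classes M. w i q (obs n \<omega>) * of_bool (lab \<omega> i = q))"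
      unfolding *[OF \<omega>] by (simp add: misclass_def)
  qed
  moreover have "AE \<omega> in S n. \<forall>i\<in>{1..n}. (\<Sum>q\<in>classes M. post M \<theta>\<^sub>0 q (snd (\<omega> i))) = 1"
    by (intro AE_finite_allI AE_obs_coord AE_post_sum) auto
  ultimately show ?thesis
    using AE_space
  proof eventually_elim
    case (elim \<omega>)
    have "(\<Sum>q\<in>classes M. w i q (obs n \<omega>) * post M \<theta>\<^sub>0 q (snd (\<omega> i))) =
      of_bool (i \<in> snd C (obs n \<omega>)) * (1 - post M \<theta>\<^sub>0 (\<sigma> (fst C (obs n \<omega>) i)) (snd (\<omega> i))) / D (obs n \<omega>)"
      if i: "i \<in> {1..n}" for i
    proof -
      let ?l = "\<sigma> (fst C (obs n \<omega>) i)"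
      have l: "?l \<in> classes M"
        using procedure_measurable(5)[OF C i obs_in_space[OF elim(3)]] permutes_in_image[OF \<sigma>] by blast
      have "(\<Sum>q\<in>classes M. w i q (obs n \<omega>) * post M \<theta>\<^sub>0 q (snd (\<omega> i))) =
        of_bool (i \<in> snd C (obs n \<omega>)) / D (obs n \<omega>) * (\<Sum>q\<in>classes M - {?l}. post M \<theta>\<^sub>0 q (snd (\<omega> i)))"
        unfolding sum_distrib_left by (intro sum.mono_neutral_cong_right) (auto simp: w_def)
      also have "(\<Sum>q\<in>classes M - {?l}. post M \<theta>\<^sub>0 q (snd (\<omega> i))) = 1 - post M \<theta>\<^sub>0 ?l (snd (\<omega> i))"
        using elim(2) i l by (subst sum_diff1) auto
      finally show ?thesis by simp
    qed
    then have "(\<Sum>i=1..n. \<Sum>q\<in>classes M. w i q (obs n \<omega>) * post M \<theta>\<^sub>0 q (snd (\<omega> i))) =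
      (\<Sum>i=1..n. of_bool (i \<in> snd C (obs n \<omega>)) * (1 - post M \<theta>\<^sub>0 (\<sigma> (fst C (obs n \<omega>) i)) (snd (\<omega> i))) / D (obs n \<omega>))"
      by (intro sum.cong) auto
    then show ?case unfolding *[OF elim(3)] using elim(1) by simp
  qed
qed

section \<open>Local oscillation of the posterior probabilities\<close>

lemma coord_props:
  shows coord_inj: "inj_on (coord M) (\<Union>\<sigma>\<in>perms M. relabel \<sigma> ` params M)"
    and coord_in_topspace: "\<sigma> permutes classes M \<Longrightarrow> \<theta> \<in> params M \<Longrightarrow>
      coord M (relabel \<sigma> \<theta>) \<in> topspace (Euclidean_space (pdim M))"
    and params_open: "openin (Euclidean_space (pdim M)) (coord M ` params M)"
  using model unfolding mixture_model_def Let_def by blast+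

lemma relabel_id [simp]: "relabel id \<theta> = \<theta>"
  by (simp add: relabel_def)

lemma params_relabelled: "params M \<subseteq> (\<Union>\<sigma>\<in>perms M. relabel \<sigma> ` params M)"
proof
  fix \<theta> assume "\<theta> \<in> params M"
  then have "relabel id \<theta> \<in> relabel id ` params M" by blast
  then show "\<theta> \<in> (\<Union>\<sigma>\<in>perms M. relabel \<sigma> ` params M)"
    by (intro UN_I[of id]) (simp_all add: permutes_id)
qed

lemma inv_coord: "\<theta> \<in> params M \<Longrightarrow> inv_into (params M) (coord M) (coord M \<theta>) = \<theta>"
  using inj_on_subset[OF coord_inj params_relabelled] by simp

text \<open>A relabelled parameter need not lie in \<open>params M\<close>. Near the truth openness
  provides a parameter with the same coordinates, and injectivity of \<open>coord M\<close> on all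
  relabellings identifies the two.\<close>

lemma params_ball:
  obtains \<rho> where "0 < \<rho>"
    "\<And>y. y \<in> topspace (Euclidean_space (pdim M)) \<Longrightarrow> edist (pdim M) y (coord M \<theta>\<^sub>0) < \<rho> \<Longrightarrow>
      y \<in> coord M ` params M"
    "\<And>\<sigma> \<theta>. \<sigma> permutes classes M \<Longrightarrow> \<theta> \<in> params M \<Longrightarrow> pdist M (relabel \<sigma> \<theta>) \<theta>\<^sub>0 < \<rho> \<Longrightarrow>
      relabel \<sigma> \<theta> \<in> params M"
proof -
  obtain \<rho> where \<rho>: "0 < \<rho>" "\<And>y. y \<in> topspace (Euclidean_space (pdim M)) \<Longrightarrow>
      edist (pdim M) y (coord M \<theta>\<^sub>0) < \<rho> \<Longrightarrow> y \<in> coord M ` params M"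
    using openin_Euclidean_space_edist[OF params_open] true_param by blast
  have "relabel \<sigma> \<theta> \<in> params M"
    if "\<sigma> permutes classes M" "\<theta> \<in> params M" "pdist M (relabel \<sigma> \<theta>) \<theta>\<^sub>0 < \<rho>" for \<sigma> \<theta>
  proof -
    have "coord M (relabel \<sigma> \<theta>) \<in> coord M ` params M"
      using \<rho>(2) coord_in_topspace that by (simp add: pdist_def)
    then obtain \<theta>' where \<theta>': "\<theta>' \<in> params M" "coord M (relabel \<sigma> \<theta>) = coord M \<theta>'" by blast
    then have "relabel \<sigma> \<theta> = \<theta>'"
      using params_relabelled \<theta>'(1) that(1,2) by (intro inj_onD[OF coord_inj \<theta>'(2)]) blast+
    then show ?thesis using \<theta>' by simp
  qed
  with \<rho> show ?thesis using that by blast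
qed

definition grad_sup :: "real \<Rightarrow> nat \<Rightarrow> rvec \<Rightarrow> ennreal" where
  "grad_sup r q x = (SUP \<theta>\<in>{\<theta>\<in>params M. pdist M \<theta> \<theta>\<^sub>0 \<le> r}. ennreal (grad_post_norm M \<theta> q x))"

text \<open>The segment to the truth stays in the ball, hence in the parameter set, so the mean
  value bound applies with the supremum of the gradient norms; where this is infinite the claim is
  trivial, as \<epsilon> is positive.\<close>

lemma post_lipschitz:
  assumes ball: "\<And>y. y \<in> topspace (Euclidean_space (pdim M)) \<Longrightarrow>
      edist (pdim M) y (coord M \<theta>\<^sub>0) < \<epsilon> \<Longrightarrow> y \<in> coord M ` params M"
    and "0 < \<epsilon>" "\<epsilon> \<le> r"
    and grad: "\<And>\<theta>. \<theta> \<in> params M \<Longrightarrow> pdist M \<theta> \<theta>\<^sub>0 \<le> r \<Longrightarrow>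
      \<exists>g. has_gradient (pdim M) (post_coord M q x) g (coord M \<theta>) (coord M ` params M)"
    and \<theta>: "\<theta> \<in> params M" "pdist M \<theta> \<theta>\<^sub>0 < \<epsilon>"
  shows "ennreal \<bar>post M \<theta> q x - post M \<theta>\<^sub>0 q x\<bar> \<le> ennreal \<epsilon> * grad_sup r q x"
proof (cases "grad_sup r q x")
  case (real B)
  let ?l = "\<lambda>s k. coord M \<theta>\<^sub>0 k + s * (coord M \<theta> k - coord M \<theta>\<^sub>0 k)"
  define G where "G s = gradient (pdim M) (post_coord M q x) (coord M ` params M) (?l s)" for s
  have *: "\<exists>\<theta>'\<in>params M. ?l s = coord M \<theta>' \<and> pdist M \<theta>' \<theta>\<^sub>0 \<le> r" if s: "s \<in> {0..1}" for s
  proof -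
    have "coord M \<theta> \<in> topspace (Euclidean_space (pdim M))" "coord M \<theta>\<^sub>0 \<in> topspace (Euclidean_space (pdim M))"
      using coord_in_topspace[OF permutes_id] \<theta>(1) true_param by (auto simp flip: id_def)
    then have top: "?l s \<in> topspace (Euclidean_space (pdim M))"
      by (simp add: topspace_Euclidean_space)
    have "edist (pdim M) (?l s) (coord M \<theta>\<^sub>0) = s * pdist M \<theta> \<theta>\<^sub>0"
      using s by (simp add: edist_def pdist_def L2_set_right_distrib)
    also have "\<dots> \<le> 1 * pdist M \<theta> \<theta>\<^sub>0"
      using s by (intro mult_right_mono) (auto simp: pdist_def edist_def)
    finally have "edist (pdim M) (?l s) (coord M \<theta>\<^sub>0) < \<epsilon>" using \<theta>(2) by simp
    then show ?thesis using ball[OF top] \<open>\<epsilon> \<le> r\<close> by (force simp: pdist_def)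
  qed
  have "\<bar>post_coord M q x (coord M \<theta>) - post_coord M q x (coord M \<theta>\<^sub>0)\<bar>
      \<le> B * edist (pdim M) (coord M \<theta>) (coord M \<theta>\<^sub>0)"
  proof (rule has_gradient_mean_value[where G=G and S="coord M ` params M"])
    fix s :: real assume "s \<in> {0..1}"
    then obtain \<theta>' where \<theta>': "\<theta>' \<in> params M" "?l s = coord M \<theta>'" "pdist M \<theta>' \<theta>\<^sub>0 \<le> r"
      using * by blast
    show "?l s \<in> coord M ` params M" using \<theta>' by auto
    show "has_gradient (pdim M) (post_coord M q x) (G s) (?l s) (coord M ` params M)"
      unfolding G_def gradient_def \<theta>'(2) using grad[OF \<theta>'(1,3)] by (rule someI_ex)
    have "ennreal (grad_post_norm M \<theta>' q x) \<le> ennreal B"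
      unfolding real(2)[symmetric] grad_sup_def using \<theta>' by (intro SUP_upper) auto
    then show "L2_set (G s) {..<pdim M} \<le> B"
      using real(1) by (simp add: grad_post_norm_def G_def \<theta>'(2))
  qed
  also have "\<dots> \<le> B * \<epsilon>"
    using real(1) \<theta>(2) by (intro mult_left_mono) (auto simp: pdist_def)
  finally have "\<bar>post M \<theta> q x - post M \<theta>\<^sub>0 q x\<bar> \<le> \<epsilon> * B"
    by (simp add: post_coord_def inv_coord \<theta> true_param mult.commute)
  then show ?thesis
    using real \<open>0 < \<epsilon>\<close> by (simp add: ennreal_mult[symmetric] ennreal_leI)
next
  case top
  then show ?thesis using \<open>0 < \<epsilon>\<close> by (simp add: ennreal_mult_top)
qed

text \<open>A bound for all parameters of \<open>D\<close> at once, so that it applies to a random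
  one. Classes are summed because (A3) bounds the sum over the classes of the integrated gradient
  norms; extended reals postpone the question whether the suprema are finite.\<close>

definition osc :: "param set \<Rightarrow> rvec \<Rightarrow> ennreal" where
  "osc D x = (\<Sum>q\<in>classes M. SUP \<theta>\<in>D. ennreal \<bar>post M \<theta> q x - post M \<theta>\<^sub>0 q x\<bar>)"

lemma osc_measurable [measurable]:
  assumes "countable D" "D \<subseteq> params M"
  shows "osc D \<in> borel_measurable L"
proof -
  have "(\<lambda>x. \<Sum>q\<in>classes M. SUP \<theta>\<in>D. ennreal \<bar>post M \<theta> q x - post M \<theta>\<^sub>0 q x\<bar>) \<in> borel_measurable L"
  proof (intro borel_measurable_sum borel_measurable_SUP assms(1))
    fix q \<theta> assume q: "q \<in> classes M" and "\<theta> \<in> D"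
    then have "\<theta> \<in> params M" using assms(2) by blast
    note [measurable] = post_measurable[OF this q] post_measurable[OF true_param q]
    show "(\<lambda>x. ennreal \<bar>post M \<theta> q x - post M \<theta>\<^sub>0 q x\<bar>) \<in> borel_measurable L" by measurable
  qed
  then show ?thesis by (simp add: osc_def[abs_def])
qed

lemma post_le_osc:
  assumes "q \<in> classes M" "\<theta> \<in> D"
  shows "ennreal \<bar>post M \<theta> q x - post M \<theta>\<^sub>0 q x\<bar> \<le> osc D x"
proof -
  have "ennreal \<bar>post M \<theta> q x - post M \<theta>\<^sub>0 q x\<bar> \<le> (SUP \<theta>\<in>D. ennreal \<bar>post M \<theta> q x - post M \<theta>\<^sub>0 q x\<bar>)"
    by (rule SUP_upper[OF assms(2)])
  also have "\<dots> \<le> osc D x"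
    unfolding osc_def using assms(1) by (intro member_le_sum) auto
  finally show ?thesis .
qed

lemma nn_integral_osc:
  assumes ball: "\<And>y. y \<in> topspace (Euclidean_space (pdim M)) \<Longrightarrow>
      edist (pdim M) y (coord M \<theta>\<^sub>0) < \<epsilon> \<Longrightarrow> y \<in> coord M ` params M"
    and \<epsilon>: "0 < \<epsilon>" "\<epsilon> \<le> r" and A3: "A3 M \<theta>\<^sub>0 \<alpha> r C\<^sub>1 C\<^sub>2 C\<^sub>3"
    and D: "countable D" "\<And>\<theta>. \<theta> \<in> D \<Longrightarrow> \<theta> \<in> params M \<and> pdist M \<theta> \<theta>\<^sub>0 < \<epsilon>"
  shows "(\<integral>\<^sup>+x. osc D x \<partial>P) \<le> ennreal (\<epsilon> * C\<^sub>1)"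
proof -
  have C1: "0 < C\<^sub>1" "(\<Sum>q\<in>classes M. \<integral>\<^sup>+x. grad_sup r q x \<partial>P) \<le> ennreal C\<^sub>1"
    and AE: "AE x in P. \<forall>q\<in>classes M. \<forall>\<theta>\<in>params M. pdist M \<theta> \<theta>\<^sub>0 \<le> r \<longrightarrow>
        (\<exists>g. has_gradient (pdim M) (post_coord M q x) g (coord M \<theta>) (coord M ` params M))"
    using A3 unfolding A3_def grad_sup_def by auto
  let ?h = "\<lambda>q x. SUP \<theta>\<in>D. ennreal \<bar>post M \<theta> q x - post M \<theta>\<^sub>0 q x\<bar>"
  have h [measurable]: "?h q \<in> borel_measurable P" if q: "q \<in> classes M" for q
  proof (intro borel_measurable_SUP D(1))
    fix \<theta> assume "\<theta> \<in> D"
    then have "\<theta> \<in> params M" using D(2) by blast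
    note [measurable] = post_measurable[OF this q] post_measurable[OF true_param q]
    show "(\<lambda>x. ennreal \<bar>post M \<theta> q x - post M \<theta>\<^sub>0 q x\<bar>) \<in> borel_measurable P" by measurable
  qed
  have "(\<integral>\<^sup>+x. osc D x \<partial>P) = (\<Sum>q\<in>classes M. \<integral>\<^sup>+x. ?h q x \<partial>P)"
    unfolding osc_def by (rule nn_integral_sum) (rule h)
  also have "\<dots> \<le> (\<Sum>q\<in>classes M. ennreal \<epsilon> * (\<integral>\<^sup>+x. grad_sup r q x \<partial>P))"
  proof (rule sum_mono)
    fix q assume q: "q \<in> classes M"
    have one: "ennreal \<epsilon> * ennreal (1 / \<epsilon>) = 1" using \<epsilon> by (simp add: ennreal_mult[symmetric])
    \<comment> \<open>\<open>grad_sup\<close> need not be measurable, so the constant factor is moved to the other side, where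
      it can be pulled out of the integral.\<close>
    have "(\<integral>\<^sup>+x. ?h q x \<partial>P) = (\<integral>\<^sup>+x. ennreal \<epsilon> * (ennreal (1 / \<epsilon>) * ?h q x) \<partial>P)"
      by (simp only: mult.assoc[symmetric] one mult_1_left)
    also have "\<dots> = ennreal \<epsilon> * (\<integral>\<^sup>+x. ennreal (1 / \<epsilon>) * ?h q x \<partial>P)"
      by (intro nn_integral_cmult borel_measurable_times_ennreal borel_measurable_const h[OF q])
    also have "\<dots> \<le> ennreal \<epsilon> * (\<integral>\<^sup>+x. grad_sup r q x \<partial>P)"
    proof (intro mult_left_mono nn_integral_mono_AE)
      show "AE x in P. ennreal (1 / \<epsilon>) * ?h q x \<le> grad_sup r q x"
        using AE
      proof eventually_elim
        case (elim x)
        have "?h q x \<le> ennreal \<epsilon> * grad_sup r q x"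
          using D(2) elim q by (intro SUP_least post_lipschitz[OF ball \<epsilon>]) auto
        then have "ennreal (1 / \<epsilon>) * ?h q x \<le> ennreal (1 / \<epsilon>) * (ennreal \<epsilon> * grad_sup r q x)"
          by (intro mult_left_mono) auto
        then show ?case by (simp only: mult.assoc[symmetric] one mult_1_left mult.commute[of "ennreal (1/\<epsilon>)"])
      qed
    qed simp
    finally show "(\<integral>\<^sup>+x. ?h q x \<partial>P) \<le> ennreal \<epsilon> * (\<integral>\<^sup>+x. grad_sup r q x \<partial>P)" .
  qed
  also have "\<dots> \<le> ennreal \<epsilon> * ennreal C\<^sub>1"
    unfolding sum_distrib_left[symmetric] using C1(2) by (intro mult_left_mono) auto
  also have "\<dots> = ennreal (\<epsilon> * C\<^sub>1)" using \<epsilon> C1 by (simp add: ennreal_mult)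
  finally show ?thesis .
qed

section \<open>Thresholds\<close>

abbreviation T0 :: "rvec \<Rightarrow> real" where "T0 \<equiv> Tstat M \<theta>\<^sub>0"

definition T_cdf :: "real \<Rightarrow> real" where
  "T_cdf t = \<P>(x in P. T0 x < t)"

text \<open>A quotient-free form of the thresholded mFMR: its sign tells whether a nonnegative level
  \<open>a\<close> is met, it is affine in \<open>a\<close>, and it inherits Lipschitz continuity in
  \<open>t\<close> from the distribution function of \<open>T0\<close>.\<close>

definition excess :: "real \<Rightarrow> real \<Rightarrow> real" where
  "excess a t = (\<integral>x. (T0 x - a) * of_bool (T0 x < t) \<partial>P)"

lemma T0_measurable [measurable]: "T0 \<in> borel_measurable L"
  by (rule Tstat_measurable[OF true_param])

lemma T0_bounds: "x \<in> space L \<Longrightarrow> 0 \<le> T0 x" "x \<in> space L \<Longrightarrow> T0 x \<le> 1"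
  using Tstat_bounds[OF true_param] by auto

lemma integrable_P:
  assumes [measurable]: "g \<in> borel_measurable L" and "\<And>x. x \<in> space L \<Longrightarrow> \<bar>g x :: real\<bar> \<le> B"
  shows "integrable P g"
proof -
  interpret prob_space P by (rule prob_space_P)
  show ?thesis using assms(2) by (intro integrable_const_bound[where B=B]) auto
qed

lemma integrable_excess:
  "integrable P (\<lambda>x. (T0 x - a) * of_bool (T0 x < t))"
  "integrable P (\<lambda>x. of_bool (T0 x < t) :: real)"
proof -
  show "integrable P (\<lambda>x. (T0 x - a) * of_bool (T0 x < t))"
    using T0_bounds by (intro integrable_P[where B="1 + \<bar>a\<bar>"]) (measurable, force simp: abs_mult)
  show "integrable P (\<lambda>x. of_bool (T0 x < t) :: real)"
    by (intro integrable_P[where B=1]) auto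
qed

lemma T_cdf_integral: "T_cdf t = (\<integral>x. of_bool (T0 x < t) \<partial>P)"
proof -
  have "(\<integral>x. of_bool (T0 x < t) \<partial>P) = (\<integral>x. indicator {x \<in> space P. T0 x < t} x \<partial>P)"
    by (intro Bochner_Integration.integral_cong) (auto simp: indicator_def)
  also have "\<dots> = measure P {x \<in> space P. T0 x < t}" by (subst Bochner_Integration.integral_indicator) (auto intro!: arg_cong[where f="measure P"])
  finally show ?thesis by (simp add: T_cdf_def)
qed

lemma T_cdf_nonneg: "0 \<le> T_cdf t"
  by (simp add: T_cdf_def)

lemma T_cdf_mono: "s \<le> t \<Longrightarrow> T_cdf s \<le> T_cdf t"
  unfolding T_cdf_integral by (intro integral_mono integrable_excess) auto

lemma excess_eq: "excess a t = excess b t + (b - a) * T_cdf t"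
proof -
  have "excess a t = (\<integral>x. (T0 x - b) * of_bool (T0 x < t) + (b - a) * of_bool (T0 x < t) \<partial>P)"
    unfolding excess_def by (intro Bochner_Integration.integral_cong) (auto simp: algebra_simps)
  then show ?thesis using integrable_excess by (simp add: excess_def T_cdf_integral)
qed

lemma excess_0_bounds: "0 \<le> excess 0 t" "excess 0 t \<le> T_cdf t"
proof -
  show "0 \<le> excess 0 t"
    unfolding excess_def using T0_bounds by (intro integral_nonneg_AE AE_I2) auto
  show "excess 0 t \<le> T_cdf t"
    unfolding excess_def T_cdf_integral using T0_bounds
    by (intro integral_mono integrable_excess) auto
qed

lemma mFMR_thr_eq: "mFMR_thr M \<theta>\<^sub>0 t = excess 0 t / T_cdf t"
  by (simp add: mFMR_thr_def excess_def T_cdf_def)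

text \<open>If no mass lies below \<open>t\<close>, the quotient is 0 by convention and the excess
  is 0 too, so both sides hold.\<close>

lemma mFMR_thr_le_iff:
  assumes "0 \<le> a"
  shows "mFMR_thr M \<theta>\<^sub>0 t \<le> a \<longleftrightarrow> excess a t \<le> 0"
proof (cases "T_cdf t = 0")
  case True
  then show ?thesis
    using assms excess_0_bounds[of t] by (simp add: mFMR_thr_eq excess_eq[of a t 0])
next
  case False
  then have "0 < T_cdf t" using T_cdf_nonneg[of t] by simp
  then show ?thesis
    by (simp add: mFMR_thr_eq excess_eq[of a t 0] pos_divide_le_eq)
qed

text \<open>Only points with \<open>T0\<close> between the two thresholds contribute, and there the
  integrand is at most 1 + |a| in absolute value.\<close>

lemma excess_diff_le:
  assumes "s \<le> t"
  shows "\<bar>excess a t - excess a s\<bar> \<le> (1 + \<bar>a\<bar>) * (T_cdf t - T_cdf s)"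
proof -
  have "excess a t - excess a s = (\<integral>x. (T0 x - a) * (of_bool (T0 x < t) - of_bool (T0 x < s)) \<partial>P)"
    unfolding excess_def right_diff_distrib
    by (rule Bochner_Integration.integral_diff[symmetric]) (rule integrable_excess)+
  also have "\<bar>\<dots>\<bar> \<le> (\<integral>x. (1 + \<bar>a\<bar>) * (of_bool (T0 x < t) - of_bool (T0 x < s)) \<partial>P)"
  proof (rule order_trans[OF integral_abs_bound integral_mono])
    show "integrable P (\<lambda>x. \<bar>(T0 x - a) * (of_bool (T0 x < t) - of_bool (T0 x < s))\<bar>)"
      unfolding right_diff_distrib by (intro integrable_abs Bochner_Integration.integrable_diff integrable_excess)
    show "integrable P (\<lambda>x. (1 + \<bar>a\<bar>) * (of_bool (T0 x < t) - of_bool (T0 x < s)))"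
      by (intro integrable_mult_right Bochner_Integration.integrable_diff integrable_excess)
    fix x assume "x \<in> space P"
    then show "\<bar>(T0 x - a) * (of_bool (T0 x < t) - of_bool (T0 x < s))\<bar>
        \<le> (1 + \<bar>a\<bar>) * (of_bool (T0 x < t) - of_bool (T0 x < s))"
      using T0_bounds[of x] assms by (auto simp: abs_mult)
  qed
  also have "\<dots> = (1 + \<bar>a\<bar>) * (T_cdf t - T_cdf s)"
    unfolding T_cdf_integral by (simp add: integrable_excess)
  finally show ?thesis .
qed

section \<open>The threshold t* as a function of the level\<close>

lemma t_star_eq: "0 \<le> a \<Longrightarrow> t_star M \<theta>\<^sub>0 a = Sup {t \<in> {0..1}. excess a t \<le> 0}"
  unfolding t_star_def by (simp add: mFMR_thr_le_iff)

lemma zero_in_levels: "0 \<in> {t \<in> {0..1}. excess a t \<le> 0}"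
proof -
  have "excess a 0 = (\<integral>x. 0 \<partial>P)"
    unfolding excess_def using T0_bounds
    by (intro Bochner_Integration.integral_cong) (auto simp: not_less)
  then show ?thesis by simp
qed

lemma t_star_upper: "0 \<le> a \<Longrightarrow> t \<in> {0..1} \<Longrightarrow> excess a t \<le> 0 \<Longrightarrow> t \<le> t_star M \<theta>\<^sub>0 a"
  unfolding t_star_eq by (intro cSup_upper bdd_aboveI[of _ 1]) auto

lemma t_star_range: "0 \<le> a \<Longrightarrow> t_star M \<theta>\<^sub>0 a \<in> {0..1}"
proof -
  assume a: "0 \<le> a"
  have "0 \<le> t_star M \<theta>\<^sub>0 a" using t_star_upper[OF a] zero_in_levels[of a] by blast
  moreover have "t_star M \<theta>\<^sub>0 a \<le> 1"
    unfolding t_star_eq[OF a] using zero_in_levels[of a] by (intro cSup_least) (blast, simp)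
  ultimately show ?thesis by simp
qed

lemma t_star_mono:
  assumes "0 \<le> a" "a \<le> b"
  shows "t_star M \<theta>\<^sub>0 a \<le> t_star M \<theta>\<^sub>0 b"
proof -
  have "excess b t \<le> excess a t" for t
    using excess_eq[of b t a] assms(2) T_cdf_nonneg[of t] by (simp add: mult_nonpos_nonneg)
  moreover have ne: "{t \<in> {0..1}. excess a t \<le> 0} \<noteq> {}" using zero_in_levels[of a] by blast
  ultimately show ?thesis
    using assms unfolding t_star_eq[OF assms(1)] t_star_eq[OF order_trans[OF assms]]
    by (intro cSup_subset_mono bdd_aboveI[of _ 1] ne) (auto intro: order_trans)
qed

text \<open>The posteriors sum to one, so one of them is positive. Thresholding strictly at 1 thus
  discards only a null set, and \<open>alpha_bar\<close> is the unconditional mean of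
  \<open>T0\<close>.\<close>

lemma AE_T0_less_1: "AE x in P. T0 x < 1"
  using AE_post_sum
proof eventually_elim
  case (elim x)
  have "\<exists>q\<in>classes M. 0 < post M \<theta>\<^sub>0 q x"
  proof (rule ccontr)
    assume "\<not> ?thesis"
    then have "(\<Sum>q\<in>classes M. post M \<theta>\<^sub>0 q x) \<le> 0" by (intro sum_nonpos) (auto simp: not_less)
    then show False using elim by simp
  qed
  then obtain q where "q \<in> classes M" "0 < post M \<theta>\<^sub>0 q x" by blast
  then show ?case using Tstat_le[of q \<theta>\<^sub>0 x] by simp
qed

lemma T_cdf_1: "T_cdf 1 = 1"
proof -
  interpret prob_space P by (rule prob_space_P)
  show ?thesis unfolding T_cdf_def using AE_T0_less_1 by (intro prob_eq_1[THEN iffD2]) auto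
qed

lemma alpha_bar_eq: "alpha_bar M \<theta>\<^sub>0 = excess 0 1"
  by (simp add: alpha_bar_def mFMR_thr_eq T_cdf_1)

text \<open>Otherwise \<open>T0\<close> vanishes almost surely, so some posterior equals 1, against
  the absence of atoms in (A1).\<close>

lemma alpha_bar_pos:
  assumes "A1 M \<theta>\<^sub>0"
  shows "0 < alpha_bar M \<theta>\<^sub>0"
proof (rule ccontr)
  interpret prob_space P by (rule prob_space_P)
  assume "\<not> ?thesis"
  then have "excess 0 1 = 0" using excess_0_bounds(1)[of 1] by (simp add: alpha_bar_eq)
  then have "AE x in P. (T0 x - 0) * of_bool (T0 x < 1) = 0"
    unfolding excess_def using T0_bounds integrable_excess(1)[of 0 1]
    by (subst (asm) integral_nonneg_eq_0_iff_AE) auto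
  moreover note AE_T0_less_1
  moreover have "AE x in P. \<forall>q\<in>classes M. post M \<theta>\<^sub>0 q x \<noteq> 1"
  proof (intro AE_finite_allI)
    fix q assume q: "q \<in> classes M"
    note [measurable] = post_measurable[OF true_param q]
    have "prob {x \<in> space P. post M \<theta>\<^sub>0 q x = 1} = 0"
      using assms q true_param by (auto simp: A1_def)
    then show "AE x in P. post M \<theta>\<^sub>0 q x \<noteq> 1"
      by (subst (asm) prob_eq_0) auto
  qed simp
  ultimately have "AE x in P. False"
  proof eventually_elim
    case (elim x)
    obtain q where "q \<in> classes M" "T0 x = 1 - post M \<theta>\<^sub>0 q x" by (rule Tstat_attained)
    then show ?case using elim by auto
  qed
  then show False by simp
qed

text \<open>The infimum is over a nonempty set, \<open>alpha_bar\<close> being a member; so for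
  \<open>a\<close> above it some threshold has a positive mFMR below \<open>a\<close>. A positive
  mFMR forces positive mass, and this threshold is at most t*(a).\<close>

lemma alpha_c_props:
  assumes "A1 M \<theta>\<^sub>0"
  shows alpha_c_nonneg: "0 \<le> alpha_c M \<theta>\<^sub>0"
    and alpha_c_less: "alpha_c M \<theta>\<^sub>0 < a \<Longrightarrow> 0 < T_cdf (t_star M \<theta>\<^sub>0 a)"
proof -
  let ?A = "{mFMR_thr M \<theta>\<^sub>0 t |t. t \<in> {0<..1} \<and> mFMR_thr M \<theta>\<^sub>0 t > 0}"
  have "mFMR_thr M \<theta>\<^sub>0 1 \<in> ?A" using alpha_bar_pos[OF assms] unfolding alpha_bar_def by force
  then have ne: "?A \<noteq> {}" by blast
  show nn: "0 \<le> alpha_c M \<theta>\<^sub>0"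
    unfolding alpha_c_def using ne by (intro cInf_greatest) auto
  assume a: "alpha_c M \<theta>\<^sub>0 < a"
  then obtain t where t: "t \<in> {0<..1}" "0 < mFMR_thr M \<theta>\<^sub>0 t" "mFMR_thr M \<theta>\<^sub>0 t < a"
    using cInf_lessD[OF ne, of a] unfolding alpha_c_def by blast
  have "0 \<le> a" using nn a by simp
  then have "t \<le> t_star M \<theta>\<^sub>0 a"
    using t mFMR_thr_le_iff[of a t] by (intro t_star_upper) auto
  moreover have "0 < T_cdf t"
    using t(2) T_cdf_nonneg[of t] by (cases "T_cdf t = 0") (auto simp: mFMR_thr_eq)
  ultimately show "0 < T_cdf (t_star M \<theta>\<^sub>0 a)" using T_cdf_mono by (meson less_le_trans)
qed

lemma T_cdf_lipschitz:
  "A3 M \<theta>\<^sub>0 \<alpha> r C\<^sub>1 C\<^sub>2 C\<^sub>3 \<Longrightarrow> s \<in> {0..1} \<Longrightarrow> t \<in> {0..1} \<Longrightarrow> \<bar>T_cdf t - T_cdf s\<bar> \<le> C\<^sub>2 * \<bar>t - s\<bar>"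
  unfolding A3_def T_cdf_def by blast

lemma excess_lipschitz:
  assumes A3: "A3 M \<theta>\<^sub>0 \<alpha> r C\<^sub>1 C\<^sub>2 C\<^sub>3" and "s \<in> {0..1}" "t \<in> {0..1}"
  shows "\<bar>excess a t - excess a s\<bar> \<le> (1 + \<bar>a\<bar>) * C\<^sub>2 * \<bar>t - s\<bar>"
proof -
  have "\<bar>excess a t - excess a s\<bar> \<le> (1 + \<bar>a\<bar>) * \<bar>T_cdf t - T_cdf s\<bar>"
    using excess_diff_le[of s t a] excess_diff_le[of t s a] T_cdf_mono[of s t] T_cdf_mono[of t s]
    by (cases "s \<le> t") (auto simp: abs_minus_commute)
  also have "\<dots> \<le> (1 + \<bar>a\<bar>) * (C\<^sub>2 * \<bar>t - s\<bar>)"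
    using T_cdf_lipschitz[OF assms] by (intro mult_left_mono) auto
  finally show ?thesis by (simp add: mult.assoc)
qed

text \<open>Continuity of \<open>excess a\<close> makes the set of admissible thresholds closed, so
  its supremum belongs to it.\<close>

lemma excess_t_star_le:
  assumes A3: "A3 M \<theta>\<^sub>0 \<alpha> r C\<^sub>1 C\<^sub>2 C\<^sub>3" and a: "0 \<le> a"
  shows "excess a (t_star M \<theta>\<^sub>0 a) \<le> 0"
proof -
  have "0 < C\<^sub>2" using A3 by (simp add: A3_def)
  have "((1 + \<bar>a\<bar>) * C\<^sub>2)-lipschitz_on {0..1} (excess a)"
    using excess_lipschitz[OF A3] \<open>0 < C\<^sub>2\<close>
    by (intro lipschitz_onI) (auto simp: dist_real_def abs_minus_commute)
  then have "continuous_on {0..1} (excess a)" by (rule lipschitz_on_continuous_on)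
  then have "closed {t \<in> {0..1}. excess a t \<le> 0}"
    by (intro continuous_on_closed_Collect_le continuous_on_const) auto
  then have "Sup {t \<in> {0..1}. excess a t \<le> 0} \<in> {t \<in> {0..1}. excess a t \<le> 0}"
    using zero_in_levels[of a] by (intro closed_contains_Sup bdd_aboveI[of _ 1]) (blast | simp)+
  then show ?thesis unfolding t_star_eq[OF a] by simp
qed

text \<open>If the value were negative, Lipschitz continuity would allow a slightly larger
  threshold, against maximality. There is room for it, because the excess at 1 is positive for
  \<open>a\<close> below \<open>alpha_bar\<close>.\<close>

lemma excess_t_star_ge:
  assumes A3: "A3 M \<theta>\<^sub>0 \<alpha> r C\<^sub>1 C\<^sub>2 C\<^sub>3" and a: "0 \<le> a" "a < alpha_bar M \<theta>\<^sub>0"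
  shows "0 \<le> excess a (t_star M \<theta>\<^sub>0 a)"
proof (rule ccontr)
  define t where "t = t_star M \<theta>\<^sub>0 a"
  define K where "K = (1 + \<bar>a\<bar>) * C\<^sub>2"
  assume "\<not> ?thesis"
  then have neg: "excess a t < 0" by (simp add: t_def)
  have t: "t \<in> {0..1}" unfolding t_def by (rule t_star_range[OF a(1)])
  have K: "0 < K" using A3 by (simp add: K_def A3_def)
  have "0 < excess a 1"
    using a excess_eq[of a 1 0] by (simp add: alpha_bar_eq T_cdf_1)
  then have "t \<noteq> 1" using neg by auto
  \<comment> \<open>This step stays within [0, 1] and raises the excess by at most its
    deficit.\<close>
  define u where "u = min (1 - t) (- excess a t / K)"
  have "0 < u" using t \<open>t \<noteq> 1\<close> neg K by (auto simp: u_def divide_neg_pos)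
  moreover have "u \<le> 1 - t" "u \<le> - excess a t / K" by (simp_all add: u_def)
  ultimately have u: "0 < u" "t + u \<in> {0..1}" "u \<le> - excess a t / K" using t by auto
  have "excess a (t + u) \<le> excess a t + K * u"
    using excess_lipschitz[OF A3 t u(2), of a] u(1) by (simp add: K_def)
  also have "K * u \<le> - excess a t" using u(3) K by (simp add: field_simps)
  finally have "t + u \<le> t" unfolding t_def
    using u(2) by (intro t_star_upper[OF a(1)]) (auto simp: t_def)
  then show False using u(1) by simp
qed

text \<open>The gap between threshold and level is the factor divided out in the Neyman-Pearson
  argument. Without it the integrand of the excess, whose integral is 0, would be nonpositive and
  hence null, so \<open>T0\<close> would almost never lie below the threshold, against
  \<open>alpha_c_less\<close>.\<close>

lemma t_star_gt:
  assumes A3: "A3 M \<theta>\<^sub>0 \<alpha> r C\<^sub>1 C\<^sub>2 C\<^sub>3" and A1: "A1 M \<theta>\<^sub>0"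
    and a: "alpha_c M \<theta>\<^sub>0 < a" "a < alpha_bar M \<theta>\<^sub>0"
  shows "a < t_star M \<theta>\<^sub>0 a"
proof (rule ccontr)
  interpret prob_space P by (rule prob_space_P)
  have a0: "0 \<le> a" using alpha_c_nonneg[OF A1] a by simp
  let ?t = "t_star M \<theta>\<^sub>0 a"
  assume "\<not> ?thesis"
  then have le: "(T0 x - a) * of_bool (T0 x < ?t) \<le> 0" for x by auto
  have "0 = (\<integral>x. - ((T0 x - a) * of_bool (T0 x < ?t)) \<partial>P)"
    using excess_t_star_le[OF A3 a0] excess_t_star_ge[OF A3 a0 a(2)]
    by (simp only: Bochner_Integration.integral_minus excess_def[symmetric])
  then have "AE x in P. - ((T0 x - a) * of_bool (T0 x < ?t)) = 0"
    using le by (subst (asm) eq_commute, subst (asm) integral_nonneg_eq_0_iff_AE)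
      (auto intro!: integrable_excess Bochner_Integration.integrable_minus simp del: mult_eq_0_iff)
  then have "AE x in P. \<not> T0 x < ?t"
    by eventually_elim (use \<open>\<not> a < ?t\<close> in auto)
  then have "T_cdf ?t = 0" unfolding T_cdf_def by (intro prob_eq_0[THEN iffD2]) auto
  then show False using alpha_c_less[OF A1 a(1)] by simp
qed

section \<open>Error rates of procedures\<close>

lemma finite_perms: "finite (perms M)" "perms M \<noteq> {}"
proof -
  show "finite (perms M)" by (simp add: finite_permutations)
  have "id \<in> perms M" by (simp add: permutes_id)
  then show "perms M \<noteq> {}" by blast
qed

lemma cond_exp_obs_measurable [measurable]: "cond_exp_obs M \<theta>\<^sub>0 n f \<in> borel_measurable (S n)"
  unfolding cond_exp_obs_def by measurable

lemma integrable_sample: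
  fixes f :: "(nat \<Rightarrow> nat \<times> rvec) \<Rightarrow> real"
  assumes "f \<in> borel_measurable (S n)" "AE \<omega> in S n. \<bar>f \<omega>\<bar> \<le> B"
  shows "integrable (S n) f"
proof -
  interpret prob_space "S n" by (rule prob_space_sample)
  show ?thesis using assms by (intro integrable_const_bound[where B=B]) auto
qed

lemma T0_coord_measurable [measurable]: "i \<in> {1..n} \<Longrightarrow> (\<lambda>\<omega>. T0 (snd (\<omega> i))) \<in> borel_measurable (S n)"
  by (rule measurable_compose[OF coord_snd_measurable T0_measurable])

lemma selection_measurable:
  assumes "is_procedure M n C"
  shows "(\<lambda>\<omega>. of_bool (i \<in> snd C (obs n \<omega>)) :: real) \<in> borel_measurable (S n)"
    and "(\<lambda>\<omega>. real (card (snd C (obs n \<omega>)))) \<in> borel_measurable (S n)"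
  using measurable_compose[OF obs_measurable procedure_measurable(2)[OF assms]]
    measurable_compose[OF obs_measurable procedure_measurable(3)[OF assms]] by auto

lemma sum_selection:
  assumes "is_procedure M n C" "\<omega> \<in> space (S n)"
  shows "(\<Sum>i\<in>snd C (obs n \<omega>). h i) = (\<Sum>i=1..n. of_bool (i \<in> snd C (obs n \<omega>)) * (h i :: real))"
proof -
  have "(\<Sum>i\<in>snd C (obs n \<omega>). h i) = (\<Sum>i\<in>snd C (obs n \<omega>). of_bool (i \<in> snd C (obs n \<omega>)) * h i)"
    by (intro sum.cong) auto
  also have "\<dots> = (\<Sum>i=1..n. of_bool (i \<in> snd C (obs n \<omega>)) * h i)"
    using procedure_measurable(4)[OF assms(1) obs_in_space[OF assms(2)]]
    by (intro sum.mono_neutral_left) auto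
  finally show ?thesis .
qed

lemma card_selection_le:
  assumes "is_procedure M n C" "\<omega> \<in> space (S n)"
  shows "real (card (snd C (obs n \<omega>))) \<le> real n"
  using card_mono[OF _ procedure_measurable(4)[OF assms(1) obs_in_space[OF assms(2)]]] by simp

text \<open>Neyman-Pearson: \<open>(1{i \<in> S} - 1{T\<^sub>i < t\<^sup>*}) (T\<^sub>i - t\<^sup>*) \<ge> 0\<close> for every selection \<open>S\<close>.\<close>

lemma expected_size_le:
  assumes A1: "A1 M \<theta>\<^sub>0" and A3: "A3 M \<theta>\<^sub>0 \<alpha>' r C\<^sub>1 C\<^sub>2 C\<^sub>3"
    and \<alpha>: "alpha_c M \<theta>\<^sub>0 < \<alpha>" "\<alpha> < alpha_bar M \<theta>\<^sub>0"
    and C: "is_procedure M n C" and mFMR: "mFMR M \<theta>\<^sub>0 n C \<le> \<alpha>"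
  shows "expected_size M \<theta>\<^sub>0 n C \<le> real n * T_cdf (t_star M \<theta>\<^sub>0 \<alpha>)"
proof -
  interpret prob_space "S n" by (rule prob_space_sample)
  define Sel where "Sel \<omega> = snd C (obs n \<omega>)" for \<omega>
  define E where "E = expected_size M \<theta>\<^sub>0 n C"
  define t where "t = t_star M \<theta>\<^sub>0 \<alpha>"
  have E: "E = expectation (\<lambda>\<omega>. real (card (Sel \<omega>)))" by (simp add: E_def expected_size_def Sel_def)
  have E0: "0 \<le> E" unfolding E by simp
  have \<alpha>0: "0 \<le> \<alpha>" using alpha_c_nonneg[OF A1] \<alpha>(1) by simp
  let ?ce = "\<lambda>\<sigma>. cond_exp_obs M \<theta>\<^sub>0 n (\<lambda>\<omega>. misclass (snd C (obs n \<omega>)) (\<sigma> \<circ> fst C (obs n \<omega>)) (lab \<omega>))"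
  \<comment> \<open>A lower bound of the conditional error for every permutation, because
    \<open>T0\<close> is at most 1 minus any posterior.\<close>
  define Y where "Y \<omega> = (\<Sum>i\<in>Sel \<omega>. T0 (snd (\<omega> i)))" for \<omega>
  have ce: "AE \<omega> in S n. ?ce \<sigma> \<omega> = (\<Sum>i\<in>Sel \<omega>. 1 - post M \<theta>\<^sub>0 (\<sigma> (fst C (obs n \<omega>) i)) (snd (\<omega> i)))"
    if "\<sigma> \<in> perms M" for \<sigma>
    using cond_exp_misclass[OF C, of \<sigma> "\<lambda>_. 1"] that by (simp add: Sel_def)
  have Sel_sub: "Sel \<omega> \<subseteq> {1..n}" if "\<omega> \<in> space (S n)" for \<omega>
    using procedure_measurable(4)[OF C obs_in_space[OF that]] by (simp add: Sel_def)
  have ce_bounds: "AE \<omega> in S n. Y \<omega> \<le> ?ce \<sigma> \<omega> \<and> \<bar>?ce \<sigma> \<omega>\<bar> \<le> real n" if \<sigma>: "\<sigma> \<in> perms M" for \<sigma>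
    using ce[OF \<sigma>] AE_space
  proof eventually_elim
    case (elim \<omega>)
    have q: "\<sigma> (fst C (obs n \<omega>) i) \<in> classes M" "snd (\<omega> i) \<in> space L" if "i \<in> Sel \<omega>" for i
      using procedure_measurable(5)[OF C _ obs_in_space[OF elim(2)], of i] Sel_sub[OF elim(2)] that \<sigma>
        permutes_in_image[of \<sigma> "classes M"] space_sampleD(2)[OF elim(2), of i] by auto
    have b: "0 \<le> 1 - post M \<theta>\<^sub>0 (\<sigma> (fst C (obs n \<omega>) i)) (snd (\<omega> i))"
      "1 - post M \<theta>\<^sub>0 (\<sigma> (fst C (obs n \<omega>) i)) (snd (\<omega> i)) \<le> 1" if "i \<in> Sel \<omega>" for i
      using post_bounds[OF true_param q[OF that]] by auto
    have "?ce \<sigma> \<omega> \<le> (\<Sum>i\<in>Sel \<omega>. 1)" unfolding elim(1) by (intro sum_mono b)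
    also have "\<dots> \<le> real n" using card_selection_le[OF C elim(2)] by (simp add: Sel_def)
    finally have "?ce \<sigma> \<omega> \<le> real n" .
    moreover have "0 \<le> ?ce \<sigma> \<omega>" unfolding elim(1) by (intro sum_nonneg b)
    moreover have "Y \<omega> \<le> ?ce \<sigma> \<omega>"
      unfolding elim(1) Y_def by (intro sum_mono Tstat_le q)
    ultimately show ?case by simp
  qed
  have meas [measurable]: "(\<lambda>\<omega>. of_bool (i \<in> Sel \<omega>) :: real) \<in> borel_measurable (S n)"
    "(\<lambda>\<omega>. real (card (Sel \<omega>))) \<in> borel_measurable (S n)" for i
    using selection_measurable[OF C] by (auto simp: Sel_def)
  have Y_eq: "Y \<omega> = (\<Sum>i=1..n. of_bool (i \<in> Sel \<omega>) * T0 (snd (\<omega> i)))" if "\<omega> \<in> space (S n)" for \<omega>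
    unfolding Y_def Sel_def by (rule sum_selection[OF C that])
  have card_eq: "real (card (Sel \<omega>)) = (\<Sum>i=1..n. of_bool (i \<in> Sel \<omega>))" if "\<omega> \<in> space (S n)" for \<omega>
    using sum_selection[OF C that, of "\<lambda>_. 1"] by (simp add: Sel_def)
  have int_Y: "integrable (S n) Y"
  proof -
    have "integrable (S n) (\<lambda>\<omega>. \<Sum>i=1..n. of_bool (i \<in> Sel \<omega>) * T0 (snd (\<omega> i)))"
      using T0_bounds space_sampleD(2)
      by (intro Bochner_Integration.integrable_sum integrable_sample[where B=1] AE_I2) auto
    then show ?thesis
      by (rule Bochner_Integration.integrable_cong[THEN iffD1, rotated 2]) (simp_all add: Y_eq)
  qed
  have int_card: "integrable (S n) (\<lambda>\<omega>. real (card (Sel \<omega>)))"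
    using card_selection_le[OF C]
    by (intro integrable_sample[where B="real n"] meas(2) AE_I2) (simp add: Sel_def)
  have EY: "expectation Y \<le> \<alpha> * E"
  \<comment> \<open>For E = 0 the convention 0/0 = 0 makes the constraint on the mFMR void, but then
    the selection is almost surely empty.\<close>
  proof (cases "E = 0")
    case True
    have "AE \<omega> in S n. real (card (Sel \<omega>)) = 0"
      using True integral_nonneg_eq_0_iff_AE[OF int_card] by (simp add: E)
    then have "AE \<omega> in S n. Y \<omega> = 0"
      using AE_space
    proof eventually_elim
      case (elim \<omega>)
      then have "Sel \<omega> = {}" using finite_subset[OF Sel_sub] by auto
      then show ?case by (simp add: Y_def)
    qed
    then have "expectation Y = 0" by (rule integral_eq_zero_AE)
    then show ?thesis using True by simp
  next
    case False
    have "expectation Y \<le> expectation (\<lambda>\<omega>. MIN \<sigma>\<in>perms M. ?ce \<sigma> \<omega>)"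
    proof (rule integral_mono_AE[OF int_Y])
      show "integrable (S n) (\<lambda>\<omega>. MIN \<sigma>\<in>perms M. ?ce \<sigma> \<omega>)"
      proof (rule integrable_MIN[OF finite_perms])
        fix \<sigma> assume "\<sigma> \<in> perms M"
        from ce_bounds[OF this] show "integrable (S n) (?ce \<sigma>)"
          by (intro integrable_sample[where B="real n"] cond_exp_obs_measurable) auto
      qed
      have "AE \<omega> in S n. \<forall>\<sigma>\<in>perms M. Y \<omega> \<le> ?ce \<sigma> \<omega> \<and> \<bar>?ce \<sigma> \<omega>\<bar> \<le> real n"
        by (intro AE_finite_allI finite_perms ce_bounds)
      then show "AE \<omega> in S n. Y \<omega> \<le> (MIN \<sigma>\<in>perms M. ?ce \<sigma> \<omega>)"
        by eventually_elim (use finite_perms in \<open>auto simp: Min_ge_iff\<close>)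
    qed
    also have "\<dots> \<le> \<alpha> * E"
      using mFMR False E0 by (simp add: mFMR_def E_def[symmetric] pos_divide_le_eq)
    finally show ?thesis .
  qed
  let ?I = "\<lambda>x. of_bool (T0 x < t) :: real"
  have int_I: "integrable (S n) (\<lambda>\<omega>. ?I (snd (\<omega> i)))"
    and int_TI: "integrable (S n) (\<lambda>\<omega>. (T0 (snd (\<omega> i)) - \<alpha>) * ?I (snd (\<omega> i)))" if i: "i \<in> {1..n}" for i
  proof -
    note [measurable] = T0_coord_measurable[OF i]
    show "integrable (S n) (\<lambda>\<omega>. ?I (snd (\<omega> i)))"
      by (intro integrable_sample[where B=1]) auto
    have "\<bar>(T0 (snd (\<omega> i)) - \<alpha>) * ?I (snd (\<omega> i))\<bar> \<le> 1 + \<bar>\<alpha>\<bar>" if "\<omega> \<in> space (S n)" for \<omega>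
      using T0_bounds[OF space_sampleD(2)[OF that i]] by (auto simp: abs_mult)
    then show "integrable (S n) (\<lambda>\<omega>. (T0 (snd (\<omega> i)) - \<alpha>) * ?I (snd (\<omega> i)))"
      by (intro integrable_sample[where B="1 + \<bar>\<alpha>\<bar>"] AE_I2) auto
  qed
  have exp_I: "expectation (\<lambda>\<omega>. \<Sum>i=1..n. ?I (snd (\<omega> i))) = real n * T_cdf t"
    by (subst Bochner_Integration.integral_sum[OF int_I], assumption)
      (simp add: integral_obs_coord[of _ n ?I] T_cdf_integral)
  have exp_TI: "expectation (\<lambda>\<omega>. \<Sum>i=1..n. (T0 (snd (\<omega> i)) - \<alpha>) * ?I (snd (\<omega> i))) = real n * excess \<alpha> t"
    by (subst Bochner_Integration.integral_sum[OF int_TI], assumption)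
      (simp add: integral_obs_coord[of _ n "\<lambda>x. (T0 x - \<alpha>) * ?I x"] excess_def)
  \<comment> \<open>Per index, the right side of the inequality below minus the left one is
    ([i in Sel] - [T0 < t]) (T0 - t), which is nonnegative. The left side isolates the difference of
    the sizes with the factor t - \<alpha>.\<close>
  have "real n * excess \<alpha> t + (t - \<alpha>) * (E - real n * T_cdf t) =
      expectation (\<lambda>\<omega>. (\<Sum>i=1..n. (T0 (snd (\<omega> i)) - \<alpha>) * ?I (snd (\<omega> i))) +
        (t - \<alpha>) * (real (card (Sel \<omega>)) - (\<Sum>i=1..n. ?I (snd (\<omega> i)))))"
    by (simp only: Bochner_Integration.integral_add Bochner_Integration.integral_diff
        Bochner_Integration.integrable_sum Bochner_Integration.integrable_diff
        integrable_mult_right integral_mult_right_zero int_TI int_I int_card exp_I exp_TI E)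
  also have "\<dots> \<le> expectation (\<lambda>\<omega>. Y \<omega> - \<alpha> * real (card (Sel \<omega>)))"
  proof (rule integral_mono)
    show "integrable (S n) (\<lambda>\<omega>. (\<Sum>i=1..n. (T0 (snd (\<omega> i)) - \<alpha>) * ?I (snd (\<omega> i))) +
        (t - \<alpha>) * (real (card (Sel \<omega>)) - (\<Sum>i=1..n. ?I (snd (\<omega> i)))))"
      by (intro Bochner_Integration.integrable_add Bochner_Integration.integrable_diff
          Bochner_Integration.integrable_sum integrable_mult_right int_TI int_I int_card)
    show "integrable (S n) (\<lambda>\<omega>. Y \<omega> - \<alpha> * real (card (Sel \<omega>)))"
      by (intro Bochner_Integration.integrable_diff integrable_mult_right int_Y int_card)
    fix \<omega> assume \<omega>: "\<omega> \<in> space (S n)"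
    have "(\<Sum>i=1..n. (T0 (snd (\<omega> i)) - \<alpha>) * ?I (snd (\<omega> i)) + (t - \<alpha>) * (of_bool (i \<in> Sel \<omega>) - ?I (snd (\<omega> i))))
      \<le> (\<Sum>i=1..n. of_bool (i \<in> Sel \<omega>) * T0 (snd (\<omega> i)) - \<alpha> * of_bool (i \<in> Sel \<omega>))"
      by (intro sum_mono) auto
    then show "(\<Sum>i=1..n. (T0 (snd (\<omega> i)) - \<alpha>) * ?I (snd (\<omega> i))) +
        (t - \<alpha>) * (real (card (Sel \<omega>)) - (\<Sum>i=1..n. ?I (snd (\<omega> i)))) \<le> Y \<omega> - \<alpha> * real (card (Sel \<omega>))"
      unfolding Y_eq[OF \<omega>] card_eq[OF \<omega>]
      by (simp only: sum.distrib sum_subtractf sum_distrib_left[symmetric])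
  qed
  also have "\<dots> = expectation Y - \<alpha> * E"
    using int_Y int_card by (simp add: E)
  also have "\<dots> \<le> 0" using EY by simp
  \<comment> \<open>The excess at \<open>t\<close> is nonnegative and t - \<alpha> is positive, so
    the difference of the sizes is at most 0.\<close>
  finally have "(t - \<alpha>) * (E - real n * T_cdf t) \<le> - real n * excess \<alpha> t" by simp
  also have "\<dots> \<le> 0" using excess_t_star_ge[OF A3 \<alpha>0 \<alpha>(2)] by (simp add: t_def)
  finally have "E - real n * T_cdf t \<le> 0"
    using t_star_gt[OF A3 A1 \<alpha>] by (simp add: t_def mult_le_0_iff)
  then show ?thesis by (simp add: E_def t_def)
qed

section \<open>Relabelling and the plug-in procedure\<close>

lemma post_relabel:
  assumes "\<sigma> permutes classes M"
  shows "post M (relabel \<sigma> \<theta>) q x = post M \<theta> (\<sigma> q) x"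
proof -
  have "(\<Sum>l\<in>classes M. fst \<theta> (\<sigma> l) * dens M (snd \<theta> (\<sigma> l)) x) = (\<Sum>l\<in>classes M. fst \<theta> l * dens M (snd \<theta> l) x)"
    using sum.permute[OF assms, of "\<lambda>l. fst \<theta> l * dens M (snd \<theta> l) x"] by (simp add: comp_def)
  then show ?thesis by (simp add: post_def relabel_def)
qed

lemma Tstat_relabel:
  assumes "\<sigma> permutes classes M"
  shows "Tstat M (relabel \<sigma> \<theta>) x = Tstat M \<theta> x"
proof -
  have "(\<lambda>q. post M \<theta> (\<sigma> q) x) ` classes M = (\<lambda>q. post M \<theta> q x) ` (\<sigma> ` classes M)" by auto
  then show ?thesis
    unfolding Tstat_def by (simp add: post_relabel[OF assms] permutes_image[OF assms])
qed

text \<open>Four bad events are removed: an estimator far from the truth up to relabelling, a large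
  mean oscillation, a sample excess well above its mean, too few observations below the threshold.
  Outside them the argument is deterministic. The bound on \<delta> keeps \<alpha> - \<delta> at or
  above the level that defines \<open>s\<close>, and the bound on \<open>c\<close> then leaves at
  least n s/2 observations below \<open>t\<close>.\<close>

lemma plugin_good_event:
  assumes A1: "A1 M \<theta>\<^sub>0" and A3: "A3 M \<theta>\<^sub>0 \<alpha> r C\<^sub>1 C\<^sub>2 C\<^sub>3"
    and \<alpha>: "alpha_c M \<theta>\<^sub>0 < \<alpha>" "\<alpha> < alpha_bar M \<theta>\<^sub>0"
    and ball: "\<And>y. y \<in> topspace (Euclidean_space (pdim M)) \<Longrightarrow>
      edist (pdim M) y (coord M \<theta>\<^sub>0) < \<epsilon> \<Longrightarrow> y \<in> coord M ` params M"
    and ball_relabel: "\<And>\<sigma> \<theta>. \<sigma> permutes classes M \<Longrightarrow> \<theta> \<in> params M \<Longrightarrow>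
      pdist M (relabel \<sigma> \<theta>) \<theta>\<^sub>0 < \<epsilon> \<Longrightarrow> relabel \<sigma> \<theta> \<in> params M"
    and \<epsilon>: "0 < \<epsilon>" "\<epsilon> \<le> r"
    and D: "countable D" "D \<subseteq> params M"
    and est: "est \<in> obs_space M n \<rightarrow>\<^sub>M count_space D"
    and C: "is_plugin M n \<alpha> est C"
    and n: "2 \<le> n"
    and s: "s = s_star M \<theta>\<^sub>0 \<alpha>"
    and c: "c = sqrt (ln (real n) / real n)" "c \<le> s / 2"
    and \<delta>: "\<delta> = (sqrt \<epsilon> + c) / s" "\<delta> \<le> (\<alpha> - alpha_c M \<theta>\<^sub>0) / 2"
    and t: "t = t_star M \<theta>\<^sub>0 (\<alpha> - \<delta>)"
  obtains Bad where "Bad \<in> sets (S n)"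
    "measure (S n) Bad \<le> C\<^sub>1 * sqrt \<epsilon> + 2 / (real n)\<^sup>2 + eta M \<theta>\<^sub>0 n est \<epsilon>"
    "\<And>\<omega>. \<omega> \<in> space (S n) - Bad \<Longrightarrow>
      (\<Sum>i=1..n. of_bool (T0 (snd (\<omega> i)) < t)) \<le> real (card (snd C (obs n \<omega>)))"
    "\<And>\<omega>. \<omega> \<in> space (S n) - Bad \<Longrightarrow> \<exists>\<tau>\<in>perms M.
      (\<Sum>i\<in>snd C (obs n \<omega>). 1 - post M \<theta>\<^sub>0 (\<tau> (fst C (obs n \<omega>) i)) (snd (\<omega> i)))
        / real (max (card (snd C (obs n \<omega>))) 1) \<le> \<alpha> + 2 / s * sqrt \<epsilon>"
proof -
  interpret prob_space "S n" by (rule prob_space_sample)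
  define a\<^sub>c where "a\<^sub>c = alpha_c M \<theta>\<^sub>0"
  have s_cdf: "s = T_cdf (t_star M \<theta>\<^sub>0 ((\<alpha> + a\<^sub>c) / 2))"
    unfolding s s_star_def T_cdf_def a\<^sub>c_def ..
  have s0: "0 < s" unfolding s_cdf by (intro alpha_c_less[OF A1]) (use \<alpha> in \<open>simp add: a\<^sub>c_def\<close>)
  have ac0: "0 \<le> a\<^sub>c" unfolding a\<^sub>c_def by (rule alpha_c_nonneg[OF A1])
  have \<alpha>01: "0 \<le> \<alpha>" "\<alpha> \<le> 1"
    using ac0 \<alpha> excess_0_bounds(2)[of 1] by (auto simp: a\<^sub>c_def alpha_bar_eq T_cdf_1)
  have C1: "0 < C\<^sub>1" using A3 by (simp add: A3_def)
  have n0: "0 < real n" using n by simp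
  have c0: "0 \<le> c" using n by (simp add: c)
  have \<delta>0: "0 \<le> \<delta>" using \<epsilon> c0 s0 by (simp add: \<delta>)
  have lvl: "(\<alpha> + a\<^sub>c) / 2 \<le> \<alpha> - \<delta>" using \<delta>(2) by (simp add: a\<^sub>c_def field_simps)
  then have lvl0: "0 \<le> \<alpha> - \<delta>" using ac0 \<alpha>01 by simp
  have s_le: "s \<le> T_cdf t"
    unfolding s_cdf t using ac0 \<alpha>01 lvl by (intro T_cdf_mono t_star_mono) auto
  \<comment> \<open>Lowering the level by \<delta> buys a margin of \<delta> times the mass below
    \<open>t\<close>, hence at least \<delta> s = sqrt(\<epsilon>) + c: the first term is for the
    oscillation, the second for Hoeffding.\<close>
  have "excess \<alpha> t = excess (\<alpha> - \<delta>) t - \<delta> * T_cdf t"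
    using excess_eq[of \<alpha> t "\<alpha> - \<delta>"] by simp
  also have "\<dots> \<le> 0 - \<delta> * s"
    using excess_t_star_le[OF A3 lvl0] \<delta>0 s_le by (intro diff_mono mult_left_mono) (auto simp: t)
  also have "\<delta> * s = sqrt \<epsilon> + c" using s0 by (simp add: \<delta>)
  finally have excess_t: "excess \<alpha> t \<le> - (sqrt \<epsilon> + c)" by simp

  \<comment> \<open>All relabelled values of the estimator that can occur near the truth; countable,
    as there are finitely many permutations.\<close>
  define D' where "D' = {\<theta> \<in> (\<Union>\<sigma>\<in>perms M. relabel \<sigma> ` D). \<theta> \<in> params M \<and> pdist M \<theta> \<theta>\<^sub>0 < \<epsilon>}"
  have D': "countable D'" "D' \<subseteq> params M" "\<And>\<theta>. \<theta> \<in> D' \<Longrightarrow> \<theta> \<in> params M \<and> pdist M \<theta> \<theta>\<^sub>0 < \<epsilon>"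
  proof -
    have "countable (\<Union>\<sigma>\<in>perms M. relabel \<sigma> ` D)"
      by (intro countable_UN countable_finite[OF finite_perms(1)] countable_image D(1))
    then show "countable D'" unfolding D'_def by (rule countable_subset[rotated]) auto
  qed (auto simp: D'_def)
  define W :: "(nat \<Rightarrow> nat \<times> rvec) \<Rightarrow> ennreal" where "W \<omega> = (\<Sum>i=1..n. osc D' (snd (\<omega> i)))" for \<omega>
  \<comment> \<open>With this factor \<open>Bad1\<close> says that the mean oscillation is at least
    sqrt(\<epsilon>). Its expectation is at most \<epsilon> times \<open>C\<^sub>1\<close>, which
    Markov's inequality divides by sqrt(\<epsilon>).\<close>
  define k where "k = ennreal (1 / (real n * sqrt \<epsilon>))"
  define g where "g x = (T0 x - \<alpha>) * of_bool (T0 x < t)" for x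
  have osc_m [measurable]: "osc D' \<in> borel_measurable L" by (rule osc_measurable[OF D'(1,2)])
  have osc_i [measurable]: "(\<lambda>\<omega>. osc D' (snd (\<omega> i))) \<in> borel_measurable (S n)" if "i \<in> {1..n}" for i
    using measurable_compose[OF coord_snd_measurable[OF that] osc_m] .
  have W_m [measurable]: "W \<in> borel_measurable (S n)"
    unfolding W_def[abs_def] by measurable
  have g_m [measurable]: "g \<in> borel_measurable L" unfolding g_def[abs_def] by measurable
  have I_m [measurable]: "(\<lambda>x. of_bool (T0 x < t) :: real) \<in> borel_measurable L" by measurable

  define Bad0 where "Bad0 = {\<omega> \<in> space (S n). (MIN \<sigma>\<in>perms M. pdist M (relabel \<sigma> (est (obs n \<omega>))) \<theta>\<^sub>0) \<ge> \<epsilon>}"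
  define Bad1 where "Bad1 = {\<omega> \<in> space (S n). 1 \<le> k * W \<omega>}"
  define Bad2 where "Bad2 = {\<omega> \<in> space (S n). real n * (\<integral>x. g x \<partial>P) + real n * c \<le> (\<Sum>i=1..n. g (snd (\<omega> i)))}"
  define Bad3 where "Bad3 = {\<omega> \<in> space (S n). (\<Sum>i=1..n. of_bool (T0 (snd (\<omega> i)) < t)) \<le>
    real n * (\<integral>x. of_bool (T0 x < t) \<partial>P) - real n * c}"

  \<comment> \<open>The estimator is measurable into a discrete space, so every function of it is
    measurable.\<close>
  have est_obs: "(\<lambda>\<omega>. est (obs n \<omega>)) \<in> S n \<rightarrow>\<^sub>M count_space D"
    by (rule measurable_compose[OF obs_measurable est])
  have [measurable]: "(\<lambda>\<omega>. MIN \<sigma>\<in>perms M. pdist M (relabel \<sigma> (est (obs n \<omega>))) \<theta>\<^sub>0) \<in> borel_measurable (S n)"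
    by (rule measurable_compose[OF est_obs, where g="\<lambda>\<theta>. MIN \<sigma>\<in>perms M. pdist M (relabel \<sigma> \<theta>) \<theta>\<^sub>0"]) simp
  have gi [measurable]: "(\<lambda>\<omega>. g (snd (\<omega> i))) \<in> borel_measurable (S n)" if "i \<in> {1..n}" for i
    by (rule measurable_compose[OF coord_snd_measurable[OF that] g_m])
  have Ii [measurable]: "(\<lambda>\<omega>. of_bool (T0 (snd (\<omega> i)) < t) :: real) \<in> borel_measurable (S n)"
    if "i \<in> {1..n}" for i
    by (rule measurable_compose[OF coord_snd_measurable[OF that] I_m])
  have sets: "Bad0 \<in> sets (S n)" "Bad1 \<in> sets (S n)" "Bad2 \<in> sets (S n)" "Bad3 \<in> sets (S n)"
    unfolding Bad0_def Bad1_def Bad2_def Bad3_def by measurable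

  have p0: "prob Bad0 = eta M \<theta>\<^sub>0 n est \<epsilon>"
    unfolding Bad0_def eta_def ..
  have p1: "prob Bad1 \<le> C\<^sub>1 * sqrt \<epsilon>"
  proof -
    have "emeasure (S n) Bad1 \<le> k * (\<integral>\<^sup>+\<omega>. W \<omega> * indicator (space (S n)) \<omega> \<partial>S n)"
      unfolding Bad1_def by (rule nn_integral_Markov_inequality) auto
    also have "(\<integral>\<^sup>+\<omega>. W \<omega> * indicator (space (S n)) \<omega> \<partial>S n) = (\<integral>\<^sup>+\<omega>. W \<omega> \<partial>S n)"
      by (intro nn_integral_cong) auto
    also have "\<dots> = (\<Sum>i=1..n. \<integral>\<^sup>+x. osc D' x \<partial>P)"
      unfolding W_def
      by (rule trans[OF nn_integral_sum], erule osc_i, intro sum.cong refl nn_integral_obs_coord osc_m)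
    also have "\<dots> \<le> of_nat n * ennreal (\<epsilon> * C\<^sub>1)"
      using nn_integral_osc[OF ball \<epsilon> A3 D'(1,3)] by (auto intro: mult_left_mono)
    also have "k * (of_nat n * ennreal (\<epsilon> * C\<^sub>1)) = ennreal (1 / (real n * sqrt \<epsilon>) * (real n * (\<epsilon> * C\<^sub>1)))"
    proof -
      have nn: "0 \<le> 1 / (real n * sqrt \<epsilon>)" "0 \<le> \<epsilon> * C\<^sub>1" "0 \<le> real n * (\<epsilon> * C\<^sub>1)"
        using \<epsilon> C1 by simp_all
      show ?thesis
        unfolding k_def ennreal_of_nat_eq_real_of_nat ennreal_mult[OF nn(1,3)]
          ennreal_mult[OF of_nat_0_le_iff nn(2)] ..
    qed
    also have "1 / (real n * sqrt \<epsilon>) * (real n * (\<epsilon> * C\<^sub>1)) = C\<^sub>1 * sqrt \<epsilon>"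
      using \<epsilon> n0 by (simp add: field_simps)
    finally have "emeasure (S n) Bad1 \<le> ennreal (C\<^sub>1 * sqrt \<epsilon>)"
      by (simp add: mult_left_mono)
    then show ?thesis using C1 \<epsilon> by (simp add: emeasure_eq_measure)
  qed
  have expc: "exp (- 2 * real n * c\<^sup>2) = 1 / (real n)\<^sup>2"
  proof -
    have "0 \<le> ln (real n)" using n by simp
    then have eq: "- 2 * real n * c\<^sup>2 = - (2 * ln (real n))" using n0 by (simp add: c)
    have "exp (2 * ln (real n)) = (real n)\<^sup>2"
      using exp_of_nat_mult[of 2 "ln (real n)"] n0 by simp
    then show ?thesis unfolding eq exp_minus by (simp add: inverse_eq_divide)
  qed
  have p2: "prob Bad2 \<le> 1 / (real n)\<^sup>2"
    unfolding Bad2_def expc[symmetric]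
  \<comment> \<open>Observations not below the threshold contribute 0, which lies in the interval
    since \<alpha> is between 0 and 1.\<close>
  proof (rule Hoeffding_sample(1)[where a="-\<alpha>"])
    show "g x \<in> {- \<alpha>..- \<alpha> + 1}" if "x \<in> space L" for x
      using T0_bounds[OF that] \<alpha>01 by (auto simp: g_def)
  qed (use n c0 in auto)
  have p3: "prob Bad3 \<le> 1 / (real n)\<^sup>2"
    unfolding Bad3_def expc[symmetric]
    by (rule Hoeffding_sample(2)[where a=0]) (use n c0 in auto)

  show ?thesis
  proof (rule that)
    show "Bad0 \<union> Bad1 \<union> Bad2 \<union> Bad3 \<in> sets (S n)" using sets by auto
    have "prob (Bad0 \<union> Bad1 \<union> Bad2 \<union> Bad3) \<le> prob Bad0 + prob Bad1 + prob Bad2 + prob Bad3"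
      using sets by (intro order_trans[OF measure_Un_le] add_mono) auto
    then show "prob (Bad0 \<union> Bad1 \<union> Bad2 \<union> Bad3) \<le> C\<^sub>1 * sqrt \<epsilon> + 2 / (real n)\<^sup>2 + eta M \<theta>\<^sub>0 n est \<epsilon>"
      using p0 p1 p2 p3 by simp
  next
    fix \<omega> assume \<omega>: "\<omega> \<in> space (S n) - (Bad0 \<union> Bad1 \<union> Bad2 \<union> Bad3)"
    define \<theta> where "\<theta> = est (obs n \<omega>)"
    define Sel where "Sel = snd C (obs n \<omega>)"
    define z where "z = fst C (obs n \<omega>)"
    have \<omega>S: "\<omega> \<in> space (S n)" using \<omega> by simp
    have \<theta>D: "\<theta> \<in> D" using measurable_space[OF est_obs \<omega>S] by (simp add: \<theta>_def)
    have "(MIN \<sigma>\<in>perms M. pdist M (relabel \<sigma> \<theta>) \<theta>\<^sub>0) < \<epsilon>"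
      using \<omega> by (auto simp: Bad0_def \<theta>_def not_le)
    then obtain \<sigma> where \<sigma>: "\<sigma> permutes classes M" "pdist M (relabel \<sigma> \<theta>) \<theta>\<^sub>0 < \<epsilon>"
      using finite_perms by (subst (asm) Min_less_iff) auto
    define \<theta>' where "\<theta>' = relabel \<sigma> \<theta>"
    have \<theta>': "\<theta>' \<in> D'"
      using ball_relabel[OF \<sigma>(1) _ \<sigma>(2)] D(2) \<theta>D \<sigma> by (auto simp: D'_def \<theta>'_def)
    have kW: "k * W \<omega> < 1" using \<omega> by (auto simp: Bad1_def not_le)
    have k0: "k \<noteq> 0" using \<epsilon> n0 by (simp add: k_def)
    \<comment> \<open>As \<open>k\<close> is not zero, the total oscillation is finite, and from
      here on it is handled in the reals.\<close>
    have "W \<omega> < \<top>"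
      using kW k0 by (cases "W \<omega> = \<top>") (auto simp: ennreal_mult_top less_top)
    then have fin: "osc D' (snd (\<omega> i)) < \<top>" if "i \<in> {1..n}" for i
      using that unfolding W_def by simp
    define h where "h i = enn2real (osc D' (snd (\<omega> i)))" for i
    have h: "osc D' (snd (\<omega> i)) = ennreal (h i)" if "i \<in> {1..n}" for i
      using fin[OF that] by (simp add: h_def)
    have h0: "0 \<le> h i" for i by (simp add: h_def)
    have "W \<omega> = ennreal (\<Sum>i=1..n. h i)"
      unfolding W_def using h h0 by (simp add: sum_ennreal[symmetric] del: sum_ennreal)
    then have "ennreal (1 / (real n * sqrt \<epsilon>) * (\<Sum>i=1..n. h i)) < ennreal 1"
      using kW h0 n0 \<epsilon> unfolding k_def by (subst ennreal_mult) (auto intro: sum_nonneg)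
    then have "1 / (real n * sqrt \<epsilon>) * (\<Sum>i=1..n. h i) < 1"
      by (subst (asm) ennreal_less_iff) (use h0 n0 \<epsilon> in \<open>auto intro!: sum_nonneg divide_nonneg_nonneg\<close>)
    then have sum_h: "(\<Sum>i=1..n. h i) < real n * sqrt \<epsilon>"
      using n0 \<epsilon> by (simp add: field_simps)
    have post_h: "\<bar>post M \<theta>' q (snd (\<omega> i)) - post M \<theta>\<^sub>0 q (snd (\<omega> i))\<bar> \<le> h i"
      if "q \<in> classes M" "i \<in> {1..n}" for q i
      using post_le_osc[OF that(1) \<theta>', of "snd (\<omega> i)"] h[OF that(2)] h0 by simp
    define T where "T i = Tstat M \<theta> (snd (\<omega> i))" for i
    have T_le: "T i \<le> T0 (snd (\<omega> i)) + h i" if i: "i \<in> {1..n}" for i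
    proof -
      obtain q where q: "q \<in> classes M" "T0 (snd (\<omega> i)) = 1 - post M \<theta>\<^sub>0 q (snd (\<omega> i))"
        by (rule Tstat_attained)
      have "T i \<le> 1 - post M \<theta>' q (snd (\<omega> i))"
        unfolding T_def Tstat_relabel[OF \<sigma>(1), of \<theta>, symmetric] \<theta>'_def using q(1) by (rule Tstat_le)
      then show ?thesis using post_h[OF q(1) i] q(2) by simp
    qed
    have proc: "is_procedure M n C" using C by (simp add: is_plugin_def)
    have plug: "\<forall>i\<in>{1..n}. is_arg_max (\<lambda>q. post M \<theta> q (obs n \<omega> i)) (\<lambda>q. q \<in> classes M) (z i)"
      "Sel \<subseteq> {1..n}" "card Sel = khat n \<alpha> (\<lambda>i. Tstat M \<theta> (obs n \<omega> i))"
      "\<forall>i\<in>Sel. \<forall>j\<in>{1..n} - Sel. Tstat M \<theta> (obs n \<omega> i) \<le> Tstat M \<theta> (obs n \<omega> j)"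
      using C obs_in_space[OF \<omega>S] unfolding is_plugin_def Let_def \<theta>_def z_def Sel_def by blast+
    define T' where "T' i = Tstat M \<theta> (obs n \<omega> i)" for i
    have T': "T' i = T i" if "i \<in> {1..n}" for i
      using that by (simp add: T'_def T_def obs_apply)
    have card_Sel: "card Sel = khat n \<alpha> T'" using plug(3) by (simp add: T'_def[abs_def])

    define A where "A = {i \<in> {1..n}. T0 (snd (\<omega> i)) < t}"
    have A: "A \<subseteq> {1..n}" by (auto simp: A_def)
    have card_A: "(\<Sum>i=1..n. of_bool (T0 (snd (\<omega> i)) < t)) = real (card A)"
      unfolding A_def by (simp add: sum.If_cases Int_def of_bool_def)
    \<comment> \<open>The Hoeffding error n c and the total oscillation n sqrt(\<epsilon>) are
      exactly what the margin \<open>excess_t\<close> cancels.\<close>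
    have "sum T' A \<le> (\<Sum>i\<in>A. T0 (snd (\<omega> i)) + h i)"
      using A T_le T' by (intro sum_mono) auto
    also have "\<dots> = (\<Sum>i\<in>A. T0 (snd (\<omega> i)) - \<alpha>) + sum h A + \<alpha> * real (card A)"
      by (simp add: sum.distrib sum_subtractf)
    also have "(\<Sum>i\<in>A. T0 (snd (\<omega> i)) - \<alpha>) = (\<Sum>i=1..n. g (snd (\<omega> i)))"
      unfolding A_def g_def by (intro sum.mono_neutral_cong_left) auto
    also have "\<dots> \<le> real n * excess \<alpha> t + real n * c"
      using \<omega> by (auto simp: Bad2_def g_def excess_def)
    also have "sum h A \<le> (\<Sum>i=1..n. h i)" using A h0 by (intro sum_mono2) auto
    also have "\<dots> \<le> real n * sqrt \<epsilon>" using sum_h by simp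
    also have "real n * excess \<alpha> t \<le> real n * (- (sqrt \<epsilon> + c))"
      using excess_t by (intro mult_left_mono) auto
    finally have "sum T' A \<le> \<alpha> * real (card A)" by (simp add: algebra_simps)
    then have card_le: "card A \<le> card Sel"
      unfolding card_Sel using \<alpha>01 A by (intro khat_ge) auto
    then show "(\<Sum>i=1..n. of_bool (T0 (snd (\<omega> i)) < t)) \<le> real (card (snd C (obs n \<omega>)))"
      unfolding card_A by (simp add: Sel_def)

    \<comment> \<open>A selection of order n is required, because the total oscillation will be
      divided by its size; this produces the term 2 / s * sqrt(\<epsilon>).\<close>
    have "real n * T_cdf t - real n * c < real (card A)"
      using \<omega> card_A by (auto simp: Bad3_def T_cdf_integral not_le)
    moreover have "real n * s - real n * (s / 2) \<le> real n * T_cdf t - real n * c"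
      using s_le c(2) by (intro diff_mono mult_left_mono) auto
    moreover have "real (card A) \<le> real (card Sel)" using card_le by simp
    moreover have "real n * s - real n * (s / 2) = real n * s / 2" by simp
    ultimately have big: "real n * s / 2 \<le> real (card Sel)" by linarith
    have pos: "0 < real n * s / 2" using n0 s0 by simp
    have max: "real (max (card Sel) 1) = real (card Sel)" "0 < real (card Sel)"
      using big pos by auto
    \<comment> \<open>Class \<open>q\<close> of the estimate corresponds to class
      \<open>inv \<sigma> q\<close> of the truth, by \<open>post_relabel\<close>; so
      \<open>inv \<sigma>\<close> is the permutation that aligns the assigned classes.\<close>
    have inv: "inv \<sigma> permutes classes M" using \<sigma>(1) by (rule permutes_inv)
    have z: "z i \<in> classes M" "post M \<theta> (z i) (snd (\<omega> i)) = 1 - T i" if i: "i \<in> {1..n}" for i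
    proof -
      have am: "is_arg_max (\<lambda>q. post M \<theta> q (snd (\<omega> i))) (\<lambda>q. q \<in> classes M) (z i)"
        using plug(1) i by (auto simp: obs_apply)
      then show zc: "z i \<in> classes M" by (simp add: is_arg_max_def)
      have "Max ((\<lambda>q. post M \<theta> q (snd (\<omega> i))) ` classes M) = post M \<theta> (z i) (snd (\<omega> i))"
        using am zc by (intro Max_eqI) (auto simp: is_arg_max_linorder)
      then show "post M \<theta> (z i) (snd (\<omega> i)) = 1 - T i" by (simp add: T_def Tstat_def)
    qed
    have "(\<Sum>i\<in>Sel. 1 - post M \<theta>\<^sub>0 (inv \<sigma> (z i)) (snd (\<omega> i))) \<le> (\<Sum>i\<in>Sel. T' i + h i)"
    proof (rule sum_mono)
      fix i assume "i \<in> Sel"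
      then have i: "i \<in> {1..n}" using plug(2) by blast
      have "inv \<sigma> (z i) \<in> classes M" using z(1)[OF i] permutes_in_image[OF inv] by blast
      from post_h[OF this i] have "1 - post M \<theta>\<^sub>0 (inv \<sigma> (z i)) (snd (\<omega> i)) \<le>
          1 - post M \<theta>' (inv \<sigma> (z i)) (snd (\<omega> i)) + h i" by simp
      also have "post M \<theta>' (inv \<sigma> (z i)) (snd (\<omega> i)) = 1 - T' i"
        unfolding \<theta>'_def post_relabel[OF \<sigma>(1)] using z(2)[OF i] T'[OF i]
        by (simp add: permutes_inverses[OF \<sigma>(1)])
      finally show "1 - post M \<theta>\<^sub>0 (inv \<sigma> (z i)) (snd (\<omega> i)) \<le> T' i + h i" by simp
    qed
    also have "\<dots> = sum T' Sel + sum h Sel" by (rule sum.distrib)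
    \<comment> \<open>The selected indices carry the \<open>khat\<close> smallest estimated
      statistics, so their sum is the one bounded in the definition of \<open>khat\<close>.\<close>
    also have "sum T' Sel \<le> (\<Sum>j=1..khat n \<alpha> T'. order_stat n T' j)"
      using plug(2) plug(4) card_Sel by (intro sum_le_sum_order_stat) (auto simp: T'_def)
    also have "\<dots> \<le> \<alpha> * real (card Sel)"
      using sum_khat[OF \<alpha>01(1), of n T'] max by (simp add: card_Sel[symmetric] pos_divide_le_eq)
    also have "sum h Sel \<le> (\<Sum>i=1..n. h i)" using plug(2) h0 by (intro sum_mono2) auto
    also have "\<dots> \<le> real n * sqrt \<epsilon>" using sum_h by simp
    finally have "(\<Sum>i\<in>Sel. 1 - post M \<theta>\<^sub>0 (inv \<sigma> (z i)) (snd (\<omega> i))) / real (card Sel)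
        \<le> (\<alpha> * real (card Sel) + real n * sqrt \<epsilon>) / real (card Sel)"
      by (intro divide_right_mono) auto
    also have "\<dots> = \<alpha> + real n * sqrt \<epsilon> / real (card Sel)" using max(2) by (simp add: add_divide_distrib)
    also have "\<dots> \<le> \<alpha> + real n * sqrt \<epsilon> / (real n * s / 2)"
      using big pos \<epsilon> by (intro add_left_mono divide_left_mono) auto
    also have "\<dots> = \<alpha> + 2 / s * sqrt \<epsilon>" using n0 by simp
    finally show "\<exists>\<tau>\<in>perms M. (\<Sum>i\<in>snd C (obs n \<omega>). 1 - post M \<theta>\<^sub>0 (\<tau> (fst C (obs n \<omega>) i)) (snd (\<omega> i)))
        / real (max (card (snd C (obs n \<omega>))) 1) \<le> \<alpha> + 2 / s * sqrt \<epsilon>"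
      using inv max(1) unfolding Sel_def z_def by (intro bexI[of _ "inv \<sigma>"]) auto
  qed
qed

text \<open>On the bad event the conditional error rate is at most 1 and the count of observations
  below the threshold at most n, so in both bounds it costs its probability. For the size,
  t*(\<alpha> - \<delta>) is compared with t*(\<alpha>) through the two Lipschitz conditions of
  (A3), at the price of \<open>C\<^sub>2 * C\<^sub>3 * \<delta>\<close>.\<close>

lemma plugin_bounds:
  assumes A1: "A1 M \<theta>\<^sub>0" and A3: "A3 M \<theta>\<^sub>0 \<alpha> r C\<^sub>1 C\<^sub>2 C\<^sub>3"
    and \<alpha>: "alpha_c M \<theta>\<^sub>0 < \<alpha>" "\<alpha> < alpha_bar M \<theta>\<^sub>0"
    and ball: "\<And>y. y \<in> topspace (Euclidean_space (pdim M)) \<Longrightarrow>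
      edist (pdim M) y (coord M \<theta>\<^sub>0) < \<epsilon> \<Longrightarrow> y \<in> coord M ` params M"
    and ball_relabel: "\<And>\<sigma> \<theta>. \<sigma> permutes classes M \<Longrightarrow> \<theta> \<in> params M \<Longrightarrow>
      pdist M (relabel \<sigma> \<theta>) \<theta>\<^sub>0 < \<epsilon> \<Longrightarrow> relabel \<sigma> \<theta> \<in> params M"
    and \<epsilon>: "0 < \<epsilon>" "\<epsilon> \<le> r"
    and D: "countable D" "D \<subseteq> params M"
    and est: "est \<in> obs_space M n \<rightarrow>\<^sub>M count_space D"
    and C: "is_plugin M n \<alpha> est C"
    and n: "2 \<le> n"
    and s: "s = s_star M \<theta>\<^sub>0 \<alpha>"
    and c: "c = sqrt (ln (real n) / real n)" "c \<le> s / 2"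
    and \<delta>: "\<delta> = (sqrt \<epsilon> + c) / s" "\<delta> \<le> (\<alpha> - alpha_c M \<theta>\<^sub>0) / 2"
  shows FMR_plugin_le: "FMR M \<theta>\<^sub>0 n C \<le>
      \<alpha> + 2 / s * sqrt \<epsilon> + (C\<^sub>1 * sqrt \<epsilon> + 2 / (real n)\<^sup>2 + eta M \<theta>\<^sub>0 n est \<epsilon>)"
    and expected_size_plugin_ge: "expected_size M \<theta>\<^sub>0 n C / real n \<ge>
      T_cdf (t_star M \<theta>\<^sub>0 \<alpha>) - C\<^sub>2 * C\<^sub>3 * \<delta> - (C\<^sub>1 * sqrt \<epsilon> + 2 / (real n)\<^sup>2 + eta M \<theta>\<^sub>0 n est \<epsilon>)"
proof -
  interpret prob_space "S n" by (rule prob_space_sample)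
  define t where "t = t_star M \<theta>\<^sub>0 (\<alpha> - \<delta>)"
  define p where "p = C\<^sub>1 * sqrt \<epsilon> + 2 / (real n)\<^sup>2 + eta M \<theta>\<^sub>0 n est \<epsilon>"
  obtain Bad where Bad [measurable]: "Bad \<in> sets (S n)" and Bad_p: "prob Bad \<le> p"
    and sel: "\<And>\<omega>. \<omega> \<in> space (S n) - Bad \<Longrightarrow>
      (\<Sum>i=1..n. of_bool (T0 (snd (\<omega> i)) < t)) \<le> real (card (snd C (obs n \<omega>)))"
    and err: "\<And>\<omega>. \<omega> \<in> space (S n) - Bad \<Longrightarrow> \<exists>\<tau>\<in>perms M.
      (\<Sum>i\<in>snd C (obs n \<omega>). 1 - post M \<theta>\<^sub>0 (\<tau> (fst C (obs n \<omega>) i)) (snd (\<omega> i)))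
        / real (max (card (snd C (obs n \<omega>))) 1) \<le> \<alpha> + 2 / s * sqrt \<epsilon>"
    by (rule plugin_good_event[OF A1 A3 \<alpha> _ _ \<epsilon> D est C n s c \<delta> t_def, folded p_def])
      (erule (1) ball, erule (2) ball_relabel, rule that)
  have proc: "is_procedure M n C" using C by (simp add: is_plugin_def)
  have s0: "0 < s"
    using alpha_c_less[OF A1, of "(\<alpha> + alpha_c M \<theta>\<^sub>0) / 2"] \<alpha> by (simp add: s s_star_def T_cdf_def)
  have ac0: "0 \<le> alpha_c M \<theta>\<^sub>0" by (rule alpha_c_nonneg[OF A1])
  have c0: "0 \<le> c" using n by (simp add: c)
  have \<delta>0: "0 \<le> \<delta>" using \<epsilon> c0 s0 by (simp add: \<delta>)
  have int_Bad: "integrable (S n) (indicator Bad :: _ \<Rightarrow> real)"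
    by (intro integrable_real_indicator Bad) (simp add: less_top[symmetric])
  have exp_Bad: "expectation (indicator Bad) = prob Bad"
    using sets.sets_into_space[OF Bad] by (simp add: Int_absorb2)

  show "FMR M \<theta>\<^sub>0 n C \<le> \<alpha> + 2 / s * sqrt \<epsilon> + (C\<^sub>1 * sqrt \<epsilon> + 2 / (real n)\<^sup>2 + eta M \<theta>\<^sub>0 n est \<epsilon>)"
  proof -
    define R where "R \<tau> \<omega> = (\<Sum>i\<in>snd C (obs n \<omega>). 1 - post M \<theta>\<^sub>0 (\<tau> (fst C (obs n \<omega>) i)) (snd (\<omega> i)))
        / real (max (card (snd C (obs n \<omega>))) 1)" for \<tau> \<omega>
    let ?ce = "\<lambda>\<sigma>. cond_exp_obs M \<theta>\<^sub>0 n (\<lambda>\<omega>. misclass (snd C (obs n \<omega>)) (\<sigma> \<circ> fst C (obs n \<omega>)) (lab \<omega>)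
        / real (max (card (snd C (obs n \<omega>))) 1))"
    have ce: "AE \<omega> in S n. ?ce \<sigma> \<omega> = R \<sigma> \<omega>" if "\<sigma> \<in> perms M" for \<sigma>
    proof -
      note [measurable] = procedure_measurable(3)[OF proc]
      have "(\<lambda>x. real (max (card (snd C x)) 1)) = (\<lambda>x. max (real (card (snd C x))) 1)"
        by (simp add: of_nat_max)
      then have "(\<lambda>x. real (max (card (snd C x)) 1)) \<in> borel_measurable (obs_space M n)" by simp
      then show ?thesis
        unfolding R_def using that by (intro cond_exp_misclass[OF proc]) auto
    qed
    have R_le: "R \<tau> \<omega> \<le> 1" if "\<tau> \<in> perms M" "\<omega> \<in> space (S n)" for \<tau> \<omega>
    proof -
      have "(\<Sum>i\<in>snd C (obs n \<omega>). 1 - post M \<theta>\<^sub>0 (\<tau> (fst C (obs n \<omega>) i)) (snd (\<omega> i))) \<le>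
          (\<Sum>i\<in>snd C (obs n \<omega>). 1)"
      proof (rule sum_mono)
        fix i assume "i \<in> snd C (obs n \<omega>)"
        then have i: "i \<in> {1..n}" using procedure_measurable(4)[OF proc obs_in_space[OF that(2)]] by blast
        have "\<tau> (fst C (obs n \<omega>) i) \<in> classes M"
          using procedure_measurable(5)[OF proc i obs_in_space[OF that(2)]] that(1)
            permutes_in_image[of \<tau> "classes M"] by auto
        then show "1 - post M \<theta>\<^sub>0 (\<tau> (fst C (obs n \<omega>) i)) (snd (\<omega> i)) \<le> 1"
          using post_bounds(1)[OF true_param _ space_sampleD(2)[OF that(2) i]] by simp
      qed
      also have "\<dots> \<le> real (max (card (snd C (obs n \<omega>))) 1)" by simp
      finally show ?thesis unfolding R_def by (subst pos_divide_le_eq) auto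
    qed
    have \<alpha>0: "0 \<le> \<alpha> + 2 / s * sqrt \<epsilon>" using ac0 \<alpha> s0 \<epsilon> by simp
    have "FMR M \<theta>\<^sub>0 n C \<le> expectation (\<lambda>\<omega>. \<alpha> + 2 / s * sqrt \<epsilon> + indicator Bad \<omega>)"
      unfolding FMR_def
    \<comment> \<open>This rule asks for integrability and nonnegativity of the upper bound only,
      not for integrability of the minimum.\<close>
    proof (rule integral_mono_AE')
      show "integrable (S n) (\<lambda>\<omega>. \<alpha> + 2 / s * sqrt \<epsilon> + indicator Bad \<omega>)"
        by (intro Bochner_Integration.integrable_add integrable_const int_Bad)
      show "AE \<omega> in S n. 0 \<le> \<alpha> + 2 / s * sqrt \<epsilon> + indicator Bad \<omega>"
        using \<alpha>0 by (intro AE_I2) (auto simp: indicator_def)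
      have "AE \<omega> in S n. \<forall>\<sigma>\<in>perms M. ?ce \<sigma> \<omega> = R \<sigma> \<omega>"
        by (intro AE_finite_allI finite_perms ce)
      then show "AE \<omega> in S n. (MIN \<sigma>\<in>perms M. ?ce \<sigma> \<omega>) \<le> \<alpha> + 2 / s * sqrt \<epsilon> + indicator Bad \<omega>"
        using AE_space
      proof eventually_elim
        case (elim \<omega>)
        have "\<exists>\<tau>\<in>perms M. R \<tau> \<omega> \<le> \<alpha> + 2 / s * sqrt \<epsilon> + indicator Bad \<omega>"
        proof (cases "\<omega> \<in> Bad")
          case True
          obtain \<tau> where \<tau>: "\<tau> \<in> perms M" using finite_perms(2) by blast
          from R_le[OF this elim(2)] show ?thesis using \<alpha>0 True by (intro bexI[OF _ \<tau>]) simp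
        next
          case False
          then show ?thesis using err[of \<omega>] elim(2) by (simp add: R_def)
        qed
        then obtain \<tau> where \<tau>: "\<tau> \<in> perms M" "R \<tau> \<omega> \<le> \<alpha> + 2 / s * sqrt \<epsilon> + indicator Bad \<omega>" by blast
        have "(MIN \<sigma>\<in>perms M. ?ce \<sigma> \<omega>) \<le> ?ce \<tau> \<omega>"
          using finite_perms(1) \<tau>(1) by (intro Min_le) auto
        also have "\<dots> = R \<tau> \<omega>" using elim(1) \<tau>(1) by blast
        finally show ?case using \<tau>(2) by simp
      qed
    qed
    also have "\<dots> = \<alpha> + 2 / s * sqrt \<epsilon> + prob Bad"
      by (simp only: Bochner_Integration.integral_add[OF integrable_const int_Bad] exp_Bad)
        (simp add: prob_space)
    finally show ?thesis using Bad_p by (simp add: p_def)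
  qed

  show "T_cdf (t_star M \<theta>\<^sub>0 \<alpha>) - C\<^sub>2 * C\<^sub>3 * \<delta> - (C\<^sub>1 * sqrt \<epsilon> + 2 / (real n)\<^sup>2 + eta M \<theta>\<^sub>0 n est \<epsilon>)
      \<le> expected_size M \<theta>\<^sub>0 n C / real n"
  proof -
    have lvl0: "0 \<le> \<alpha> - \<delta>" "0 \<le> \<alpha>" using \<delta>(2) \<alpha> ac0 \<delta>0 by auto
    have Ii [measurable]: "(\<lambda>\<omega>. of_bool (T0 (snd (\<omega> i)) < t) :: real) \<in> borel_measurable (S n)"
      if "i \<in> {1..n}" for i
      using T0_coord_measurable[OF that] by measurable
    have int_I: "integrable (S n) (\<lambda>\<omega>. of_bool (T0 (snd (\<omega> i)) < t) :: real)" if "i \<in> {1..n}" for i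
      using Ii[OF that] by (intro integrable_sample[where B=1]) auto
    have int_card: "integrable (S n) (\<lambda>\<omega>. real (card (snd C (obs n \<omega>))))"
      using card_selection_le[OF proc]
      by (intro integrable_sample[where B="real n"] selection_measurable[OF proc] AE_I2) simp
    have "real n * T_cdf t - real n * prob Bad =
        expectation (\<lambda>\<omega>. (\<Sum>i=1..n. of_bool (T0 (snd (\<omega> i)) < t)) - real n * indicator Bad \<omega>)"
    proof -
      have "expectation (\<lambda>\<omega>. \<Sum>i=1..n. of_bool (T0 (snd (\<omega> i)) < t) :: real) = real n * T_cdf t"
        by (subst Bochner_Integration.integral_sum[OF int_I], assumption)
          (simp add: integral_obs_coord[of _ n "\<lambda>x. of_bool (T0 x < t)"] T_cdf_integral)
      then show ?thesis
        by (simp only: Bochner_Integration.integral_diff[OF Bochner_Integration.integrable_sum[OF int_I]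
            integrable_mult_right[OF int_Bad]] integral_mult_right_zero exp_Bad)
    qed
    also have "\<dots> \<le> expected_size M \<theta>\<^sub>0 n C"
      unfolding expected_size_def
    proof (rule integral_mono)
      show "integrable (S n) (\<lambda>\<omega>. (\<Sum>i=1..n. of_bool (T0 (snd (\<omega> i)) < t)) - real n * indicator Bad \<omega>)"
        by (intro Bochner_Integration.integrable_diff Bochner_Integration.integrable_sum
            integrable_mult_right int_I int_Bad)
      fix \<omega> assume \<omega>: "\<omega> \<in> space (S n)"
      \<comment> \<open>On \<open>Bad\<close>, subtracting n makes the left side
        nonpositive.\<close>
      have "(\<Sum>i=1..n. of_bool (T0 (snd (\<omega> i)) < t)) \<le> (\<Sum>i=1..n. 1 :: real)"
        by (intro sum_mono) auto
      then show "(\<Sum>i=1..n. of_bool (T0 (snd (\<omega> i)) < t)) - real n * indicator Bad \<omega>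
          \<le> real (card (snd C (obs n \<omega>)))"
        using sel[of \<omega>] \<omega> by (cases "\<omega> \<in> Bad") auto
    qed (rule int_card)
    finally have "real n * (T_cdf t - prob Bad) \<le> expected_size M \<theta>\<^sub>0 n C" by (simp add: algebra_simps)
    then have "T_cdf t - prob Bad \<le> expected_size M \<theta>\<^sub>0 n C / real n"
      using n by (simp add: pos_le_divide_eq mult.commute)
    moreover have "T_cdf (t_star M \<theta>\<^sub>0 \<alpha>) - T_cdf t \<le> C\<^sub>2 * C\<^sub>3 * \<delta>"
    proof -
      have C2: "0 < C\<^sub>2" using A3 by (simp add: A3_def)
      \<comment> \<open>The local Lipschitz condition on t* applies because \<delta> is at most half
        the distance from \<alpha> to \<open>alpha_c\<close>.\<close>
      have "\<alpha> - \<delta> \<in> {(alpha_c M \<theta>\<^sub>0 + \<alpha>) / 2 .. (\<alpha> + alpha_bar M \<theta>\<^sub>0) / 2}"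
        using \<delta>(2) \<delta>0 \<alpha> by (auto simp: field_simps)
      then have "\<bar>t - t_star M \<theta>\<^sub>0 \<alpha>\<bar> \<le> C\<^sub>3 * \<bar>(\<alpha> - \<delta>) - \<alpha>\<bar>"
        using A3 unfolding A3_def t_def by blast
      then have "\<bar>t_star M \<theta>\<^sub>0 \<alpha> - t\<bar> \<le> C\<^sub>3 * \<delta>" using \<delta>0 by (simp add: abs_minus_commute)
      then have "C\<^sub>2 * \<bar>t_star M \<theta>\<^sub>0 \<alpha> - t\<bar> \<le> C\<^sub>2 * (C\<^sub>3 * \<delta>)" using C2 by (intro mult_left_mono) auto
      moreover have "\<bar>T_cdf (t_star M \<theta>\<^sub>0 \<alpha>) - T_cdf t\<bar> \<le> C\<^sub>2 * \<bar>t_star M \<theta>\<^sub>0 \<alpha> - t\<bar>"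
        by (rule T_cdf_lipschitz[OF A3]) (use t_star_range[OF lvl0(1)] t_star_range[OF lvl0(2)] in \<open>auto simp: t_def\<close>)
      ultimately show ?thesis by simp
    qed
    ultimately show ?thesis using Bad_p by (simp add: p_def)
  qed
qed

end

text \<open>\<open>A\<close> and \<open>B\<close> are quantified before the model, so they depend on
  their arguments only. "For n large" is split in two: \<open>N\<close> and
  \<open>\<epsilon>\<^sub>0\<close> are fixed before the estimator and the sequence, whereas the
  index from which the sequence stays below \<open>\<epsilon>\<^sub>0\<close> depends on the
  sequence.\<close>

theorem theorem2:
  shows "\<exists>A B :: nat \<Rightarrow> real \<Rightarrow> real \<Rightarrow> real \<Rightarrow> nat \<Rightarrow> nat \<Rightarrow> real \<Rightarrow> real.
    (\<forall>Q C\<^sub>1 C\<^sub>2 C\<^sub>3 V V' s. A Q C\<^sub>1 C\<^sub>2 C\<^sub>3 V V' s > 0 \<and> B Q C\<^sub>1 C\<^sub>2 C\<^sub>3 V V' s > 0) \<and>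
    (\<forall>(M :: mixture) \<theta>\<^sub>0 \<alpha> r C\<^sub>1 C\<^sub>2 C\<^sub>3 V V'.
       mixture_model M \<and> \<theta>\<^sub>0 \<in> params M \<and> \<alpha> \<in> {alpha_c M \<theta>\<^sub>0<..<alpha_bar M \<theta>\<^sub>0} \<and>
       A1 M \<theta>\<^sub>0 \<and> A2 M \<theta>\<^sub>0 \<and> A3 M \<theta>\<^sub>0 \<alpha> r C\<^sub>1 C\<^sub>2 C\<^sub>3 \<and>
       vc_post M = enat V \<and> vc_diff M = enat V' \<longrightarrow>
       (let a = A (nclass M) C\<^sub>1 C\<^sub>2 C\<^sub>3 V V' (s_star M \<theta>\<^sub>0 \<alpha>);
            b = B (nclass M) C\<^sub>1 C\<^sub>2 C\<^sub>3 V V' (s_star M \<theta>\<^sub>0 \<alpha>)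
        in \<exists>N::nat. \<exists>\<epsilon>\<^sub>0>0. \<forall>D est (\<epsilon> :: nat \<Rightarrow> real).
             consistent_estimator M \<theta>\<^sub>0 D est \<and> (\<forall>n. \<epsilon> n > 0) \<and> \<epsilon> \<longlonglongrightarrow> 0 \<longrightarrow>
             (\<forall>n C. n \<ge> N \<and> \<epsilon> n \<le> \<epsilon>\<^sub>0 \<and> is_plugin M n \<alpha> (est n) C \<longrightarrow>
                FMR M \<theta>\<^sub>0 n C
                  \<le> \<alpha> + a * sqrt (\<epsilon> n) + b * sqrt (ln (real n) / real n) + 5 / (real n)^2
                      + eta M \<theta>\<^sub>0 n (est n) (\<epsilon> n) \<and>
                (\<forall>C'. is_procedure M n C' \<and> mFMR M \<theta>\<^sub>0 n C' \<le> \<alpha> \<longrightarrow>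
                   expected_size M \<theta>\<^sub>0 n C / real n - expected_size M \<theta>\<^sub>0 n C' / real n
                     \<ge> - a * sqrt (\<epsilon> n) - b * sqrt (ln (real n) / real n) - 5 / (real n)^2
                         - eta M \<theta>\<^sub>0 n (est n) (\<epsilon> n)))))"
proof -
  \<comment> \<open>\<open>C\<^sub>1\<close> pays for Markov's inequality, 2/s for the division by
    the size of the selection, and \<open>C\<^sub>2 * C\<^sub>3 / s\<close> for shifting the
    threshold. The summand 1 and the absolute values give positivity for all real arguments.\<close>
  define A :: "nat \<Rightarrow> real \<Rightarrow> real \<Rightarrow> real \<Rightarrow> nat \<Rightarrow> nat \<Rightarrow> real \<Rightarrow> real"
    where "A Q C\<^sub>1 C\<^sub>2 C\<^sub>3 V V' s = 1 + \<bar>C\<^sub>1\<bar> + 2 / \<bar>s\<bar> + \<bar>C\<^sub>2 * C\<^sub>3 / s\<bar>" for Q C\<^sub>1 C\<^sub>2 C\<^sub>3 V V' s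
  define B :: "nat \<Rightarrow> real \<Rightarrow> real \<Rightarrow> real \<Rightarrow> nat \<Rightarrow> nat \<Rightarrow> real \<Rightarrow> real"
    where "B Q C\<^sub>1 C\<^sub>2 C\<^sub>3 V V' s = 1 + \<bar>C\<^sub>2 * C\<^sub>3 / s\<bar>" for Q C\<^sub>1 C\<^sub>2 C\<^sub>3 V V' s
  show ?thesis
  proof (rule exI[of _ A], rule exI[of _ B], intro conjI allI impI, goal_cases)
    case (1 Q C\<^sub>1 C\<^sub>2 C\<^sub>3 V V' s)
    have "0 \<le> \<bar>C\<^sub>1\<bar> + 2 / \<bar>s\<bar> + \<bar>C\<^sub>2 * C\<^sub>3 / s\<bar>" by (intro add_nonneg_nonneg) simp_all
    then show ?case unfolding A_def by linarith
  next
    case (2 Q C\<^sub>1 C\<^sub>2 C\<^sub>3 V V' s)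
    have "0 \<le> \<bar>C\<^sub>2 * C\<^sub>3 / s\<bar>" by simp
    then show ?case unfolding B_def by linarith
  next
    case (3 M \<theta>\<^sub>0 \<alpha> r C\<^sub>1 C\<^sub>2 C\<^sub>3 V V')
    then interpret mixture_at M \<theta>\<^sub>0 by unfold_locales auto
    have A1: "A1 M \<theta>\<^sub>0" and A3: "A3 M \<theta>\<^sub>0 \<alpha> r C\<^sub>1 C\<^sub>2 C\<^sub>3"
      and \<alpha>: "alpha_c M \<theta>\<^sub>0 < \<alpha>" "\<alpha> < alpha_bar M \<theta>\<^sub>0"
      using 3 by auto
    define s where "s = s_star M \<theta>\<^sub>0 \<alpha>"
    define a where "a = A (nclass M) C\<^sub>1 C\<^sub>2 C\<^sub>3 V V' s"
    define b where "b = B (nclass M) C\<^sub>1 C\<^sub>2 C\<^sub>3 V V' s"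
    \<comment> \<open>If sqrt(\<epsilon>) and \<open>c\<close> are both at most \<kappa>, then
      \<delta> is at most 2 \<kappa> / s, which is half of \<alpha> - alpha_c.\<close>
    define \<kappa> where "\<kappa> = s * (\<alpha> - alpha_c M \<theta>\<^sub>0) / 4"
    have C: "0 < r" "0 < C\<^sub>1" "0 < C\<^sub>2" "0 < C\<^sub>3" using A3 by (auto simp: A3_def)
    have s0: "0 < s"
      using alpha_c_less[OF A1, of "(\<alpha> + alpha_c M \<theta>\<^sub>0) / 2"] \<alpha> by (simp add: s_def s_star_def T_cdf_def)
    have \<kappa>0: "0 < \<kappa>" using s0 \<alpha> by (simp add: \<kappa>_def)
    have a_eq: "a = 1 + C\<^sub>1 + 2 / s + C\<^sub>2 * C\<^sub>3 / s" and b_eq: "b = 1 + C\<^sub>2 * C\<^sub>3 / s"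
      using C s0 by (simp_all add: a_def b_def A_def B_def)
    obtain \<rho> where \<rho>: "0 < \<rho>"
      "\<And>y. y \<in> topspace (Euclidean_space (pdim M)) \<Longrightarrow> edist (pdim M) y (coord M \<theta>\<^sub>0) < \<rho> \<Longrightarrow>
        y \<in> coord M ` params M"
      "\<And>\<sigma> \<theta>. \<sigma> permutes classes M \<Longrightarrow> \<theta> \<in> params M \<Longrightarrow> pdist M (relabel \<sigma> \<theta>) \<theta>\<^sub>0 < \<rho> \<Longrightarrow>
        relabel \<sigma> \<theta> \<in> params M"
      by (rule params_ball, rule that)
    have "(\<lambda>n. sqrt (ln (real n) / real n)) \<longlonglongrightarrow> sqrt 0"
      by (intro tendsto_real_sqrt lim_ln_over_n)
    then have "eventually (\<lambda>n. sqrt (ln (real n) / real n) < min \<kappa> (s / 2)) sequentially"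
      using \<kappa>0 s0 by (intro order_tendstoD) auto
    then obtain N0 where N0: "\<And>n. N0 \<le> n \<Longrightarrow> sqrt (ln (real n) / real n) < min \<kappa> (s / 2)"
      by (auto simp: eventually_sequentially)
    \<comment> \<open>The three bounds keep sqrt(\<epsilon>) below \<kappa>, the ball within the
      radius where (A3) controls the gradients, and nearby relabelled estimates inside the parameter
      set.\<close>
    define \<epsilon>\<^sub>0 where "\<epsilon>\<^sub>0 = min (\<kappa>\<^sup>2) (min r \<rho>)"
    have \<epsilon>\<^sub>0: "0 < \<epsilon>\<^sub>0" using \<kappa>0 C \<rho>(1) by (simp add: \<epsilon>\<^sub>0_def)
    show ?case
      unfolding Let_def s_def[symmetric] a_def[symmetric] b_def[symmetric]
    proof (intro exI[of _ "max 2 N0"] exI[of _ \<epsilon>\<^sub>0] conjI \<epsilon>\<^sub>0 allI impI)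
      fix D est and \<epsilon> :: "nat \<Rightarrow> real" and n Cp
      assume "consistent_estimator M \<theta>\<^sub>0 D est \<and> (\<forall>n. 0 < \<epsilon> n) \<and> \<epsilon> \<longlonglongrightarrow> 0"
        and "max 2 N0 \<le> n \<and> \<epsilon> n \<le> \<epsilon>\<^sub>0 \<and> is_plugin M n \<alpha> (est n) Cp"
      then have D: "countable D" "D \<subseteq> params M" and est: "est n \<in> obs_space M n \<rightarrow>\<^sub>M count_space D"
        and \<epsilon>: "0 < \<epsilon> n" "\<epsilon> n \<le> r" "\<epsilon> n \<le> \<rho>" "\<epsilon> n \<le> \<kappa>\<^sup>2"
        and n: "2 \<le> n" "N0 \<le> n" and plugin: "is_plugin M n \<alpha> (est n) Cp"
        by (auto simp: consistent_estimator_def \<epsilon>\<^sub>0_def)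
      define c where "c = sqrt (ln (real n) / real n)"
      define \<delta> where "\<delta> = (sqrt (\<epsilon> n) + c) / s"
      have c: "0 \<le> c" "c \<le> s / 2" "c \<le> \<kappa>" using N0[OF n(2)] n(1) by (simp_all add: c_def)
      have "sqrt (\<epsilon> n) \<le> \<kappa>" using \<epsilon>(4) \<kappa>0 by (intro real_le_lsqrt) auto
      then have "\<delta> \<le> (\<kappa> + \<kappa>) / s" unfolding \<delta>_def using c(3) s0 by (intro divide_right_mono add_mono) auto
      then have \<delta>: "\<delta> \<le> (\<alpha> - alpha_c M \<theta>\<^sub>0) / 2" using s0 by (simp add: \<kappa>_def)
      have ball: "y \<in> coord M ` params M"
        if "y \<in> topspace (Euclidean_space (pdim M))" "edist (pdim M) y (coord M \<theta>\<^sub>0) < \<epsilon> n" for y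
        using \<rho>(2)[OF that(1)] that(2) \<epsilon>(3) by simp
      have ball_relabel: "relabel \<sigma> \<theta> \<in> params M"
        if "\<sigma> permutes classes M" "\<theta> \<in> params M" "pdist M (relabel \<sigma> \<theta>) \<theta>\<^sub>0 < \<epsilon> n" for \<sigma> \<theta>
        using \<rho>(3)[OF that(1,2)] that(3) \<epsilon>(3) by simp
      note bounds = plugin_bounds[OF A1 A3 \<alpha> ball ball_relabel \<epsilon>(1,2) D est plugin n(1) s_def c_def c(2) \<delta>_def \<delta>]
      have nonneg: "0 \<le> sqrt (\<epsilon> n)" "0 \<le> 1 / (real n)\<^sup>2" "0 \<le> C\<^sub>1 * sqrt (\<epsilon> n)" "0 \<le> 2 / s * sqrt (\<epsilon> n)"
        "0 \<le> C\<^sub>2 * C\<^sub>3 / s * sqrt (\<epsilon> n)" "0 \<le> C\<^sub>2 * C\<^sub>3 / s * c"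
        using \<epsilon> C s0 c by simp_all
      \<comment> \<open>Each product becomes an atom, so that passing to the coarser constants is
        linear arithmetic that drops nonnegative terms.\<close>
      have split: "a * sqrt (\<epsilon> n) = sqrt (\<epsilon> n) + C\<^sub>1 * sqrt (\<epsilon> n) + 2 / s * sqrt (\<epsilon> n) + C\<^sub>2 * C\<^sub>3 / s * sqrt (\<epsilon> n)"
        "b * c = c + C\<^sub>2 * C\<^sub>3 / s * c" "5 / (real n)\<^sup>2 = 5 * (1 / (real n)\<^sup>2)" "2 / (real n)\<^sup>2 = 2 * (1 / (real n)\<^sup>2)"
        "C\<^sub>2 * C\<^sub>3 * \<delta> = C\<^sub>2 * C\<^sub>3 / s * sqrt (\<epsilon> n) + C\<^sub>2 * C\<^sub>3 / s * c"
        by (simp_all add: a_eq b_eq \<delta>_def distrib_right distrib_left add_divide_distrib)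
      have FMR: "FMR M \<theta>\<^sub>0 n Cp \<le> \<alpha> + 2 / s * sqrt (\<epsilon> n) +
          (C\<^sub>1 * sqrt (\<epsilon> n) + 2 / (real n)\<^sup>2 + eta M \<theta>\<^sub>0 n (est n) (\<epsilon> n))"
        by (rule bounds(1))
      show "FMR M \<theta>\<^sub>0 n Cp \<le> \<alpha> + a * sqrt (\<epsilon> n) + b * sqrt (ln (real n) / real n) + 5 / (real n)\<^sup>2
          + eta M \<theta>\<^sub>0 n (est n) (\<epsilon> n)"
        using FMR nonneg c(1) unfolding c_def[symmetric] split by linarith
      fix C' assume C': "is_procedure M n C' \<and> mFMR M \<theta>\<^sub>0 n C' \<le> \<alpha>"
      have "expected_size M \<theta>\<^sub>0 n C' / real n \<le> T_cdf (t_star M \<theta>\<^sub>0 \<alpha>)"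
        using expected_size_le[OF A1 A3 \<alpha>, of n C'] C' n(1) by (simp add: pos_divide_le_eq mult.commute)
      moreover have "T_cdf (t_star M \<theta>\<^sub>0 \<alpha>) - C\<^sub>2 * C\<^sub>3 * \<delta>
          - (C\<^sub>1 * sqrt (\<epsilon> n) + 2 / (real n)\<^sup>2 + eta M \<theta>\<^sub>0 n (est n) (\<epsilon> n)) \<le> expected_size M \<theta>\<^sub>0 n Cp / real n"
        by (rule bounds(2))
      ultimately show "- a * sqrt (\<epsilon> n) - b * sqrt (ln (real n) / real n) - 5 / (real n)\<^sup>2
          - eta M \<theta>\<^sub>0 n (est n) (\<epsilon> n) \<le> expected_size M \<theta>\<^sub>0 n Cp / real n - expected_size M \<theta>\<^sub>0 n C' / real n"
        using nonneg c(1) unfolding c_def[symmetric] split mult_minus_left by linarith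
    qed
  qed
qed

end
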